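(* Let $0<\alpha<1$, $T>0$, let $(X,\|\cdot\|)$ be a Banach space, let $A:D(A)\subset X\to X$ be a closed densely defined linear operator which generates an $\alpha$-order fractional resolvent $\{S(t)\}_{t>0}$, let $x\in X$, let $r$ be a continuous real-valued function on $\{(t,s):0\le s\le t\le T\}$ and $(Ku)(t)=\int_0^t r(t,s)u(s)\,ds$, let $f:[0,T]\times X\times X\to X$ be continuous, and let $g:C_{1-\alpha}([0,T],X)\to X$. Assume the following. (1) There exist constants $\alpha_1,\alpha_2\in(0,\alpha)$ and real-valued functions $m_1\in L^{1/\alpha_1}([0,T],\mathbb{R})$, $m_2\in L^{1/\alpha_2}([0,T],\mathbb{R})$ such that for all $t\in[0,T]$ and $u_1,u_2,v_1,v_2\in X$, $$\|f(t,u_1,u_2)-f(t,v_1,v_2)\|\le m_1(t)\|u_1-v_1\|+m_2(t)\|u_2-v_2\|.$$ (2) There exist a constant $\alpha_3\in(0,\alpha)$ and a real-valued function $h\in L^{1/\alpha_3}([0,T],\mathbb{R})$ such that $\|f(t,u_1,v_1)\|\le h(t)$ for all $t\in[0,T]$ and $u_1,v_1\in X$. (3) There exists a constant $b$ such that $\|g(u)-g(v)\|\le b\|u-v\|_*$ for all $u,v\in C_{1-\alpha}([0,T],X)$. Put $M=\sup_{t\in(0,T]}\|t^{1-\alpha}S(t)\|$, $N=\max_{0\le s\le t\le T}|r(t,s)|$, $M_1=\|m_1\|_{L^{1/\alpha_1}([0,T],\mathbb{R})}$ and $M_2=\|m_2\|_{L^{1/\alpha_2}([0,T],\mathbb{R})}$.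 If $$\Omega:=Mb+\frac{MM_1T^{1-\alpha_1}}{\left(\frac{\alpha-\alpha_1}{1-\alpha_1}\right)^{1-\alpha_1}}+\frac{MM_2NT^{\alpha+1-\alpha_2}}{\alpha\left(\frac{\alpha-\alpha_2}{1-\alpha_2}\right)^{1-\alpha_2}}<1,$$ then the nonlocal Riemann-Liouville fractional problem with data $(A,f,K,x,g)$ has a unique mild solution $u\in C_{1-\alpha}([0,T],X)$.
   Context: **Function space.** $C_{1-\alpha}([0,T],X)$ is the space of functions $u:(0,T]\to X$ such that $t\mapsto t^{1-\alpha}u(t)$ is continuous on $(0,T]$ and extends continuously to $[0,T]$, with the norm $\|u\|_*=\|u\|_{C_{1-\alpha}([0,T];X)}=\sup_{t\in[0,T]}\|t^{1-\alpha}u(t)\|$ (the value at $t=0$ being the limit). **Fractional integral.** For $\beta>0$ and $u\in L^1((0,T);X)$, $J_t^\beta u(t)=\frac{1}{\Gamma(\beta)}\int_0^t(t-\tau)^{\beta-1}u(\tau)\,d\tau$. **Fractional resolvent.** For $0<\alpha<1$, a family $\{S(t)\}_{t>0}$ of bounded linear operators on $X$ is an $\alpha$-order fractional resolvent if: (P1) for every $y\in X$, $S(\cdot)y\in C((0,\infty),X)$ and $\lim_{t\to0^+}\Gamma(\alpha)t^{1-\alpha}S(t)y=y$; (P2) $S(s)S(t)=S(t)S(s)$ for all $s,t>0$; (P3) for all $s,t>0$, $S(t)J_s^\alpha S(s)-J_t^\alpha S(t)S(s)=\frac{t^{\alpha-1}}{\Gamma(\alpha)}J_s^\alpha S(s)-\frac{s^{\alpha-1}}{\Gamma(\alpha)}J_t^\alpha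 S(t)$, where $J_t^\alpha S(t)y=\frac1{\Gamma(\alpha)}\int_0^t(t-\tau)^{\alpha-1}S(\tau)y\,d\tau$. Its generator $A$ is defined by $Ay=\Gamma(2\alpha)\lim_{t\to0^+}t^{-\alpha}\left(t^{1-\alpha}S(t)y-\frac{y}{\Gamma(\alpha)}\right)$, with $D(A)$ the set of $y\in X$ for which this limit exists. **Mild solution.** A function $u\in C((0,T],X)$ is a mild solution of the nonlocal Riemann-Liouville fractional problem with data $(A,f,K,x,g)$ (the problem $D_t^\alpha u(t)=Au(t)+f(t,t^{1-\alpha}u(t),(Ku)(t))$, $t\in(0,T]$, with a nonlocal initial condition on $\lim_{t\to0^+}\Gamma(\alpha)t^{1-\alpha}u(t)$ determined by $x$ and $g$) if $J_t^\alpha u(t)\in D(A)$ for $t\in(0,T]$ and $$u(t)=\frac{t^{\alpha-1}}{\Gamma(\alpha)}[x-g(u)]+AJ_t^\alpha u(t)+J_t^\alpha f(t,t^{1-\alpha}u(t),(Ku)(t)),\quad t\in(0,T],$$ where the last term is the $\alpha$-order fractional integral of $s\mapsto f(s,s^{1-\alpha}u(s),(Ku)(s))$ at $t$. *)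

theory Defs
  imports "HOL-Analysis.Analysis"
begin

text \<open>
  A function \<open>(0,T] \<rightarrow> X\<close> is represented by a total function on the reals that is extensional on
  \<open>{0<..T}\<close>, so that HOL equality of such functions is equality on \<open>(0,T]\<close>.

  Integrals of \<open>X\<close>-valued functions are Henstock--Kurzweil integrals, because the library's Bochner
  integral requires \<open>X\<close> to be second countable. A Bochner integrable function is Henstock--Kurzweil
  integrable with the same integral. For the resolvents, the elements of the weighted space and
  the nonlinearities considered below, the integrands are continuous on the open interval
  \<open>(0,t)\<close> and have integrable norm, so they are Bochner integrable. The value of the integrand
  at the endpoints is irrelevant.
\<close>

definition weighted :: "real \<Rightarrow> (real \<Rightarrow> 'a::real_normed_vector) \<Rightarrow> real \<Rightarrow> 'a" where
  "weighted \<alpha> u t =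
     (if t = 0 then Lim (at_right 0) (\<lambda>s. s powr (1 - \<alpha>) *\<^sub>R u s)
      else t powr (1 - \<alpha>) *\<^sub>R u t)"

text \<open>
  If the limit at \<open>0\<close> does not exist, then \<^const>\<open>weighted\<close> is discontinuous at \<open>0\<close> whatever
  its value there; hence continuity on \<open>{0..T}\<close> includes the existence of the limit.
\<close>

definition weighted_space :: "real \<Rightarrow> real \<Rightarrow> (real \<Rightarrow> 'a::real_normed_vector) set" where
  "weighted_space \<alpha> T = {u \<in> extensional {0<..T}. continuous_on {0..T} (weighted \<alpha> u)}"

definition weighted_norm :: "real \<Rightarrow> real \<Rightarrow> (real \<Rightarrow> 'a::real_normed_vector) \<Rightarrow> real" where
  "weighted_norm \<alpha> T u = (SUP t\<in>{0..T}. norm (weighted \<alpha> u t))"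

definition frac_integral :: "real \<Rightarrow> (real \<Rightarrow> 'a::real_normed_vector) \<Rightarrow> real \<Rightarrow> 'a" where
  "frac_integral \<beta> u t =
     (1 / Gamma \<beta>) *\<^sub>R integral {0..t} (\<lambda>\<tau>. (t - \<tau>) powr (\<beta> - 1) *\<^sub>R u \<tau>)"

text \<open>Only the operators \<open>S t\<close> with \<open>t > 0\<close> matter.\<close>

definition fractional_resolvent :: "real \<Rightarrow> (real \<Rightarrow> 'a::banach \<Rightarrow>\<^sub>L 'a) \<Rightarrow> bool" where
  "fractional_resolvent \<alpha> S \<longleftrightarrow>
     (\<forall>y. continuous_on {0<..} (\<lambda>t. blinfun_apply (S t) y) \<and>
          ((\<lambda>t. (Gamma \<alpha> * t powr (1 - \<alpha>)) *\<^sub>R blinfun_apply (S t) y) \<longlongrightarrow> y) (at_right 0)) \<and>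
     (\<forall>s>0. \<forall>t>0. S s o\<^sub>L S t = S t o\<^sub>L S s) \<and>
     (\<forall>s>0. \<forall>t>0. \<forall>y.
        blinfun_apply (S t) (frac_integral \<alpha> (\<lambda>\<tau>. blinfun_apply (S \<tau>) y) s)
          - frac_integral \<alpha> (\<lambda>\<tau>. blinfun_apply (S \<tau>) (blinfun_apply (S s) y)) t
        = (t powr (\<alpha> - 1) / Gamma \<alpha>) *\<^sub>R frac_integral \<alpha> (\<lambda>\<tau>. blinfun_apply (S \<tau>) y) s
          - (s powr (\<alpha> - 1) / Gamma \<alpha>) *\<^sub>R frac_integral \<alpha> (\<lambda>\<tau>. blinfun_apply (S \<tau>) y) t)"

definition generator_quotient ::
    "real \<Rightarrow> (real \<Rightarrow> 'a::banach \<Rightarrow>\<^sub>L 'a) \<Rightarrow> 'a \<Rightarrow> real \<Rightarrow> 'a" where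
  "generator_quotient \<alpha> S y t =
     t powr (- \<alpha>) *\<^sub>R (t powr (1 - \<alpha>) *\<^sub>R blinfun_apply (S t) y - (1 / Gamma \<alpha>) *\<^sub>R y)"

definition generator_domain :: "real \<Rightarrow> (real \<Rightarrow> 'a::banach \<Rightarrow>\<^sub>L 'a) \<Rightarrow> 'a set" where
  "generator_domain \<alpha> S = {y. \<exists>z. (generator_quotient \<alpha> S y \<longlongrightarrow> z) (at_right 0)}"

definition generator :: "real \<Rightarrow> (real \<Rightarrow> 'a::banach \<Rightarrow>\<^sub>L 'a) \<Rightarrow> 'a \<Rightarrow> 'a" where
  "generator \<alpha> S y = Gamma (2 * \<alpha>) *\<^sub>R Lim (at_right 0) (generator_quotient \<alpha> S y)"

text \<open>
  An unbounded operator is a pair of a domain \<open>D\<close> and a total function \<open>A\<close> whose values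
  outside \<open>D\<close> are irrelevant.
\<close>

definition generates ::
    "real \<Rightarrow> 'a set \<Rightarrow> ('a \<Rightarrow> 'a) \<Rightarrow> (real \<Rightarrow> 'a::banach \<Rightarrow>\<^sub>L 'a) \<Rightarrow> bool" where
  "generates \<alpha> D A S \<longleftrightarrow>
     fractional_resolvent \<alpha> S \<and> D = generator_domain \<alpha> S \<and> (\<forall>y\<in>D. A y = generator \<alpha> S y)"

definition linear_operator :: "'a::real_vector set \<Rightarrow> ('a \<Rightarrow> 'a) \<Rightarrow> bool" where
  "linear_operator D A \<longleftrightarrow>
     subspace D \<and> (\<forall>y\<in>D. \<forall>z\<in>D. A (y + z) = A y + A z) \<and> (\<forall>c. \<forall>y\<in>D. A (c *\<^sub>R y) = c *\<^sub>R A y)"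

definition closed_operator :: "'a::real_normed_vector set \<Rightarrow> ('a \<Rightarrow> 'a) \<Rightarrow> bool" where
  "closed_operator D A \<longleftrightarrow> closed ((\<lambda>y. (y, A y)) ` D)"

definition densely_defined :: "'a::real_normed_vector set \<Rightarrow> bool" where
  "densely_defined D \<longleftrightarrow> closure D = UNIV"

definition in_Lp :: "real \<Rightarrow> real set \<Rightarrow> (real \<Rightarrow> real) \<Rightarrow> bool" where
  "in_Lp p I m \<longleftrightarrow> m \<in> borel_measurable (lebesgue_on I) \<and>
     integrable (lebesgue_on I) (\<lambda>t. \<bar>m t\<bar> powr p)"

definition Lp_norm :: "real \<Rightarrow> real set \<Rightarrow> (real \<Rightarrow> real) \<Rightarrow> real" where
  "Lp_norm p I m = (LINT t|lebesgue_on I. \<bar>m t\<bar> powr p) powr (1 / p)"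

definition volterra ::
    "(real \<Rightarrow> real \<Rightarrow> real) \<Rightarrow> (real \<Rightarrow> 'a::real_normed_vector) \<Rightarrow> real \<Rightarrow> 'a" where
  "volterra r u t = integral {0..t} (\<lambda>s. r t s *\<^sub>R u s)"

definition mild_solution ::
    "real \<Rightarrow> real \<Rightarrow> 'a::banach set \<Rightarrow> ('a \<Rightarrow> 'a) \<Rightarrow> (real \<Rightarrow> 'a \<Rightarrow> 'a \<Rightarrow> 'a) \<Rightarrow>
      ((real \<Rightarrow> 'a) \<Rightarrow> real \<Rightarrow> 'a) \<Rightarrow> 'a \<Rightarrow> ((real \<Rightarrow> 'a) \<Rightarrow> 'a) \<Rightarrow> (real \<Rightarrow> 'a) \<Rightarrow> bool" where
  "mild_solution \<alpha> T D A f K x g u \<longleftrightarrow>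
     continuous_on {0<..T} u \<and>
     (\<forall>t\<in>{0<..T}. frac_integral \<alpha> u t \<in> D) \<and>
     (\<forall>t\<in>{0<..T}.
        u t = (t powr (\<alpha> - 1) / Gamma \<alpha>) *\<^sub>R (x - g u) + A (frac_integral \<alpha> u t)
              + frac_integral \<alpha> (\<lambda>s. f s (s powr (1 - \<alpha>) *\<^sub>R u s) (K u s)) t)"

end

theory Submission
  imports Defs
begin

text \<open>
  Write \<open>P(t) = t\<^sup>1\<^sup>-\<^sup>\<alpha>S(t)\<close>, which extends strongly continuously to \<open>t = 0\<close>. Every integral that occurs is
  then a product of powers integrated against a continuous function, so Henstock--Kurzweil integration
  suffices, and Dirichlet's formula for the iterated integrals follows from the continuous case by truncating
  the powers. From (P3) and this formula, the linear problem with continuous forcing \<open>F\<close> and initial value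
  \<open>y\<close> has exactly one mild solution in the weighted space, \<open>S(t)y + (S * F)(t)\<close>; uniqueness
  reduces to the injectivity of \<open>J\<^sup>\<alpha>\<close>. Hence the mild solutions of the nonlinear problem correspond to the
  fixed points of a map on continuous functions on \<open>[0,T]\<close>, and by Hoelder's inequality that map is
  Lipschitz with constant \<open>\<Omega> < 1\<close>. For \<open>u\<close> in the weighted space the
  forcing \<open>s \<mapsto> f(s, s\<^sup>1\<^sup>-\<^sup>\<alpha>u(s), (Ku)(s))\<close> is continuous on \<open>[0,T]\<close>.
\<close>

text \<open>A mild solution provides only that \<open>frac_integral \<alpha> u t\<close> lies in
  \<open>D\<close>, so \<open>A\<close> is never moved through an integral. Bounded operators stand
  in for it: \<open>Q \<sigma>\<close>, the difference quotient whose limit is \<open>A\<close> up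
  to the factor Gamma(2\<alpha>), and \<open>W \<sigma>\<close>, the rescaled fractional integral of
  \<open>S\<close>. By (P3), \<open>Q \<sigma>\<close> maps \<open>V t y\<close> to
  \<open>W \<sigma>\<close> of an explicit vector. This identity survives integration, and only
  afterwards is \<sigma> sent to 0; that limit gives membership in the domain and the value of
  \<open>A\<close> together. The number \<Omega> arises as follows. The nonlocal condition costs M
  b. If two arguments differ by at most d, their forcings differ at s in [0,t] by at most (|m1(s)| +
  |m2(s)| N t^\<alpha>/\<alpha>) d. Hoelder against (t-s)^(\<alpha>-1) gives t^(\<alpha>-\<alpha>i)
  over the displayed denominator, and the weight t^(1-\<alpha>) raises the exponent to 1-\<alpha>i.
  The condition \<alpha>i < \<alpha> is exactly integrability of
  (t-s)^((\<alpha>-1)/(1-\<alpha>i)).\<close>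

section \<open>Products of a singular kernel and a continuous function\<close>

lemma integrable_on_if_dominated_approx:
  fixes F :: "real \<Rightarrow> 'a::banach" and k :: "real \<Rightarrow> real"
  assumes k: "k integrable_on {a..b}"
    and approx: "\<And>e. e > 0 \<Longrightarrow> \<exists>G. G integrable_on {a..b} \<and> (\<forall>x\<in>{a..b}. norm (F x - G x) \<le> e * k x)"
  shows "F integrable_on {a..b}"
proof -
  let ?I = "integral {a..b} k"
  let ?s = "\<lambda>H D. (\<Sum>(x,K)\<in>D. measure lborel K *\<^sub>R H x)"
  have k0: "k x \<ge> 0" if "x \<in> {a..b}" for x
    using approx[of 1] that by (metis mult_1 norm_ge_zero order_trans zero_less_one)
  have I0: "?I \<ge> 0"
    using k k0 by (intro Henstock_Kurzweil_Integration.integral_nonneg) auto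
  have "\<exists>\<gamma>. gauge \<gamma> \<and> (\<forall>D1 D2. D1 tagged_division_of (cbox a b) \<and> \<gamma> fine D1 \<and>
      D2 tagged_division_of (cbox a b) \<and> \<gamma> fine D2 \<longrightarrow> norm (?s F D1 - ?s F D2) < e)" if e: "e > 0" for e
  proof -
    \<comment> \<open>Two replacements of \<open>F\<close> by \<open>G\<close> cost e/4 each, and
      the Cauchy property of \<open>G\<close> costs e/2. The summand 1 absorbs the gauge error for
      \<open>k\<close> and keeps the denominator positive.\<close>
    define d where "d = e / (4 * (?I + 1))"
    have d0: "d > 0" using e I0 by (simp add: d_def)
    obtain G where G: "G integrable_on {a..b}" "\<And>x. x \<in> {a..b} \<Longrightarrow> norm (F x - G x) \<le> d * k x"
      using approx[OF d0] by blast
    have "\<exists>\<gamma>. gauge \<gamma> \<and> (\<forall>D1 D2. D1 tagged_division_of (cbox a b) \<and> \<gamma> fine D1 \<and>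
      D2 tagged_division_of (cbox a b) \<and> \<gamma> fine D2 \<longrightarrow> norm (?s G D1 - ?s G D2) < e / 2)"
      using G(1) e by (intro integrable_Cauchy[THEN iffD1, rule_format]) auto
    then obtain \<gamma>1 where g1: "gauge \<gamma>1" "\<And>D1 D2. \<lbrakk>D1 tagged_division_of (cbox a b); \<gamma>1 fine D1;
      D2 tagged_division_of (cbox a b); \<gamma>1 fine D2\<rbrakk> \<Longrightarrow> norm (?s G D1 - ?s G D2) < e / 2"
      by (elim exE conjE) (rule that, assumption, simp)
    have "(k has_integral ?I) (cbox a b)"
      using k by (simp add: integrable_integral)
    then obtain \<gamma>2 where g2: "gauge \<gamma>2" "\<And>D. \<lbrakk>D tagged_division_of (cbox a b); \<gamma>2 fine D\<rbrakk> \<Longrightarrow>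
        norm (?s k D - ?I) < 1"
      unfolding has_integral by (meson zero_less_one)
    have diff: "norm (?s F D - ?s G D) \<le> e / 4"
      if D: "D tagged_division_of (cbox a b)" "\<gamma>2 fine D" for D
    proof -
      have "norm (?s F D - ?s G D) = norm (\<Sum>(x,K)\<in>D. measure lborel K *\<^sub>R (F x - G x))"
        by (simp add: sum_subtractf[symmetric] scaleR_diff_right case_prod_unfold)
      also have "\<dots> \<le> (\<Sum>(x,K)\<in>D. measure lborel K * (d * k x))"
      proof (rule sum_norm_le, clarify)
        fix x K assume "(x, K) \<in> D"
        then have "x \<in> {a..b}" using D(1) by (metis box_real(2) subsetD tagged_division_ofD(2,3))
        then show "norm (measure lborel K *\<^sub>R (F x - G x)) \<le> measure lborel K * (d * k x)"
          using G(2)[of x] by (simp add: mult_left_mono)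
      qed
      also have "\<dots> = d * ?s k D"
        by (simp add: sum_distrib_left case_prod_unfold algebra_simps)
      also have "\<dots> \<le> d * (?I + 1)"
      proof -
        have "?s k D \<le> ?I + 1" using g2(2)[OF D] by (simp add: abs_less_iff)
        then show ?thesis using d0 by (simp add: mult_left_mono)
      qed
      also have "\<dots> = e / 4" using I0 by (simp add: d_def field_simps)
      finally show ?thesis .
    qed
    have "norm (?s F D1 - ?s F D2) < e"
      if "D1 tagged_division_of (cbox a b)" "(\<lambda>x. \<gamma>1 x \<inter> \<gamma>2 x) fine D1"
        "D2 tagged_division_of (cbox a b)" "(\<lambda>x. \<gamma>1 x \<inter> \<gamma>2 x) fine D2" for D1 D2
    proof -
      have f: "\<gamma>1 fine D1" "\<gamma>2 fine D1" "\<gamma>1 fine D2" "\<gamma>2 fine D2"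
        using that(2,4) by (simp_all add: fine_Int)
      have tri: "norm (v - w) < e" if "norm (v - v') \<le> e / 4" "norm (v' - w') < e / 2" "norm (w - w') \<le> e / 4"
        for v v' w w' :: 'a
        using that by norm
      show ?thesis
        by (rule tri[OF diff[OF that(1) f(2)] g1(2)[OF that(1) f(1) that(3) f(3)] diff[OF that(3) f(4)]])
    qed
    then show ?thesis
      using gauge_Int[OF g1(1) g2(1)] by (intro exI conjI allI impI) auto
  qed
  then show ?thesis
    using integrable_Cauchy[of F a b] by simp
qed

text \<open>A continuous factor need not preserve Henstock-Kurzweil integrability in general; with
  \<open>k\<close> nonnegative it does. On short intervals \<psi> is within e of a constant, so
  \<open>k\<close> times that constant is an approximant with error at most \<open>e * k\<close>,
  and Bolzano's bisection principle glues the pieces.\<close>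

lemma integrable_on_scaleR_continuous:
  fixes k :: "real \<Rightarrow> real" and \<psi> :: "real \<Rightarrow> 'a::banach"
  assumes k: "k integrable_on {a..b}" and k0: "\<And>x. x \<in> {a..b} \<Longrightarrow> 0 \<le> k x"
    and \<psi>: "continuous_on {a..b} \<psi>"
  shows "(\<lambda>x. k x *\<^sub>R \<psi> x) integrable_on {a..b}"
proof (cases "a \<le> b")
  case True
  show ?thesis
  proof (rule integrable_on_if_dominated_approx[OF k])
    fix e :: real assume e: "e > 0"
    define Q where "Q = (\<lambda>c d. a \<le> c \<longrightarrow> d \<le> b \<longrightarrow>
      (\<exists>G. G integrable_on {c..d} \<and> (\<forall>x\<in>{c..d}. norm (k x *\<^sub>R \<psi> x - G x) \<le> e * k x)))"
    have "Q a b"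
      using True
    proof (induction rule: Bolzano)
      case (trans p q s)
      show ?case unfolding Q_def
      proof (intro impI)
        assume "a \<le> p" "s \<le> b"
        then obtain G H where G: "G integrable_on {p..q}"
            "\<And>x. x \<in> {p..q} \<Longrightarrow> norm (k x *\<^sub>R \<psi> x - G x) \<le> e * k x"
          and H: "H integrable_on {q..s}" "\<And>x. x \<in> {q..s} \<Longrightarrow> norm (k x *\<^sub>R \<psi> x - H x) \<le> e * k x"
          using trans(1,2)[unfolded Q_def] trans(3,4) by (meson order_trans)
        let ?J = "\<lambda>x. if x \<le> q then G x else H x"
        have "?J integrable_on {p..q}"
          using G(1) by (rule integrable_eq) auto
        moreover have "?J integrable_on {q..s}"
          using H(1) by (rule integrable_spike[where S = "{q}"]) auto
        ultimately have "?J integrable_on {p..s}"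
          using trans(3,4) by (rule Henstock_Kurzweil_Integration.integrable_combine[rotated 2])
        moreover have "\<forall>x\<in>{p..s}. norm (k x *\<^sub>R \<psi> x - ?J x) \<le> e * k x"
          using G(2) H(2) by auto
        ultimately show "\<exists>G. G integrable_on {p..s} \<and> (\<forall>x\<in>{p..s}. norm (k x *\<^sub>R \<psi> x - G x) \<le> e * k x)"
          by blast
      qed
    next
      case (local x)
      then have "x \<in> {a..b}" by simp
      then obtain d where d: "d > 0" "\<And>y. y \<in> {a..b} \<Longrightarrow> dist y x < d \<Longrightarrow> dist (\<psi> y) (\<psi> x) < e"
        using \<psi> e unfolding continuous_on_iff by metis
      show ?case
      proof (intro exI[of _ d] conjI allI impI d(1))
        fix p q assume pq: "p \<le> x \<and> x \<le> q \<and> q - p < d"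
        show "Q p q" unfolding Q_def
        proof (intro impI exI[of _ "\<lambda>y. k y *\<^sub>R \<psi> x"] conjI ballI)
          assume ab: "a \<le> p" "q \<le> b"
          have "k integrable_on {p..q}"
            using k by (rule integrable_on_subinterval) (use ab in auto)
          then show "(\<lambda>y. k y *\<^sub>R \<psi> x) integrable_on {p..q}"
            by (rule integrable_on_scaleR_left)
          fix y assume y: "y \<in> {p..q}"
          then have "dist (\<psi> y) (\<psi> x) < e" 
            using pq ab by (intro d(2)) (auto simp: dist_real_def)
          then have "k y * norm (\<psi> y - \<psi> x) \<le> k y * e"
            using k0[of y] y ab by (intro mult_left_mono) (auto simp: dist_norm)
          then show "norm (k y *\<^sub>R \<psi> y - k y *\<^sub>R \<psi> x) \<le> e * k y"
            using k0[of y] y ab by (simp flip: scaleR_diff_right add: mult.commute)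
        qed
      qed
    qed
    then show "\<exists>G. G integrable_on {a..b} \<and> (\<forall>x\<in>{a..b}. norm (k x *\<^sub>R \<psi> x - G x) \<le> e * k x)"
      by (simp add: Q_def)
  qed
qed (simp add: integrable_on_empty)

lemma norm_integral_scaleR_le:
  fixes k :: "real \<Rightarrow> real" and \<psi> :: "real \<Rightarrow> 'a::banach"
  assumes k: "k integrable_on {a..b}" and k0: "\<And>x. x \<in> {a..b} \<Longrightarrow> 0 \<le> k x"
    and \<psi>: "continuous_on {a..b} \<psi>" and C: "\<And>x. x \<in> {a..b} \<Longrightarrow> norm (\<psi> x) \<le> C"
  shows "norm (integral {a..b} (\<lambda>x. k x *\<^sub>R \<psi> x)) \<le> C * integral {a..b} k"
proof -
  have "norm (integral {a..b} (\<lambda>x. k x *\<^sub>R \<psi> x)) \<le> integral {a..b} (\<lambda>x. C * k x)"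
  proof (rule integral_norm_bound_integral)
    show "(\<lambda>x. C * k x) integrable_on {a..b}" 
      using k integrable_on_cmult_left by fastforce
    show "norm (k x *\<^sub>R \<psi> x) \<le> C * k x" if "x \<in> {a..b}" for x
      using mult_left_mono[OF C[OF that] k0[OF that]] k0[OF that] by (simp add: mult.commute)
  qed (rule integrable_on_scaleR_continuous[OF k k0 \<psi>])
  then show ?thesis by simp
qed

lemma continuous_on_integral_scaleR:
  fixes k :: "real \<Rightarrow> real" and H :: "real \<Rightarrow> real \<Rightarrow> 'a::banach"
  assumes k: "k integrable_on {a..b}" and k0: "\<And>x. x \<in> {a..b} \<Longrightarrow> 0 \<le> k x"
    and H: "continuous_on ({c..d} \<times> {a..b}) (\<lambda>(t, x). H t x)"
  shows "continuous_on {c..d} (\<lambda>t. integral {a..b} (\<lambda>x. k x *\<^sub>R H t x))"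
  unfolding continuous_on_iff
proof (intro ballI allI impI)
  fix t e :: real assume t: "t \<in> {c..d}" and e: "e > 0"
  let ?I = "integral {a..b} k"
  have I0: "?I \<ge> 0"
    using k k0 by (intro Henstock_Kurzweil_Integration.integral_nonneg) auto
  have Hc: "continuous_on {a..b} (H t)" if "t \<in> {c..d}" for t
    using continuous_on_compose2[OF H, of "{a..b}" "Pair t"] that
    by (force intro: continuous_on_Pair)
  define \<epsilon> where "\<epsilon> = e / (2 * (?I + 1))"
  have \<epsilon>: "\<epsilon> > 0" using e I0 by (simp add: \<epsilon>_def)
  have "uniformly_continuous_on ({c..d} \<times> {a..b}) (\<lambda>(t, x). H t x)"
    by (intro compact_uniformly_continuous H compact_Times compact_Icc)
  then obtain \<delta> where \<delta>: "\<delta> > 0" "\<And>p q. p \<in> {c..d} \<times> {a..b} \<Longrightarrow> q \<in> {c..d} \<times> {a..b} \<Longrightarrow>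
      dist q p < \<delta> \<Longrightarrow> dist ((\<lambda>(t, x). H t x) q) ((\<lambda>(t, x). H t x) p) < \<epsilon>"
    using \<epsilon> unfolding uniformly_continuous_on_def by metis
  show "\<exists>\<delta>>0. \<forall>t'\<in>{c..d}. dist t' t < \<delta> \<longrightarrow>
    dist (integral {a..b} (\<lambda>x. k x *\<^sub>R H t' x)) (integral {a..b} (\<lambda>x. k x *\<^sub>R H t x)) < e"
  proof (intro exI[of _ \<delta>] conjI ballI impI \<delta>(1))
    fix t' assume t': "t' \<in> {c..d}" "dist t' t < \<delta>"
    have "integral {a..b} (\<lambda>x. k x *\<^sub>R H t' x) - integral {a..b} (\<lambda>x. k x *\<^sub>R H t x)
        = integral {a..b} (\<lambda>x. k x *\<^sub>R (H t' x - H t x))"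
      using integrable_on_scaleR_continuous[OF k k0 Hc[OF t]] integrable_on_scaleR_continuous[OF k k0 Hc[OF t'(1)]]
      by (simp add: Henstock_Kurzweil_Integration.integral_diff[symmetric] scaleR_diff_right)
    also have "norm \<dots> \<le> \<epsilon> * ?I"
    proof (rule norm_integral_scaleR_le[OF k k0])
      show "continuous_on {a..b} (\<lambda>x. H t' x - H t x)"
        using Hc t t' by (intro continuous_intros) auto
      fix x assume x: "x \<in> {a..b}"
      have "dist (t', x) (t, x) = dist t' t" by (simp add: dist_Pair_Pair)
      then have "dist (H t' x) (H t x) < \<epsilon>"
        using \<delta>(2)[of "(t, x)" "(t', x)"] x t t' by auto
      then show "norm (H t' x - H t x) \<le> \<epsilon>" by (simp add: dist_norm)
    qed simp
    also have "\<dots> < e"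
    proof -
      have "\<epsilon> * ?I \<le> \<epsilon> * (?I + 1)" using \<epsilon> by simp
      also have "\<dots> = e / 2" using I0 by (simp add: \<epsilon>_def field_simps)
      finally show ?thesis using e by simp
    qed
    finally show "dist (integral {a..b} (\<lambda>x. k x *\<^sub>R H t' x)) (integral {a..b} (\<lambda>x. k x *\<^sub>R H t x)) < e"
      by (simp add: dist_norm)
  qed
qed

text \<open>The kernel \<open>K\<close> may be singular; \<open>E\<close> controls the error made by truncating it.\<close>

lemma integral_swap_scaleR:
  fixes K E :: "real \<Rightarrow> real \<Rightarrow> real" and \<Phi> :: "real \<Rightarrow> real \<Rightarrow> 'a::banach"
  assumes \<Phi>: "continuous_on ({a..b} \<times> {a..b}) (\<lambda>(x, y). \<Phi> x y)"
    and approx: "\<And>e. e > 0 \<Longrightarrow> \<exists>K'. continuous_on ({a..b} \<times> {a..b}) (\<lambda>(x, y). K' x y) \<and>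
        (\<forall>x\<in>{a..b}. \<forall>y\<in>{a..b}. \<bar>K x y - K' x y\<bar> \<le> e * E x y)"
    and K0: "\<And>x y. 0 \<le> K x y"
    and K1: "\<And>x. x \<in> {a..b} \<Longrightarrow> (\<lambda>y. K x y) integrable_on {a..b}"
    and K2: "\<And>y. y \<in> {a..b} \<Longrightarrow> (\<lambda>x. K x y) integrable_on {a..b}"
    and E1: "\<And>x. x \<in> {a..b} \<Longrightarrow> (\<lambda>y. E x y) integrable_on {a..b}"
    and E2: "\<And>y. y \<in> {a..b} \<Longrightarrow> (\<lambda>x. E x y) integrable_on {a..b}"
    and E12: "(\<lambda>x. integral {a..b} (\<lambda>y. E x y)) integrable_on {a..b}"
    and E21: "(\<lambda>y. integral {a..b} (\<lambda>x. E x y)) integrable_on {a..b}"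
  shows "integral {a..b} (\<lambda>x. integral {a..b} (\<lambda>y. K x y *\<^sub>R \<Phi> x y))
       = integral {a..b} (\<lambda>y. integral {a..b} (\<lambda>x. K x y *\<^sub>R \<Phi> x y))"
proof -
  have \<Phi>1: "continuous_on {a..b} (\<Phi> x)" if "x \<in> {a..b}" for x
    using continuous_on_compose2[OF \<Phi>, of "{a..b}" "Pair x"] that
    by (force intro: continuous_on_Pair)
  have \<Phi>2: "continuous_on {a..b} (\<lambda>x. \<Phi> x y)" if "y \<in> {a..b}" for y
    using continuous_on_compose2[OF \<Phi>, of "{a..b}" "\<lambda>x. (x, y)"] that
    by (force intro: continuous_on_Pair)
  have "bounded ((\<lambda>(x, y). \<Phi> x y) ` ({a..b} \<times> {a..b}))"
    by (intro compact_imp_bounded compact_continuous_image \<Phi> compact_Times compact_Icc)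
  then obtain C where C0: "C > 0" and "\<forall>z\<in>(\<lambda>(x, y). \<Phi> x y) ` ({a..b} \<times> {a..b}). norm z \<le> C"
    unfolding bounded_pos by blast
  then have C: "norm (\<Phi> x y) \<le> C" if "x \<in> {a..b}" "y \<in> {a..b}" for x y
    using that by auto
  have I1: "(\<lambda>y. K x y *\<^sub>R \<Phi> x y) integrable_on {a..b}" if "x \<in> {a..b}" for x
    using that by (intro integrable_on_scaleR_continuous K1 K0 \<Phi>1)
  have I2: "(\<lambda>x. K x y *\<^sub>R \<Phi> x y) integrable_on {a..b}" if "y \<in> {a..b}" for y
    using that by (intro integrable_on_scaleR_continuous K2 K0 \<Phi>2)
  \<comment> \<open>A single truncation \<open>L\<close> serves both orders of integration, so the
    exchange for the continuous \<open>L\<close> links the two iterated integrals. The accuracy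
    \<open>e / C\<close> compensates for the bound \<open>C\<close> on \<Phi>.\<close>
  have appr: "\<exists>L. continuous_on ({a..b} \<times> {a..b}) (\<lambda>(x, y). L x y) \<and>
     (\<forall>x\<in>{a..b}. norm (integral {a..b} (\<lambda>y. K x y *\<^sub>R \<Phi> x y) - integral {a..b} (\<lambda>y. L x y))
        \<le> e * integral {a..b} (\<lambda>y. E x y)) \<and>
     (\<forall>y\<in>{a..b}. norm (integral {a..b} (\<lambda>x. K x y *\<^sub>R \<Phi> x y) - integral {a..b} (\<lambda>x. L x y))
        \<le> e * integral {a..b} (\<lambda>x. E x y)) \<and>
     (\<lambda>x. integral {a..b} (\<lambda>y. L x y :: 'a)) integrable_on {a..b} \<and> (\<lambda>y. integral {a..b} (\<lambda>x. L x y)) integrable_on {a..b} \<and>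
     integral {a..b} (\<lambda>x. integral {a..b} (\<lambda>y. L x y)) = integral {a..b} (\<lambda>y. integral {a..b} (\<lambda>x. L x y))"
    if e: "e > 0" for e
  proof -
    obtain K' where K': "continuous_on ({a..b} \<times> {a..b}) (\<lambda>(x, y). K' x y)"
      "\<And>x y. x \<in> {a..b} \<Longrightarrow> y \<in> {a..b} \<Longrightarrow> \<bar>K x y - K' x y\<bar> \<le> (e / C) * E x y"
      using approx[of "e / C"] e C0 by (auto simp: divide_pos_pos)
    define L where "L = (\<lambda>x y. K' x y *\<^sub>R \<Phi> x y)"
    have Lc: "continuous_on ({a..b} \<times> {a..b}) (\<lambda>(x, y). L x y)"
      using K'(1) \<Phi> unfolding L_def case_prod_unfold by (intro continuous_intros)
    have L1: "continuous_on {a..b} (L x)" if "x \<in> {a..b}" for x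
      using continuous_on_compose2[OF Lc, of "{a..b}" "Pair x"] that
      by (force intro: continuous_on_Pair)
    have L2: "continuous_on {a..b} (\<lambda>x. L x y)" if "y \<in> {a..b}" for y
      using continuous_on_compose2[OF Lc, of "{a..b}" "\<lambda>x. (x, y)"] that
      by (force intro: continuous_on_Pair)
    have est: "norm (K x y *\<^sub>R \<Phi> x y - L x y) \<le> e * E x y" if "x \<in> {a..b}" "y \<in> {a..b}" for x y
    proof -
      have "norm (K x y *\<^sub>R \<Phi> x y - L x y) = \<bar>K x y - K' x y\<bar> * norm (\<Phi> x y)"
        by (simp add: L_def flip: scaleR_diff_left)
      also have "\<dots> \<le> ((e / C) * E x y) * C"
        using K'(2)[OF that] C[OF that] by (intro mult_mono) auto
      finally show ?thesis using C0 by simp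
    qed
    have Ls: "continuous_on {a..b} (\<lambda>x. integral {a..b} (\<lambda>y. 1 *\<^sub>R L x y))"
      by (rule continuous_on_integral_scaleR) (use Lc in auto)
    have "continuous_on ({a..b} \<times> {a..b}) (\<lambda>(y, x). L x y)"
      using swap_continuous[of a a b b L] Lc by (simp add: cbox_Pair_eq)
    then have Ls2: "continuous_on {a..b} (\<lambda>y. integral {a..b} (\<lambda>x. 1 *\<^sub>R L x y))"
      by (intro continuous_on_integral_scaleR) auto
    show ?thesis
    proof (intro exI[of _ L] conjI ballI Lc)
      fix x assume x: "x \<in> {a..b}"
      have "integral {a..b} (\<lambda>y. K x y *\<^sub>R \<Phi> x y) - integral {a..b} (L x)
         = integral {a..b} (\<lambda>y. K x y *\<^sub>R \<Phi> x y - L x y)"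
        using I1[OF x] integrable_continuous_real[OF L1[OF x]]
        by (simp add: Henstock_Kurzweil_Integration.integral_diff)
      also have "norm \<dots> \<le> integral {a..b} (\<lambda>y. e * E x y)"
        using I1[OF x] integrable_continuous_real[OF L1[OF x]] E1[OF x] est[OF x]
        by (intro integral_norm_bound_integral integrable_diff integrable_on_mult_right) auto
      finally show "norm (integral {a..b} (\<lambda>y. K x y *\<^sub>R \<Phi> x y) - integral {a..b} (L x)) \<le> e * integral {a..b} (E x)"
        by simp
    next
      fix y assume y: "y \<in> {a..b}"
      have "integral {a..b} (\<lambda>x. K x y *\<^sub>R \<Phi> x y) - integral {a..b} (\<lambda>x. L x y)
         = integral {a..b} (\<lambda>x. K x y *\<^sub>R \<Phi> x y - L x y)"
        using I2[OF y] integrable_continuous_real[OF L2[OF y]]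
        by (simp add: Henstock_Kurzweil_Integration.integral_diff)
      also have "norm \<dots> \<le> integral {a..b} (\<lambda>x. e * E x y)"
        using I2[OF y] integrable_continuous_real[OF L2[OF y]] E2[OF y] est[OF _ y]
        by (intro integral_norm_bound_integral integrable_diff integrable_on_mult_right) auto
      finally show "norm (integral {a..b} (\<lambda>x. K x y *\<^sub>R \<Phi> x y) - integral {a..b} (\<lambda>x. L x y)) \<le> e * integral {a..b} (\<lambda>x. E x y)"
        by simp
    next
      show "integral {a..b} (\<lambda>x. integral {a..b} (L x)) = integral {a..b} (\<lambda>y. integral {a..b} (\<lambda>x. L x y))"
        using integral_swap_continuous[of a a b b L] Lc by (simp add: cbox_Pair_eq)
    qed (use Ls Ls2 integrable_continuous_real in force)+
  qed
  let ?P = "\<lambda>x. integral {a..b} (\<lambda>y. K x y *\<^sub>R \<Phi> x y)" and ?Q = "\<lambda>y. integral {a..b} (\<lambda>x. K x y *\<^sub>R \<Phi> x y)"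
  have P: "?P integrable_on {a..b}"
    by (rule integrable_on_if_dominated_approx[OF E12]) (use appr in blast)
  have Q: "?Q integrable_on {a..b}"
    by (rule integrable_on_if_dominated_approx[OF E21]) (use appr in blast)
  let ?B = "integral {a..b} (\<lambda>x. integral {a..b} (\<lambda>y. E x y)) + integral {a..b} (\<lambda>y. integral {a..b} (\<lambda>x. E x y))"
  have "norm (integral {a..b} ?P - integral {a..b} ?Q) \<le> e * ?B" if e: "e > 0" for e
  proof -
    obtain L where
      1: "\<And>x. x \<in> {a..b} \<Longrightarrow> norm (?P x - integral {a..b} (\<lambda>y. L x y)) \<le> e * integral {a..b} (\<lambda>y. E x y)" and
      2: "\<And>y. y \<in> {a..b} \<Longrightarrow> norm (?Q y - integral {a..b} (\<lambda>x. L x y)) \<le> e * integral {a..b} (\<lambda>x. E x y)" and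
      3: "(\<lambda>x. integral {a..b} (\<lambda>y. L x y :: 'a)) integrable_on {a..b}" and
      4: "(\<lambda>y. integral {a..b} (\<lambda>x. L x y)) integrable_on {a..b}" and
      5: "integral {a..b} (\<lambda>x. integral {a..b} (\<lambda>y. L x y)) = integral {a..b} (\<lambda>y. integral {a..b} (\<lambda>x. L x y))"
      using appr[OF e] by (elim exE conjE) (rule that; (assumption | erule (1) bspec))
    have eq: "integral {a..b} ?P - integral {a..b} ?Q = integral {a..b} (\<lambda>x. ?P x - integral {a..b} (\<lambda>y. L x y))
       - integral {a..b} (\<lambda>y. ?Q y - integral {a..b} (\<lambda>x. L x y))"
      using P Q 3 4 5 by (simp add: Henstock_Kurzweil_Integration.integral_diff)
    have n1: "norm (integral {a..b} (\<lambda>x. ?P x - integral {a..b} (\<lambda>y. L x y)))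
        \<le> e * integral {a..b} (\<lambda>x. integral {a..b} (\<lambda>y. E x y))"
      by (rule order_trans[OF integral_norm_bound_integral[OF integrable_diff[OF P 3] integrable_on_mult_right[OF E12] 1]])
        simp_all
    have n2: "norm (integral {a..b} (\<lambda>y. ?Q y - integral {a..b} (\<lambda>x. L x y)))
        \<le> e * integral {a..b} (\<lambda>y. integral {a..b} (\<lambda>x. E x y))"
      by (rule order_trans[OF integral_norm_bound_integral[OF integrable_diff[OF Q 4] integrable_on_mult_right[OF E21] 2]])
        simp_all
    show ?thesis
      unfolding eq distrib_left
      by (rule order_trans[OF norm_triangle_ineq4 add_mono[OF n1 n2]])
  qed
  then have "norm (integral {a..b} ?P - integral {a..b} ?Q) \<le> 0"
  proof -
    assume *: "\<And>e. e > 0 \<Longrightarrow> norm (integral {a..b} ?P - integral {a..b} ?Q) \<le> e * ?B"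
    have "((\<lambda>e. e * ?B) \<longlongrightarrow> 0 * ?B) (at_right 0)"
      by (intro tendsto_intros)
    moreover have "\<forall>\<^sub>F e in at_right 0. norm (integral {a..b} ?P - integral {a..b} ?Q) \<le> e * ?B"
      using * by (auto simp: eventually_at_right_less eventually_at_right_field intro: exI[of _ 1])
    ultimately show ?thesis
      using tendsto_lowerbound by fastforce
  qed
  then show ?thesis by simp
qed

section \<open>Convolution with powers\<close>

text \<open>Up to the factor \<open>1 / Gamma a\<close> this is the Riemann--Liouville kernel. Vanishing on the negative
  half-line lets all convolutions be written over one fixed interval.\<close>

definition kern :: "real \<Rightarrow> real \<Rightarrow> real" where
  "kern a x = (if x \<le> 0 then 0 else x powr (a - 1))"

lemma kern_nonneg [simp]: "0 \<le> kern a x"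
  by (simp add: kern_def)

lemma kern_pos: "0 < x \<Longrightarrow> 0 < kern a x"
  by (simp add: kern_def)

lemma kern_nonpos [simp]: "x \<le> 0 \<Longrightarrow> kern a x = 0"
  by (simp add: kern_def)

lemma kern_eq_powr: "0 \<le> x \<Longrightarrow> kern a x = x powr (a - 1)"
  by (auto simp: kern_def)

lemma kern_one: "0 < x \<Longrightarrow> kern 1 x = 1"
  by (simp add: kern_def)

lemma kern_mult_left: "0 < c \<Longrightarrow> kern a (c * x) = c powr (a - 1) * kern a x"
  by (auto simp: kern_def powr_mult mult_le_0_iff)

lemma powr_mult_kern: "0 < t \<Longrightarrow> t powr a * kern b t = kern (a + b) t"
  by (simp add: kern_def powr_add[symmetric] add_diff_eq)

lemma continuous_on_kern: "continuous_on {0<..} (kern a)"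
proof -
  have "continuous_on {0<..} (\<lambda>x::real. x powr (a - 1))"
    by (intro continuous_intros) auto
  then show ?thesis
    by (rule continuous_on_cong[THEN iffD1, rotated 2]) (auto simp: kern_def)
qed

text \<open>Substitute s = t \<sigma>. The kernels are homogeneous of degrees a - 1 and b - 1 and ds
  contributes one more power of t, which gives exponent a + b - 1, that is,
  \<open>kern (a + b) t\<close>.\<close>

lemma has_integral_kern_scale:
  fixes \<Phi> :: "real \<Rightarrow> 'a::real_normed_vector"
  assumes t: "t > 0"
    and I: "((\<lambda>\<sigma>. (kern a (1 - \<sigma>) * kern b \<sigma>) *\<^sub>R \<Phi> (t * \<sigma>)) has_integral I) {0..1}"
  shows "((\<lambda>s. (kern a (t - s) * kern b s) *\<^sub>R \<Phi> s) has_integral kern (a + b) t *\<^sub>R I) {0..t}"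
proof -
  have im: "(\<lambda>x. x / (1 / t)) ` {0..1} = {0..t}"
  proof -
    have "(\<lambda>x. x * t) ` {0..1} = {0..t}"
      using image_mult_atLeastAtMost[of t 0 1] t by (simp add: mult.commute)
    then show ?thesis by simp
  qed
  have "((\<lambda>s. (kern a (1 - (1 / t) * s) * kern b ((1 / t) * s)) *\<^sub>R \<Phi> (t * ((1 / t) * s)))
      has_integral (1 / \<bar>1 / t\<bar>) *\<^sub>R I) {0..t}"
    using has_integral_stretch_real[OF I, of "1 / t"] t unfolding im by simp
  then have "((\<lambda>s. (t powr (a - 1) * t powr (b - 1)) *\<^sub>R
      ((kern a (1 - (1 / t) * s) * kern b ((1 / t) * s)) *\<^sub>R \<Phi> (t * ((1 / t) * s))))
      has_integral (t powr (a - 1) * t powr (b - 1)) *\<^sub>R ((1 / \<bar>1 / t\<bar>) *\<^sub>R I)) {0..t}"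
    by (rule has_integral_cmul)
  moreover have "(t powr (a - 1) * t powr (b - 1)) *\<^sub>R
      ((kern a (1 - (1 / t) * s) * kern b ((1 / t) * s)) *\<^sub>R \<Phi> (t * ((1 / t) * s)))
      = (kern a (t - s) * kern b s) *\<^sub>R \<Phi> s" for s
  proof -
    have "kern a (t - s) = kern a (t * (1 - (1 / t) * s))" "kern b s = kern b (t * ((1 / t) * s))"
      using t by (simp_all add: right_diff_distrib)
    then have "kern a (t - s) = t powr (a - 1) * kern a (1 - (1 / t) * s)"
        "kern b s = t powr (b - 1) * kern b ((1 / t) * s)"
      using t by (simp_all only: kern_mult_left)
    then show ?thesis using t by (simp add: algebra_simps)
  qed
  moreover have "(t powr (a - 1) * t powr (b - 1)) *\<^sub>R ((1 / \<bar>1 / t\<bar>) *\<^sub>R I) = kern (a + b) t *\<^sub>R I"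
  proof -
    have "t powr (a - 1) * t powr (b - 1) * t = t powr (a - 1) * t powr (b - 1) * t powr 1"
      using t by simp
    also have "\<dots> = t powr (a + b - 1)"
      by (simp only: powr_add[symmetric]) simp
    finally show ?thesis using t by (simp add: kern_def)
  qed
  ultimately show ?thesis by (simp only:)
qed

lemma has_integral_kern_unit:
  assumes "0 < a" "0 < b"
  shows "((\<lambda>\<sigma>. kern a (1 - \<sigma>) * kern b \<sigma>) has_integral Beta a b) {0..1}"
proof -
  have "((\<lambda>\<sigma>. \<sigma> powr (b - 1) * (1 - \<sigma>) powr (a - 1)) has_integral Beta b a) {0..1}"
    using assms by (intro has_integral_Beta_real)
  then show ?thesis
    by (subst Beta_commute) (auto simp: kern_eq_powr mult.commute intro: has_integral_eq[rotated])
qed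

text \<open>The Beta integral. For \<open>t \<le> 0\<close> one of \<open>t - s\<close> and
  \<open>s\<close> is always nonpositive, so both sides are 0 and the formula can be used without a
  case distinction.\<close>

lemma has_integral_kern_conv:
  assumes "0 < a" "0 < b" "t \<le> T"
  shows "((\<lambda>s. kern a (t - s) * kern b s) has_integral kern (a + b) t * Beta a b) {0..T}"
proof (cases "t > 0")
  case True
  have "((\<lambda>s. kern a (t - s) * kern b s) has_integral kern (a + b) t * Beta a b) {0..t}"
    using has_integral_kern_scale[of t a b "\<lambda>_. 1::real"] has_integral_kern_unit[of a b] True assms by simp
  then show ?thesis
    by (rule has_integral_on_superset) (use assms in auto)
next
  case False
  then have "kern a (t - s) * kern b s = 0" for s
    by (cases "s > 0") auto
  then show ?thesis using False by (simp only: kern_nonpos not_less mult_zero_left has_integral_0)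
qed

lemma kern_conv_integrable:
  fixes \<psi> :: "real \<Rightarrow> 'a::banach"
  assumes "continuous_on {0..t} \<psi>" "0 < a" "0 < c"
  shows "(\<lambda>s. (kern a (t - s) * kern c s) *\<^sub>R \<psi> s) integrable_on {0..t}"
  using has_integral_kern_conv[of a c t t] assms
  by (intro integrable_on_scaleR_continuous) auto

lemma has_integral_kern_conv_shift:
  fixes \<psi> :: "real \<Rightarrow> 'a::banach"
  assumes s: "0 \<le> s" "s \<le> t"
  shows "((\<lambda>\<tau>. (kern a (t - \<tau>) * kern b (\<tau> - s)) *\<^sub>R \<psi> \<tau>) has_integral I) {0..t} \<longleftrightarrow>
    ((\<lambda>\<sigma>. (kern a (t - s - \<sigma>) * kern b \<sigma>) *\<^sub>R \<psi> (s + \<sigma>)) has_integral I) {0..t - s}"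
proof -
  let ?f = "\<lambda>\<tau>. (kern a (t - \<tau>) * kern b (\<tau> - s)) *\<^sub>R \<psi> \<tau>"
  have "(?f has_integral I) {0..t} \<longleftrightarrow> (?f has_integral I) {s..t}"
  proof -
    have "(?f has_integral I) {0..t} \<longleftrightarrow> ((\<lambda>\<tau>. if \<tau> \<in> {s..t} then ?f \<tau> else 0) has_integral I) {0..t}"
      by (intro has_integral_cong) auto
    also have "\<dots> \<longleftrightarrow> (?f has_integral I) {s..t}"
      using s by (intro has_integral_restrict) auto
    finally show ?thesis .
  qed
  also have "\<dots> \<longleftrightarrow> ((?f \<circ> (+) s) has_integral I) {0..t - s}"
    using has_integral_shift_Icc_real[of ?f s I 0 "t - s"] by simp
  also have "?f \<circ> (+) s = (\<lambda>\<sigma>. (kern a (t - s - \<sigma>) * kern b \<sigma>) *\<^sub>R \<psi> (s + \<sigma>))"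
    by (simp add: fun_eq_iff algebra_simps)
  finally show ?thesis .
qed

lemma integral_kern_conv_shift:
  fixes \<psi> :: "real \<Rightarrow> 'a::banach"
  assumes "0 \<le> s" "s \<le> t"
  shows "integral {0..t} (\<lambda>\<tau>. (kern a (t - \<tau>) * kern b (\<tau> - s)) *\<^sub>R \<psi> \<tau>) =
    integral {0..t - s} (\<lambda>\<sigma>. (kern a (t - s - \<sigma>) * kern b \<sigma>) *\<^sub>R \<psi> (s + \<sigma>))"
  using has_integral_kern_conv_shift[OF assms, of a b \<psi>]
  by (simp add: integral_def integrable_on_def)

lemma integral_kern_conv_extend:
  fixes \<psi> :: "real \<Rightarrow> 'a::banach"
  assumes "0 \<le> t" "t \<le> T"
  shows "integral {0..T} (\<lambda>s. (kern a (t - s) * k s) *\<^sub>R \<psi> s) = integral {0..t} (\<lambda>s. (kern a (t - s) * k s) *\<^sub>R \<psi> s)"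
proof -
  let ?f = "\<lambda>s. (kern a (t - s) * k s) *\<^sub>R \<psi> s"
  have "integral {0..T} ?f = integral {0..T} (\<lambda>s. if s \<in> {0..t} then ?f s else 0)"
    by (intro Henstock_Kurzweil_Integration.integral_cong) auto
  also have "\<dots> = integral {0..t} ?f"
    using assms by (subst Henstock_Kurzweil_Integration.integral_restrict_Int) (simp add: Int_absorb2)
  finally show ?thesis .
qed

lemma integral_kern_conv_reflect:
  fixes \<psi> :: "real \<Rightarrow> 'a::banach"
  shows "integral {0..t} (\<lambda>s. (kern a (t - s) * kern b s) *\<^sub>R \<psi> s) =
    integral {0..t} (\<lambda>s. (kern b (t - s) * kern a s) *\<^sub>R \<psi> (t - s))"
proof -
  let ?f = "\<lambda>s. (kern a (t - s) * kern b s) *\<^sub>R \<psi> s"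
  have "integral {0..t} ?f = integral {-t..0} (\<lambda>s. ?f (-s))"
    using Henstock_Kurzweil_Integration.integral_reflect_real[of t 0 ?f] by simp
  also have "\<dots> = integral {0..t} ((\<lambda>s. ?f (-s)) \<circ> (+) (-t))"
    using integral_shift_Icc_real[of 0 t "\<lambda>s. ?f (-s)" "-t"] by simp
  finally show ?thesis by (simp add: o_def mult.commute)
qed

text \<open>Rescaling \<open>{0..t}\<close> to \<open>{0..1}\<close> splits a singular convolution into an explicit power of \<open>t\<close> and a
  factor that is continuous up to \<open>t = 0\<close>.\<close>

definition kern_mean :: "real \<Rightarrow> real \<Rightarrow> (real \<Rightarrow> 'a::real_normed_vector) \<Rightarrow> real \<Rightarrow> 'a" where
  "kern_mean a b \<Phi> t = integral {0..1} (\<lambda>\<sigma>. (kern a (1 - \<sigma>) * kern b \<sigma>) *\<^sub>R \<Phi> (t * \<sigma>))"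

lemma has_integral_kern_mean:
  fixes \<Phi> :: "real \<Rightarrow> 'a::banach"
  assumes ab: "0 < a" "0 < b" and t: "0 < t" and \<Phi>: "continuous_on {0..t} \<Phi>"
  shows "((\<lambda>s. (kern a (t - s) * kern b s) *\<^sub>R \<Phi> s) has_integral kern (a + b) t *\<^sub>R kern_mean a b \<Phi> t) {0..t}"
proof (rule has_integral_kern_scale[OF t])
  have "continuous_on {0..1} (\<lambda>\<sigma>. \<Phi> (t * \<sigma>))"
    by (rule continuous_on_compose2[OF \<Phi>])
      (use t in \<open>auto intro!: continuous_intros simp: mult_left_le\<close>)
  then have "(\<lambda>\<sigma>. (kern a (1 - \<sigma>) * kern b \<sigma>) *\<^sub>R \<Phi> (t * \<sigma>)) integrable_on {0..1}"
    using has_integral_kern_unit[OF ab] by (intro integrable_on_scaleR_continuous) auto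
  then show "((\<lambda>\<sigma>. (kern a (1 - \<sigma>) * kern b \<sigma>) *\<^sub>R \<Phi> (t * \<sigma>)) has_integral kern_mean a b \<Phi> t) {0..1}"
    unfolding kern_mean_def by (rule integrable_integral)
qed

lemma kern_mean_zero:
  assumes "0 < a" "0 < b"
  shows "kern_mean a b \<Phi> 0 = Beta a b *\<^sub>R \<Phi> 0"
  using has_integral_scaleR_left[OF has_integral_kern_unit[OF assms], of "\<Phi> 0"]
  by (simp add: kern_mean_def integral_unique)

text \<open>After rescaling, neither the interval nor the singular weight depends on
  \<open>t\<close>; only the continuous factor does. \<Phi> may itself depend on \<open>t\<close>,
  as needed for convolutions with \<open>P (t - s)\<close> and for the Volterra kernel.\<close>

lemma continuous_on_kern_mean:
  fixes \<Phi> :: "real \<Rightarrow> real \<Rightarrow> 'a::banach"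
  assumes ab: "0 < a" "0 < b"
    and \<Phi>: "continuous_on {(t, s). 0 \<le> s \<and> s \<le> t \<and> t \<le> T} (\<lambda>(t, s). \<Phi> t s)"
  shows "continuous_on {0..T} (\<lambda>t. kern_mean a b (\<Phi> t) t)"
  unfolding kern_mean_def
proof (rule continuous_on_integral_scaleR)
  show "(\<lambda>\<sigma>. kern a (1 - \<sigma>) * kern b \<sigma>) integrable_on {0..1}"
    using has_integral_kern_unit[OF ab] by blast
  have "continuous_on ({0..T} \<times> {0..1}) (\<lambda>z. (\<lambda>(t, s). \<Phi> t s) (fst z, fst z * snd z))"
    by (rule continuous_on_compose2[OF \<Phi>])
      (auto intro!: continuous_intros simp: mult_left_le)
  then show "continuous_on ({0..T} \<times> {0..1}) (\<lambda>(t, \<sigma>). \<Phi> t (t * \<sigma>))"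
    by (simp add: case_prod_unfold)
qed simp

text \<open>Lowering the exponent by \<open>d\<close> pays for the truncation error: for 0 < x <
  \<epsilon> the whole kernel is x^d \<open>kern (a - d) x\<close>, hence at most \<epsilon>^d
  \<open>kern (a - d) x\<close>, and \<epsilon> is chosen with \<epsilon>^d = e.\<close>

lemma kern_truncate:
  assumes "0 < a" "0 < d" "0 < e"
  obtains p where "continuous_on UNIV p" "\<And>x. 0 \<le> p x" "\<And>x. p x \<le> kern a x"
    "\<And>x. kern a x - p x \<le> e * kern (a - d) x"
proof -
  define \<epsilon> where "\<epsilon> = e powr (1 / d)"
  have \<epsilon>: "\<epsilon> > 0" using assms by (simp add: \<epsilon>_def)
  \<comment> \<open>Equal to x^(a-1) from \<epsilon> on and to x^a / \<epsilon> on [0,\<epsilon>],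
    hence continuous at 0 because a > 0.\<close>
  define p where "p = (\<lambda>x. (max 0 x) powr a / max x \<epsilon>)"
  have p: "p x = kern a x * (x / max x \<epsilon>)" if "x > 0" for x
    using that powr_add[of x "a - 1" 1] by (simp add: p_def kern_def)
  have p0: "p x = 0" if "x \<le> 0" for x
    using that assms by (simp add: p_def)
  show ?thesis
  proof
    have "continuous_on UNIV (\<lambda>x::real. (max 0 x) powr a)"
      using assms by (intro continuous_on_powr' continuous_intros) auto
    then show "continuous_on UNIV p"
      unfolding p_def by (rule continuous_on_divide) (use \<epsilon> in \<open>auto intro!: continuous_intros\<close>)
    show "0 \<le> p x" for x
      using \<epsilon> by (simp add: p_def max_def)
    show "p x \<le> kern a x" for x
    proof (cases "x > 0")
      case True
      then have "x / max x \<epsilon> \<le> 1" by (simp add: divide_simps)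
      then show ?thesis using True mult_left_mono[of "x / max x \<epsilon>" 1 "kern a x"] by (simp add: p)
    qed (simp add: p0)
    show "kern a x - p x \<le> e * kern (a - d) x" for x
    proof (cases "x > 0")
      case x: True
      show ?thesis
      proof (cases "x < \<epsilon>")
        case True
        have "x powr d \<le> \<epsilon> powr d"
          using x True assms by (intro powr_mono2) auto
        also have "\<dots> = e" using assms by (simp add: \<epsilon>_def powr_powr)
        finally have "x powr d * kern (a - d) x \<le> e * kern (a - d) x"
          by (intro mult_right_mono) auto
        moreover have "x powr d * kern (a - d) x = kern a x"
          using powr_mult_kern[OF x, of d "a - d"] by simp
        moreover have "p x \<ge> 0" using \<open>\<And>x. 0 \<le> p x\<close> .
        ultimately show ?thesis by linarith
      next
        case False
        then have "p x = kern a x" using x by (simp add: p max_def)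
        then show ?thesis using assms by simp
      qed
    qed (simp add: p0)
  qed
qed

lemma prod3_diff_bound:
  fixes A B C :: real
  assumes "0 \<le> A'" "A' \<le> A" "0 \<le> B'" "B' \<le> B" "0 \<le> C'" "C' \<le> C"
    and "A - A' \<le> e * A1" "B - B' \<le> e * B1" "C - C' \<le> e * C1"
  shows "\<bar>A * B * C - A' * B' * C'\<bar> \<le> e * (A1 * B * C + A * B1 * C + A * B * C1)"
proof -
  have "A * B * C - A' * B' * C' = (A - A') * (B * C) + (B - B') * (A' * C) + (C - C') * (A' * B')"
    by (simp add: algebra_simps)
  moreover have "(A - A') * (B * C) \<ge> 0" "(B - B') * (A' * C) \<ge> 0" "(C - C') * (A' * B') \<ge> 0"
    using assms by simp_all
  moreover have "(A - A') * (B * C) \<le> (e * A1) * (B * C)"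
    using assms by (intro mult_right_mono) auto
  moreover have "(B - B') * (A' * C) \<le> (e * B1) * (A * C)"
    using assms by (intro mult_mono) auto
  moreover have "(C - C') * (A' * B') \<le> (e * C1) * (A * B)"
    using assms by (intro mult_mono) auto
  ultimately show ?thesis by (simp add: algebra_simps)
qed

text \<open>Since \<open>kern\<close> vanishes on the negative half-line, the product of the three
  kernels lives on the triangle s < \<tau> < t, and the exchange can be made on the full square.
  Truncating all three factors produces an error controlled by the sum of the products in which one
  exponent is lowered; the Beta formula integrates each of these in either order.\<close>

theorem kern_Dirichlet_formula:
  fixes \<Phi> :: "real \<Rightarrow> real \<Rightarrow> 'a::banach"
  assumes abc: "0 < a" "0 < b" "0 < c" and t: "0 \<le> t"
    and \<Phi>: "continuous_on ({0..t} \<times> {0..t}) (\<lambda>(x, y). \<Phi> x y)"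
  shows "integral {0..t} (\<lambda>\<tau>. kern a (t - \<tau>) *\<^sub>R integral {0..\<tau>} (\<lambda>s. (kern b (\<tau> - s) * kern c s) *\<^sub>R \<Phi> \<tau> s))
    = integral {0..t} (\<lambda>s. kern c s *\<^sub>R integral {0..t - s} (\<lambda>\<sigma>. (kern a (t - s - \<sigma>) * kern b \<sigma>) *\<^sub>R \<Phi> (s + \<sigma>) s))"
proof -
  \<comment> \<open>Half the smallest exponent, so that each lowered exponent stays positive and its
    kernel integrable.\<close>
  define d where "d = min a (min b c) / 2"
  have d: "0 < d" "0 < a - d" "0 < b - d" "0 < c - d"
    using abc by (auto simp: d_def min_def)
  define KK where "KK = (\<lambda>a b c \<tau> s. kern a (t - \<tau>) * kern b (\<tau> - s) * kern c s)"
  define E where "E = (\<lambda>\<tau> s. KK (a - d) b c \<tau> s + KK a (b - d) c \<tau> s + KK a b (c - d) \<tau> s)"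
  have KK1: "(KK a b c \<tau> has_integral kern a (t - \<tau>) * (kern (b + c) \<tau> * Beta b c)) {0..t}"
    if "\<tau> \<in> {0..t}" "0 < b" "0 < c" for \<tau> a b c
    using has_integral_mult_right[OF has_integral_kern_conv[OF that(2,3)], of \<tau> t "kern a (t - \<tau>)"] that
    by (simp add: KK_def[abs_def] mult.assoc)
  have KK2: "((\<lambda>\<tau>. KK a b c \<tau> s) has_integral kern c s * (kern (a + b) (t - s) * Beta a b)) {0..t}"
    if "s \<in> {0..t}" "0 < a" "0 < b" for s a b c
  proof -
    have "((\<lambda>\<sigma>. (kern a (t - s - \<sigma>) * kern b \<sigma>) *\<^sub>R 1) has_integral kern (a + b) (t - s) * Beta a b) {0..t - s}"
      using has_integral_kern_conv[OF that(2,3), of "t - s" "t - s"] by simp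
    then have "((\<lambda>\<tau>. (kern a (t - \<tau>) * kern b (\<tau> - s)) *\<^sub>R 1) has_integral kern (a + b) (t - s) * Beta a b) {0..t}"
      using that by (subst has_integral_kern_conv_shift) auto
    then have "((\<lambda>\<tau>. kern c s * (kern a (t - \<tau>) * kern b (\<tau> - s))) has_integral kern c s * (kern (a + b) (t - s) * Beta a b)) {0..t}"
      by (intro has_integral_mult_right) simp
    then show ?thesis by (simp add: KK_def mult_ac)
  qed
  have KK12: "(\<lambda>\<tau>. integral {0..t} (KK a b c \<tau>)) integrable_on {0..t}"
    if "0 < a" "0 < b" "0 < c" for a b c
  proof -
    have "(\<lambda>\<tau>. (kern a (t - \<tau>) * kern (b + c) \<tau>) * Beta b c) integrable_on {0..t}"
      using has_integral_kern_conv[of a "b + c" t t] that by (intro integrable_on_mult_left) auto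
    then show ?thesis
      by (rule integrable_eq) (use integral_unique[OF KK1] that in \<open>simp add: mult_ac\<close>)
  qed
  have KK21: "(\<lambda>s. integral {0..t} (\<lambda>\<tau>. KK a b c \<tau> s)) integrable_on {0..t}"
    if "0 < a" "0 < b" "0 < c" for a b c
  proof -
    have "(\<lambda>s. (kern (a + b) (t - s) * kern c s) * Beta a b) integrable_on {0..t}"
      using has_integral_kern_conv[of "a + b" c t t] that by (intro integrable_on_mult_left) auto
    then show ?thesis
      by (rule integrable_eq) (use integral_unique[OF KK2] that in \<open>simp add: mult_ac\<close>)
  qed
  have i1: "KK a b c \<tau> integrable_on {0..t}" if "\<tau> \<in> {0..t}" "0 < b" "0 < c" for \<tau> a b c
    using KK1 that by blast
  have i2: "(\<lambda>\<tau>. KK a b c \<tau> s) integrable_on {0..t}" if "s \<in> {0..t}" "0 < a" "0 < b" for s a b c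
    using KK2 that by blast
  have E1: "E \<tau> = (\<lambda>s. KK (a - d) b c \<tau> s + KK a (b - d) c \<tau> s + KK a b (c - d) \<tau> s)" for \<tau>
    by (simp add: E_def)
  have swap: "integral {0..t} (\<lambda>\<tau>. integral {0..t} (\<lambda>s. KK a b c \<tau> s *\<^sub>R \<Phi> \<tau> s))
      = integral {0..t} (\<lambda>s. integral {0..t} (\<lambda>\<tau>. KK a b c \<tau> s *\<^sub>R \<Phi> \<tau> s))"
  proof (rule integral_swap_scaleR[OF \<Phi>, where E = E])
    fix e :: real assume e: "e > 0"
    obtain p where p: "continuous_on UNIV p" "\<And>x. 0 \<le> p x" "\<And>x. p x \<le> kern a x"
        "\<And>x. kern a x - p x \<le> e * kern (a - d) x"
      using kern_truncate[OF abc(1) d(1) e] by blast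
    obtain q where q: "continuous_on UNIV q" "\<And>x. 0 \<le> q x" "\<And>x. q x \<le> kern b x"
        "\<And>x. kern b x - q x \<le> e * kern (b - d) x"
      using kern_truncate[OF abc(2) d(1) e] by blast
    obtain r where r: "continuous_on UNIV r" "\<And>x. 0 \<le> r x" "\<And>x. r x \<le> kern c x"
        "\<And>x. kern c x - r x \<le> e * kern (c - d) x"
      using kern_truncate[OF abc(3) d(1) e] by blast
    show "\<exists>K'. continuous_on ({0..t} \<times> {0..t}) (\<lambda>(x, y). K' x y) \<and>
        (\<forall>x\<in>{0..t}. \<forall>y\<in>{0..t}. \<bar>KK a b c x y - K' x y\<bar> \<le> e * E x y)"
    proof (intro exI[of _ "\<lambda>\<tau> s. p (t - \<tau>) * q (\<tau> - s) * r s"] conjI ballI)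
      show "continuous_on ({0..t} \<times> {0..t}) (\<lambda>(\<tau>, s). p (t - \<tau>) * q (\<tau> - s) * r s)"
        unfolding case_prod_unfold
        by (intro continuous_intros continuous_on_compose2[OF p(1)] continuous_on_compose2[OF q(1)]
            continuous_on_compose2[OF r(1)]) auto
      show "\<bar>KK a b c \<tau> s - p (t - \<tau>) * q (\<tau> - s) * r s\<bar> \<le> e * E \<tau> s" for \<tau> s
        unfolding KK_def E_def by (rule prod3_diff_bound) (use p q r in auto)
    qed
  next
    show "0 \<le> KK a b c \<tau> s" for \<tau> s by (simp add: KK_def)
    show "(\<lambda>y. KK a b c x y) integrable_on {0..t}" if "x \<in> {0..t}" for x
      using i1 that abc by blast
    show "(\<lambda>x. KK a b c x y) integrable_on {0..t}" if "y \<in> {0..t}" for y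
      using i2 that abc by blast
    show "E x integrable_on {0..t}" if "x \<in> {0..t}" for x
      unfolding E1 by (intro integrable_add i1 that abc d)
    show "(\<lambda>x. E x y) integrable_on {0..t}" if "y \<in> {0..t}" for y
      unfolding E_def by (intro integrable_add i2 that abc d)
    have "(\<lambda>x. integral {0..t} (KK (a - d) b c x) + integral {0..t} (KK a (b - d) c x)
         + integral {0..t} (KK a b (c - d) x)) integrable_on {0..t}"
      by (intro integrable_add KK12 abc d)
    then show "(\<lambda>x. integral {0..t} (\<lambda>y. E x y)) integrable_on {0..t}"
      by (rule integrable_eq)
        (use i1 abc d in \<open>simp add: E1 Henstock_Kurzweil_Integration.integral_add integrable_add\<close>)
    have "(\<lambda>y. integral {0..t} (\<lambda>x. KK (a - d) b c x y) + integral {0..t} (\<lambda>x. KK a (b - d) c x y)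
         + integral {0..t} (\<lambda>x. KK a b (c - d) x y)) integrable_on {0..t}"
      by (intro integrable_add KK21 abc d)
    then show "(\<lambda>y. integral {0..t} (\<lambda>x. E x y)) integrable_on {0..t}"
      by (rule integrable_eq)
        (use i2 abc d in \<open>simp add: E_def Henstock_Kurzweil_Integration.integral_add integrable_add\<close>)
  qed
  have 1: "integral {0..t} (\<lambda>s. KK a b c \<tau> s *\<^sub>R \<Phi> \<tau> s)
      = kern a (t - \<tau>) *\<^sub>R integral {0..\<tau>} (\<lambda>s. (kern b (\<tau> - s) * kern c s) *\<^sub>R \<Phi> \<tau> s)"
    if "\<tau> \<in> {0..t}" for \<tau>
    using integral_kern_conv_extend[of \<tau> t b "kern c" "\<Phi> \<tau>"] that
    by (simp add: KK_def mult.assoc flip: scaleR_scaleR)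
  have 2: "integral {0..t} (\<lambda>\<tau>. KK a b c \<tau> s *\<^sub>R \<Phi> \<tau> s)
      = kern c s *\<^sub>R integral {0..t - s} (\<lambda>\<sigma>. (kern a (t - s - \<sigma>) * kern b \<sigma>) *\<^sub>R \<Phi> (s + \<sigma>) s)"
    if "s \<in> {0..t}" for s
  proof -
    have "KK a b c \<tau> s *\<^sub>R \<Phi> \<tau> s = kern c s *\<^sub>R ((kern a (t - \<tau>) * kern b (\<tau> - s)) *\<^sub>R \<Phi> \<tau> s)" for \<tau>
      by (simp add: KK_def mult_ac)
    then show ?thesis
      using integral_kern_conv_shift[of s t a b "\<lambda>\<tau>. \<Phi> \<tau> s"] that
      by (simp only: integral_cmul atLeastAtMost_iff)
  qed
  show ?thesis
    by (rule trans[OF Henstock_Kurzweil_Integration.integral_cong[OF 1[symmetric]]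
          trans[OF swap Henstock_Kurzweil_Integration.integral_cong[OF 2]]])
qed

text \<open>Used with \<open>c = \<alpha>\<close> for functions of the weighted space and with
  \<open>c = 1\<close> for continuous forcings, since \<open>kern 1\<close> is 1 on positive
  arguments. The value at 0 lies in a null set.\<close>

lemma frac_integral_kern:
  fixes u \<phi> :: "real \<Rightarrow> 'a::real_normed_vector"
  assumes "\<And>\<tau>. 0 < \<tau> \<Longrightarrow> \<tau> \<le> t \<Longrightarrow> u \<tau> = kern c \<tau> *\<^sub>R \<phi> \<tau>"
  shows "frac_integral \<beta> u t = (1 / Gamma \<beta>) *\<^sub>R integral {0..t} (\<lambda>\<tau>. (kern \<beta> (t - \<tau>) * kern c \<tau>) *\<^sub>R \<phi> \<tau>)"
proof -
  have "integral {0..t} (\<lambda>\<tau>. (t - \<tau>) powr (\<beta> - 1) *\<^sub>R u \<tau>)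
      = integral {0..t} (\<lambda>\<tau>. (kern \<beta> (t - \<tau>) * kern c \<tau>) *\<^sub>R \<phi> \<tau>)"
    by (rule integral_spike[of "{0}"]) (auto simp: assms kern_eq_powr)
  then show ?thesis by (simp only: frac_integral_def)
qed

section \<open>Injectivity of the fractional integral and uniform boundedness\<close>

text \<open>Abel's inversion: a further convolution with \<open>kern (1 - a)\<close> turns the inner
  kernel into the constant \<open>Beta (1 - a) a\<close>, so the primitive of
  \<open>kern c s *\<^sub>R \<zeta> s\<close> vanishes identically. Differentiating it and dividing
  by the positive \<open>kern c t\<close> gives the claim.\<close>

lemma kern_conv_eq_0_imp_eq_0:
  fixes \<zeta> :: "real \<Rightarrow> 'a::banach"
  assumes a: "0 < a" "a < 1" and c: "0 < c" and \<zeta>: "continuous_on {0..T} \<zeta>"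
    and eq: "\<And>t. t \<in> {0<..T} \<Longrightarrow> integral {0..t} (\<lambda>s. (kern a (t - s) * kern c s) *\<^sub>R \<zeta> s) = 0"
    and t: "t \<in> {0<..T}"
  shows "\<zeta> t = 0"
proof -
  have zero: "integral {0..t} (\<lambda>s. kern c s *\<^sub>R \<zeta> s) = 0" if t: "t \<in> {0..T}" for t
  proof -
    have "continuous_on ({0..t} \<times> {0..t}) (\<lambda>(x, y). \<zeta> y)"
      unfolding case_prod_unfold
      by (intro continuous_on_compose2[OF \<zeta>] continuous_intros) (use t in auto)
    then have "integral {0..t} (\<lambda>\<tau>. kern (1 - a) (t - \<tau>) *\<^sub>R integral {0..\<tau>} (\<lambda>s. (kern a (\<tau> - s) * kern c s) *\<^sub>R \<zeta> s))
      = integral {0..t} (\<lambda>s. kern c s *\<^sub>R integral {0..t - s} (\<lambda>\<sigma>. (kern (1 - a) (t - s - \<sigma>) * kern a \<sigma>) *\<^sub>R \<zeta> s))"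
      using a c t by (intro kern_Dirichlet_formula) auto
    also have "integral {0..t} (\<lambda>\<tau>. kern (1 - a) (t - \<tau>) *\<^sub>R integral {0..\<tau>} (\<lambda>s. (kern a (\<tau> - s) * kern c s) *\<^sub>R \<zeta> s))
      = integral {0..t} (\<lambda>\<tau>. 0)"
    proof (rule Henstock_Kurzweil_Integration.integral_cong)
      fix \<tau> assume \<tau>: "\<tau> \<in> {0..t}"
      show "kern (1 - a) (t - \<tau>) *\<^sub>R integral {0..\<tau>} (\<lambda>s. (kern a (\<tau> - s) * kern c s) *\<^sub>R \<zeta> s) = 0"
        by (cases "\<tau> = 0") (use \<tau> t eq in auto)
    qed
    also have "integral {0..t} (\<lambda>s. kern c s *\<^sub>R integral {0..t - s} (\<lambda>\<sigma>. (kern (1 - a) (t - s - \<sigma>) * kern a \<sigma>) *\<^sub>R \<zeta> s))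
      = integral {0..t} (\<lambda>s. Beta (1 - a) a *\<^sub>R (kern c s *\<^sub>R \<zeta> s))"
    \<comment> \<open>At s = t the inner integral runs over a single point and is 0 instead of the
      Beta value, hence the exceptional set.\<close>
    proof (rule integral_spike[of "{t}"])
      fix s assume s: "s \<in> {0..t} - {t}"
      then have "((\<lambda>\<sigma>. (kern (1 - a) (t - s - \<sigma>) * kern a \<sigma>) *\<^sub>R \<zeta> s) has_integral
          (kern (1 - a + a) (t - s) * Beta (1 - a) a) *\<^sub>R \<zeta> s) {0..t - s}"
        using a by (intro has_integral_scaleR_left has_integral_kern_conv) auto
      then show "Beta (1 - a) a *\<^sub>R (kern c s *\<^sub>R \<zeta> s)
        = kern c s *\<^sub>R integral {0..t - s} (\<lambda>\<sigma>. (kern (1 - a) (t - s - \<sigma>) * kern a \<sigma>) *\<^sub>R \<zeta> s)"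
        using s by (simp add: integral_unique kern_one mult.commute)
    qed simp
    finally have "Beta (1 - a) a *\<^sub>R integral {0..t} (\<lambda>s. kern c s *\<^sub>R \<zeta> s) = 0"
      unfolding integral_cmul by simp
    moreover have "Beta (1 - a) a \<noteq> 0"
      using a Gamma_real_pos[of a] Gamma_real_pos[of "1 - a"] by (simp add: Beta_def less_imp_neq[symmetric])
    ultimately show ?thesis by simp
  qed
  let ?I = "\<lambda>t. integral {0..t} (\<lambda>s. kern c s *\<^sub>R \<zeta> s)"
  have "kern c integrable_on {0..T}"
  proof -
    have "(\<lambda>s. kern 1 (T - s) * kern c s) integrable_on {0..T}"
      using has_integral_kern_conv[of 1 c T T] c by auto
    then show ?thesis
      by (rule integrable_spike[where S = "{T}"]) (auto simp: kern_one)
  qed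
  then have int: "(\<lambda>s. kern c s *\<^sub>R \<zeta> s) integrable_on {0..T}"
    by (intro integrable_on_scaleR_continuous \<zeta>) auto
  have "isCont (kern c) t"
    using continuous_on_kern[of c] t continuous_on_eq_continuous_at[OF open_greaterThan[of 0]] by auto
  then have "continuous (at t within {0..T}) (kern c)"
    by (rule continuous_at_imp_continuous_within)
  moreover have "continuous (at t within {0..T}) \<zeta>"
    using \<zeta> t by (auto simp: continuous_on_eq_continuous_within)
  ultimately have "continuous (at t within {0..T}) (\<lambda>s. kern c s *\<^sub>R \<zeta> s)"
    by (rule continuous_scaleR)
  then have d1: "(?I has_vector_derivative kern c t *\<^sub>R \<zeta> t) (at t within {0..T})"
    using integral_has_vector_derivative_continuous_at[OF int, of t "{}"] t by simp
  have d2: "(?I has_vector_derivative 0) (at t within {0..T})"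
    by (rule has_vector_derivative_transform[where f = "\<lambda>_. 0"]) (use t zero in auto)
  have "kern c t *\<^sub>R \<zeta> t = 0"
    by (rule vector_derivative_unique_within_closed_interval[OF _ _ d1[folded box_real(2)] d2[folded box_real(2)]]) (use t in auto)
  then show ?thesis
    using kern_pos[of t c] t by auto
qed

section \<open>Uniform boundedness and strong continuity\<close>

text \<open>The library's \<open>Baire\<close> theorem needs a Heine--Borel space, hence the abstract version.\<close>

theorem uniform_boundedness:
  fixes F :: "'i \<Rightarrow> 'a::banach \<Rightarrow>\<^sub>L 'b::real_normed_vector"
  assumes "\<And>y. bounded ((\<lambda>i. F i y) ` I)"
  obtains C where "C > 0" "\<And>i. i \<in> I \<Longrightarrow> norm (F i) \<le> C"
proof -
  define A where "A = (\<lambda>n::nat. {y. \<forall>i\<in>I. norm (F i y) \<le> real n})"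
  have cl: "closed (A n)" for n
  proof -
    have "A n = (\<Inter>i\<in>I. {y. norm (F i y) \<le> real n})" by (auto simp: A_def)
    moreover have "closed {y. norm (F i y) \<le> real n}" for i
      by (intro closed_Collect_le continuous_intros)
    ultimately show ?thesis by auto
  qed
  have cover: "(\<Union>n. A n) = UNIV"
  proof -
    have "\<exists>n. y \<in> A n" for y
    proof -
      obtain B where "\<forall>z\<in>(\<lambda>i. F i y) ` I. norm z \<le> B"
        using assms[of y] unfolding bounded_iff by blast
      moreover obtain n where "B \<le> real n" using real_arch_simple by blast
      ultimately have "norm (F i y) \<le> real n" if "i \<in> I" for i
        using that by force
      then show ?thesis by (auto simp: A_def)
    qed
    then show ?thesis by auto
  qed
  have "\<exists>n. interior (A n) \<noteq> {}"
  proof (rule ccontr)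
    assume "\<nexists>n. interior (A n) \<noteq> {}"
    then have "euclidean interior_of \<Union>(range A) = {}"
      using cl by (intro Baire_category_alt) (auto simp: completely_metrizable_space_euclidean interior_of_def interior_def)
    then show False using cover by (auto simp: interior_of_def)
  qed
  then obtain n y0 e where e: "e > 0" "ball y0 e \<subseteq> A n"
    by (metis ex_in_conv mem_interior)
  \<comment> \<open>A vector of norm e/2 is a difference of two points of the ball, so its image has
    norm at most 2n; rescaling gives 4n/e. The summand 1 only makes the constant positive when n =
    0.\<close>
  define C where "C = 4 * real n / e + 1"
  have "norm (F i) \<le> C" if i: "i \<in> I" for i
  proof (rule norm_blinfun_bound)
    show "0 \<le> C" using e by (simp add: C_def)
    fix y
    show "norm (F i y) \<le> C * norm y"
    proof (cases "y = 0")
      case False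
      define z where "z = (e / (2 * norm y)) *\<^sub>R y"
      have "y0 + z \<in> ball y0 e" "y0 \<in> ball y0 e"
        using e False by (auto simp: z_def dist_norm)
      then have "y0 + z \<in> A n" "y0 \<in> A n"
        using e(2) by blast+
      then have "norm (F i (y0 + z)) \<le> real n" "norm (F i y0) \<le> real n"
        using i by (simp_all add: A_def)
      moreover have "F i z = F i (y0 + z) - F i y0" by (simp add: blinfun.add_right)
      ultimately have "norm (F i z) \<le> 2 * real n"
        by (metis norm_triangle_le_diff add_mono mult_2)
      then have "(e / (2 * norm y)) * norm (F i y) \<le> 2 * real n"
        using e by (simp add: z_def blinfun.scaleR_right)
      then have "norm (F i y) \<le> (4 * real n / e) * norm y"
        using e False by (simp add: field_simps)
      also have "\<dots> \<le> C * norm y"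
        by (intro mult_right_mono) (auto simp: C_def)
      finally show ?thesis .
    qed simp
  qed
  moreover have "C > 0" using e by (simp add: C_def add_nonneg_pos)
  ultimately show ?thesis using that by blast
qed

lemma strongly_continuous_bounded:
  fixes Q :: "real \<Rightarrow> 'a::banach \<Rightarrow>\<^sub>L 'b::real_normed_vector"
  assumes "compact I" "\<And>y. continuous_on I (\<lambda>t. Q t y)"
  obtains C where "C > 0" "\<And>t. t \<in> I \<Longrightarrow> norm (Q t) \<le> C"
  using assms by (metis uniform_boundedness compact_continuous_image compact_imp_bounded)

text \<open>Strong continuity does not give continuity in operator norm, so the increment is split:
  with the vector frozen at \<phi>(z) strong continuity applies, and the remainder
  \<open>Q (\<tau> w) (\<phi> w - \<phi> z)\<close> is killed by the uniform bound on the compact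
  set.\<close>

lemma continuous_on_strongly_continuous_apply:
  fixes Q :: "real \<Rightarrow> 'a::banach \<Rightarrow>\<^sub>L 'b::real_normed_vector"
  assumes "compact I" and Q: "\<And>y. continuous_on I (\<lambda>t. Q t y)"
    and \<tau>: "continuous_on U \<tau>" "\<tau> ` U \<subseteq> I" and \<phi>: "continuous_on U \<phi>"
  shows "continuous_on U (\<lambda>z. Q (\<tau> z) (\<phi> z))"
  unfolding continuous_on_def
proof
  fix z assume z: "z \<in> U"
  obtain C where C: "C > 0" "\<And>t. t \<in> I \<Longrightarrow> norm (Q t) \<le> C"
    using strongly_continuous_bounded[OF assms(1,2)] by metis
  have "continuous_on U (\<lambda>w. Q (\<tau> w) (\<phi> z))"
    using \<tau> by (intro continuous_on_compose2[OF Q]) auto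
  then have 1: "((\<lambda>w. Q (\<tau> w) (\<phi> z)) \<longlongrightarrow> Q (\<tau> z) (\<phi> z)) (at z within U)"
    using z by (auto simp: continuous_on_def)
  have "((\<lambda>w. \<phi> w - \<phi> z) \<longlongrightarrow> \<phi> z - \<phi> z) (at z within U)"
    using \<phi> z by (intro tendsto_intros) (auto simp: continuous_on_def)
  then have lim: "((\<lambda>w. norm (\<phi> w - \<phi> z) * C) \<longlongrightarrow> 0) (at z within U)"
    by (intro tendsto_mult_left_zero tendsto_norm_zero) simp
  have "((\<lambda>w. Q (\<tau> w) (\<phi> w - \<phi> z)) \<longlongrightarrow> 0) (at z within U)"
  proof (rule Lim_null_comparison[OF _ lim])
    show "\<forall>\<^sub>F w in at z within U. norm (Q (\<tau> w) (\<phi> w - \<phi> z)) \<le> norm (\<phi> w - \<phi> z) * C"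
    proof (rule eventually_at_topological[THEN iffD2], intro exI[of _ UNIV] conjI ballI impI)
      fix w assume "w \<in> U"
      then have "norm (Q (\<tau> w)) \<le> C" using C \<tau> by auto
      then show "norm (Q (\<tau> w) (\<phi> w - \<phi> z)) \<le> norm (\<phi> w - \<phi> z) * C"
        by (metis norm_blinfun mult.commute mult_left_mono norm_ge_zero order_trans)
    qed auto
  qed
  from tendsto_add[OF this 1] show "((\<lambda>w. Q (\<tau> w) (\<phi> w)) \<longlongrightarrow> Q (\<tau> z) (\<phi> z)) (at z within U)"
    by (simp add: blinfun.diff_right)
qed

section \<open>Fractional resolvents\<close>

locale resolvent =
  fixes \<alpha> :: real and S :: "real \<Rightarrow> 'a::banach \<Rightarrow>\<^sub>L 'a"
  assumes alpha: "0 < \<alpha>" "\<alpha> < 1" and res: "fractional_resolvent \<alpha> S"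
begin

text \<open>The extension by \<open>P 0 = (1 / Gamma \<alpha>) id\<close> makes \<open>P\<close> strongly continuous, by (P1).\<close>

definition P :: "real \<Rightarrow> 'a \<Rightarrow>\<^sub>L 'a" where
  "P t = (if t \<le> 0 then (1 / Gamma \<alpha>) *\<^sub>R id_blinfun else t powr (1 - \<alpha>) *\<^sub>R S t)"

lemma Gamma_pos: "0 < Gamma \<alpha>"
  using alpha Gamma_real_pos by blast

lemma P_nonpos: "t \<le> 0 \<Longrightarrow> P t y = (1 / Gamma \<alpha>) *\<^sub>R y"
  by (simp add: P_def scaleR_blinfun.rep_eq)

lemma S_eq: "0 < t \<Longrightarrow> S t y = kern \<alpha> t *\<^sub>R P t y"
  by (simp add: P_def kern_def scaleR_blinfun.rep_eq flip: powr_add)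

lemma continuous_on_P: "continuous_on UNIV (\<lambda>t. P t y)"
proof -
  have "continuous_on {0..} (\<lambda>t. P t y)"
    unfolding continuous_on_def
  proof
    fix t :: real assume t: "t \<in> {0..}"
    show "((\<lambda>t. P t y) \<longlongrightarrow> P t y) (at t within {0..})"
    proof (cases "t = 0")
      case True
      have "((\<lambda>t. (Gamma \<alpha> * t powr (1 - \<alpha>)) *\<^sub>R S t y) \<longlongrightarrow> y) (at_right 0)"
        using res unfolding fractional_resolvent_def by blast
      then have "((\<lambda>t. (1 / Gamma \<alpha>) *\<^sub>R ((Gamma \<alpha> * t powr (1 - \<alpha>)) *\<^sub>R S t y)) \<longlongrightarrow> (1 / Gamma \<alpha>) *\<^sub>R y) (at_right 0)"
        by (intro tendsto_intros)
      then have "((\<lambda>t. P t y) \<longlongrightarrow> (1 / Gamma \<alpha>) *\<^sub>R y) (at_right 0)"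
        by (rule Lim_transform_eventually)
          (use Gamma_pos in \<open>auto simp: eventually_at_right_less P_def scaleR_blinfun.rep_eq
             intro!: eventually_at_rightI[of 0 1]\<close>)
      then show ?thesis
        by (simp add: True P_nonpos at_within_Ici_at_right)
    next
      case False
      then have t0: "t > 0" using t by simp
      have "continuous_on {0<..} (\<lambda>t. S t y)"
        using res unfolding fractional_resolvent_def by blast
      then have "continuous_on {0<..} (\<lambda>t. t powr (1 - \<alpha>) *\<^sub>R S t y)"
        by (intro continuous_on_scaleR continuous_on_powr continuous_on_id continuous_on_const) auto
      then have "continuous_on {0<..} (\<lambda>t. P t y)"
        by (rule continuous_on_cong[THEN iffD1, rotated 2]) (auto simp: P_def scaleR_blinfun.rep_eq)
      then have "isCont (\<lambda>t. P t y) t"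
        using t0 continuous_on_eq_continuous_at[OF open_greaterThan[of 0]] by auto
      then show ?thesis
        using tendsto_within_subset isCont_def by blast
    qed
  qed
  moreover have "continuous_on {..0} (\<lambda>t. P t y)"
    by (rule continuous_on_cong[THEN iffD1, OF _ _ continuous_on_const[of _ "(1 / Gamma \<alpha>) *\<^sub>R y"]])
      (auto simp: P_nonpos)
  ultimately have "continuous_on ({..0} \<union> {0..}) (\<lambda>t. P t y)"
    by (intro continuous_on_closed_Un) auto
  moreover have "{..0} \<union> {0..} = (UNIV :: real set)" by auto
  ultimately show ?thesis by simp
qed

lemma continuous_on_P_apply:
  assumes "bounded (\<tau> ` U)" "continuous_on U \<tau>" "continuous_on U \<phi>"
  shows "continuous_on U (\<lambda>z. P (\<tau> z) (\<phi> z))"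
proof (rule continuous_on_strongly_continuous_apply)
  show "compact (closure (\<tau> ` U))" using assms(1) by (simp add: compact_closure)
qed (use assms closure_subset[of "\<tau> ` U"] continuous_on_subset[OF continuous_on_P] in auto)

lemma S_commute: "S s (S t y) = S t (S s y)" if "0 < s" "0 < t"
proof -
  have "S s o\<^sub>L S t = S t o\<^sub>L S s"
    using res that unfolding fractional_resolvent_def by blast
  then show ?thesis by (metis blinfun_apply_blinfun_compose)
qed

lemma P_commute: "P s (S t y) = S t (P s y)" if "0 < t"
  using that by (simp add: P_def scaleR_blinfun.rep_eq blinfun.scaleR_right S_commute)

text \<open>For t > 0 this is t^(1-2\<alpha>) times the fractional integral of \<open>S\<close>, in
  the rescaled form that is strongly continuous up to t = 0. \<open>W_apply\<close> proves the
  bounded linearity that \<open>Blinfun\<close> presupposes.\<close>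

definition W :: "real \<Rightarrow> 'a \<Rightarrow>\<^sub>L 'a" where
  "W t = Blinfun (\<lambda>y. (1 / Gamma \<alpha>) *\<^sub>R kern_mean \<alpha> \<alpha> (\<lambda>\<tau>. P \<tau> y) t)"

lemma P_mean_integrable:
  "(\<lambda>\<sigma>. (kern \<alpha> (1 - \<sigma>) * kern \<alpha> \<sigma>) *\<^sub>R P (t * \<sigma>) y) integrable_on {0..1}"
proof (rule integrable_on_scaleR_continuous)
  show "continuous_on {0..1} (\<lambda>\<sigma>. P (t * \<sigma>) y)"
    by (rule continuous_on_compose2[OF continuous_on_P]) (auto intro!: continuous_intros)
qed (use has_integral_kern_unit[OF alpha(1) alpha(1)] in auto)

lemma W_apply: "W t y = (1 / Gamma \<alpha>) *\<^sub>R kern_mean \<alpha> \<alpha> (\<lambda>\<tau>. P \<tau> y) t"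
proof -
  have "bounded_linear (\<lambda>y. kern_mean \<alpha> \<alpha> (\<lambda>\<tau>. P \<tau> y) t)"
  proof -
    have "bounded ((\<lambda>\<sigma>. t * \<sigma>) ` {0..1})"
      by (intro compact_imp_bounded compact_continuous_image continuous_intros compact_Icc)
    then have "compact (closure ((\<lambda>\<sigma>. t * \<sigma>) ` {0..1}))"
      by (simp add: compact_closure)
    then obtain C where C: "C > 0" "\<And>s. s \<in> closure ((\<lambda>\<sigma>. t * \<sigma>) ` {0..1}) \<Longrightarrow> norm (P s) \<le> C"
      using strongly_continuous_bounded[of _ P] continuous_on_subset[OF continuous_on_P] by blast
    then have C': "norm (P (t * \<sigma>)) \<le> C" if "\<sigma> \<in> {0..1}" for \<sigma>
      using that by (meson closure_subset imageI subsetD)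
    show ?thesis
    proof (rule bounded_linear_intro)
      fix y z :: 'a and c :: real
      show "kern_mean \<alpha> \<alpha> (\<lambda>\<tau>. P \<tau> (y + z)) t = kern_mean \<alpha> \<alpha> (\<lambda>\<tau>. P \<tau> y) t + kern_mean \<alpha> \<alpha> (\<lambda>\<tau>. P \<tau> z) t"
        unfolding kern_mean_def blinfun.add_right scaleR_add_right
        by (intro Henstock_Kurzweil_Integration.integral_add P_mean_integrable)
      show "kern_mean \<alpha> \<alpha> (\<lambda>\<tau>. P \<tau> (c *\<^sub>R y)) t = c *\<^sub>R kern_mean \<alpha> \<alpha> (\<lambda>\<tau>. P \<tau> y) t"
        unfolding kern_mean_def by (simp add: blinfun.scaleR_right mult.commute flip: integral_cmul)
      have "norm (kern_mean \<alpha> \<alpha> (\<lambda>\<tau>. P \<tau> y) t) \<le> (C * norm y) * integral {0..1} (\<lambda>\<sigma>. kern \<alpha> (1 - \<sigma>) * kern \<alpha> \<sigma>)"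
        unfolding kern_mean_def
      proof (rule norm_integral_scaleR_le)
        show "continuous_on {0..1} (\<lambda>\<sigma>. P (t * \<sigma>) y)"
          by (rule continuous_on_compose2[OF continuous_on_P]) (auto intro!: continuous_intros)
        show "norm (P (t * \<sigma>) y) \<le> C * norm y" if "\<sigma> \<in> {0..1}" for \<sigma>
          using C'[OF that] by (meson mult_right_mono norm_blinfun norm_ge_zero order_trans)
      qed (use has_integral_kern_unit[OF alpha(1) alpha(1)] in auto)
      then show "norm (kern_mean \<alpha> \<alpha> (\<lambda>\<tau>. P \<tau> y) t) \<le> norm y * (C * Beta \<alpha> \<alpha>)"
        using has_integral_kern_unit[OF alpha(1) alpha(1)] by (simp add: integral_unique mult_ac)
    qed
  qed
  then have "bounded_linear (\<lambda>y. (1 / Gamma \<alpha>) *\<^sub>R kern_mean \<alpha> \<alpha> (\<lambda>\<tau>. P \<tau> y) t)"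
    by (rule bounded_linear_scaleR_right[THEN bounded_linear_compose])
  then show ?thesis unfolding W_def by (simp add: bounded_linear_Blinfun_apply)
qed

text \<open>Beta(\<alpha>,\<alpha>) / Gamma(\<alpha>)^2 = 1 / Gamma(2\<alpha>). This is the origin
  of the normalising factor Gamma(2\<alpha>) in the definition of the generator.\<close>

lemma W_zero: "W 0 y = (1 / Gamma (2 * \<alpha>)) *\<^sub>R y"
proof -
  have "W 0 y = (1 / Gamma \<alpha>) *\<^sub>R (Beta \<alpha> \<alpha> *\<^sub>R ((1 / Gamma \<alpha>) *\<^sub>R y))"
    using alpha by (simp add: W_apply kern_mean_zero P_nonpos)
  then show ?thesis using Gamma_pos by (simp add: Beta_def)
qed

lemma continuous_on_W: "continuous_on {0..T} (\<lambda>t. W t y)"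
  unfolding W_apply
proof (intro continuous_on_scaleR continuous_on_const continuous_on_kern_mean)
  show "continuous_on {(t, s). 0 \<le> s \<and> s \<le> t \<and> t \<le> T} (\<lambda>(t, s). P s y)"
    unfolding case_prod_unfold
    by (rule continuous_on_compose2[OF continuous_on_P]) (auto intro!: continuous_intros)
qed (use alpha in auto)

lemma continuous_on_W_apply:
  assumes "\<tau> ` U \<subseteq> {0..T}" "continuous_on U \<tau>" "continuous_on U \<phi>"
  shows "continuous_on U (\<lambda>z. W (\<tau> z) (\<phi> z))"
  using assms by (intro continuous_on_strongly_continuous_apply[OF compact_Icc continuous_on_W])

text \<open>\<open>V t\<close> is \<open>J\<^sup>\<alpha>S(t)\<close>, see \<open>frac_integral_S\<close>.\<close>

definition V :: "real \<Rightarrow> 'a \<Rightarrow>\<^sub>L 'a" where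
  "V t = kern (2 * \<alpha>) t *\<^sub>R W t"

lemma V_apply: "V t y = kern (2 * \<alpha>) t *\<^sub>R W t y"
  by (simp add: V_def scaleR_blinfun.rep_eq)

lemma has_integral_V:
  assumes "0 \<le> t"
  shows "((\<lambda>\<tau>. (kern \<alpha> (t - \<tau>) * kern \<alpha> \<tau>) *\<^sub>R P \<tau> y) has_integral Gamma \<alpha> *\<^sub>R V t y) {0..t}"
proof (cases "t = 0")
  case False
  have "((\<lambda>\<tau>. (kern \<alpha> (t - \<tau>) * kern \<alpha> \<tau>) *\<^sub>R P \<tau> y) has_integral
      kern (\<alpha> + \<alpha>) t *\<^sub>R kern_mean \<alpha> \<alpha> (\<lambda>\<tau>. P \<tau> y) t) {0..t}"
    by (intro has_integral_kern_mean alpha continuous_on_subset[OF continuous_on_P subset_UNIV])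
      (use False assms in simp)
  then show ?thesis
    using Gamma_pos by (simp add: V_apply W_apply flip: mult_2)
qed (simp add: V_apply has_integral_refl)

lemma frac_integral_S: "0 \<le> t \<Longrightarrow> frac_integral \<alpha> (\<lambda>\<tau>. S \<tau> y) t = V t y"
  using frac_integral_kern[of t "\<lambda>\<tau>. S \<tau> y" \<alpha> "\<lambda>\<tau>. P \<tau> y" \<alpha>] integral_unique[OF has_integral_V[of t y]] Gamma_pos
  by (simp add: S_eq)

text \<open>The generator's difference quotient, without the factor Gamma(2\<alpha>), taken as a
  bounded operator on the whole space so that it passes through integrals.\<close>

definition Q :: "real \<Rightarrow> 'a \<Rightarrow>\<^sub>L 'a" where
  "Q \<sigma> = \<sigma> powr (- \<alpha>) *\<^sub>R (\<sigma> powr (1 - \<alpha>) *\<^sub>R S \<sigma> - (1 / Gamma \<alpha>) *\<^sub>R id_blinfun)"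

lemma Q_apply: "Q \<sigma> y = generator_quotient \<alpha> S y \<sigma>"
  by (simp add: Q_def generator_quotient_def scaleR_blinfun.rep_eq minus_blinfun.rep_eq)

text \<open>This is (P3). It turns the difference quotients of \<open>V t y\<close> into bounded operators converging strongly
  to a multiple of the identity.\<close>

lemma Q_V:
  assumes s: "0 < s" and t: "0 \<le> t"
  shows "Q s (V t y) = W s (kern \<alpha> t *\<^sub>R P t y - (kern \<alpha> t / Gamma \<alpha>) *\<^sub>R y)"
proof (cases "t = 0")
  case True
  then show ?thesis by (simp add: V_apply blinfun.zero_right)
next
  case False
  then have t0: "t > 0" using t by simp
  have "S s (frac_integral \<alpha> (\<lambda>\<tau>. S \<tau> y) t) - frac_integral \<alpha> (\<lambda>\<tau>. S \<tau> (S t y)) s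
      = (s powr (\<alpha> - 1) / Gamma \<alpha>) *\<^sub>R frac_integral \<alpha> (\<lambda>\<tau>. S \<tau> y) t
       - (t powr (\<alpha> - 1) / Gamma \<alpha>) *\<^sub>R frac_integral \<alpha> (\<lambda>\<tau>. S \<tau> y) s"
    using res s t0 unfolding fractional_resolvent_def by blast
  then have eq: "S s (V t y) - (s powr (\<alpha> - 1) / Gamma \<alpha>) *\<^sub>R V t y
      = V s (S t y) - (kern \<alpha> t / Gamma \<alpha>) *\<^sub>R V s y"
    using s t0 by (simp add: frac_integral_S kern_eq_powr algebra_simps)
  \<comment> \<open>The factor s^(1-2\<alpha>) does two things at once: it turns the left side of
    (P3) into \<open>Q s\<close>, and on the right it is the reciprocal of
    \<open>kern (2 * \<alpha>) s\<close>, so \<open>V s\<close> becomes \<open>W s\<close>.\<close>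
  have "Q s (V t y) = s powr (1 - 2 * \<alpha>) *\<^sub>R (S s (V t y) - (s powr (\<alpha> - 1) / Gamma \<alpha>) *\<^sub>R V t y)"
  proof -
    have "s powr (- \<alpha>) * s powr (1 - \<alpha>) = s powr (1 - 2 * \<alpha>)"
      "s powr (1 - 2 * \<alpha>) * s powr (\<alpha> - 1) = s powr (- \<alpha>)"
      by (simp_all flip: powr_add)
    then show ?thesis
      by (simp add: Q_apply generator_quotient_def scaleR_diff_right)
  qed
  also have "\<dots> = s powr (1 - 2 * \<alpha>) *\<^sub>R V s (S t y - (kern \<alpha> t / Gamma \<alpha>) *\<^sub>R y)"
    unfolding eq by (simp add: blinfun.diff_right blinfun.scaleR_right)
  also have "\<dots> = W s (S t y - (kern \<alpha> t / Gamma \<alpha>) *\<^sub>R y)"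
  proof -
    have "s powr (1 - 2 * \<alpha>) * kern (2 * \<alpha>) s = 1"
      using s by (simp add: powr_mult_kern kern_one)
    then show ?thesis by (simp add: V_apply)
  qed
  finally show ?thesis using t0 by (simp add: S_eq)
qed

lemma tendsto_W: "((\<lambda>s. W s y) \<longlongrightarrow> (1 / Gamma (2 * \<alpha>)) *\<^sub>R y) (at_right 0)"
proof -
  have "((\<lambda>s. W s y) \<longlongrightarrow> W 0 y) (at 0 within {0..1})"
    using continuous_on_W[of 1 y] by (auto simp: continuous_on_def)
  then show ?thesis
    by (simp add: W_zero at_within_Icc_at_right)
qed

text \<open>As \<sigma> tends to 0, \<open>W \<sigma> w\<close> converges to w / Gamma(2\<alpha>).
  An identity between bounded operators at each \<sigma> > 0 therefore settles both membership in
  the domain and the value of the generator.\<close>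

lemma generator_eqI:
  assumes "\<And>\<sigma>. 0 < \<sigma> \<Longrightarrow> Q \<sigma> z = W \<sigma> w"
  shows "z \<in> generator_domain \<alpha> S" and "generator \<alpha> S z = w"
proof -
  have lim: "(generator_quotient \<alpha> S z \<longlongrightarrow> (1 / Gamma (2 * \<alpha>)) *\<^sub>R w) (at_right 0)"
    by (rule Lim_transform_eventually[OF tendsto_W])
      (auto simp: assms simp flip: Q_apply intro!: eventually_at_rightI[of 0 1])
  then show "z \<in> generator_domain \<alpha> S" by (auto simp: generator_domain_def)
  have "Gamma (2 * \<alpha>) > 0" using alpha by (intro Gamma_real_pos) auto
  then show "generator \<alpha> S z = w"
    using tendsto_Lim[OF _ lim] by (simp add: generator_def)
qed

lemma W_S_commute: "0 < s \<Longrightarrow> W t (S s y) = S s (W t y)"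
proof -
  assume s: "0 < s"
  have "integral {0..1} (S s \<circ> (\<lambda>\<sigma>. (kern \<alpha> (1 - \<sigma>) * kern \<alpha> \<sigma>) *\<^sub>R P (t * \<sigma>) y))
     = S s (integral {0..1} (\<lambda>\<sigma>. (kern \<alpha> (1 - \<sigma>) * kern \<alpha> \<sigma>) *\<^sub>R P (t * \<sigma>) y))"
    by (intro integral_linear P_mean_integrable blinfun.bounded_linear_right)
  then show ?thesis
    using s by (simp add: W_apply kern_mean_def o_def blinfun.scaleR_right P_commute)
qed

lemma V_Q_commute: "0 < \<sigma> \<Longrightarrow> V t (Q \<sigma> y) = Q \<sigma> (V t y)"
  by (simp add: Q_apply generator_quotient_def V_apply blinfun.diff_right blinfun.scaleR_right W_S_commute
      scaleR_diff_right mult_ac)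

text \<open>The bounded \<open>V t\<close> lets the limit defining the generator pass outside. By
  (P2) it commutes with \<open>Q \<sigma>\<close>, so (P3), in the form \<open>Q_V\<close>,
  identifies the quotients with \<open>W \<sigma> ?w\<close>, whose limit is known.\<close>

lemma V_generator:
  assumes y: "y \<in> generator_domain \<alpha> S" and t: "0 \<le> t"
  shows "V t (generator \<alpha> S y) = kern \<alpha> t *\<^sub>R P t y - (kern \<alpha> t / Gamma \<alpha>) *\<^sub>R y" (is "_ = ?w")
proof -
  obtain l where l: "(generator_quotient \<alpha> S y \<longlongrightarrow> l) (at_right 0)"
    using y by (auto simp: generator_domain_def)
  then have gen: "generator \<alpha> S y = Gamma (2 * \<alpha>) *\<^sub>R l"
    by (simp add: generator_def tendsto_Lim)
  have "((\<lambda>\<sigma>. V t (Q \<sigma> y)) \<longlongrightarrow> V t l) (at_right 0)"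
    unfolding Q_apply by (intro tendsto_intros l)
  moreover have "((\<lambda>\<sigma>. V t (Q \<sigma> y)) \<longlongrightarrow> (1 / Gamma (2 * \<alpha>)) *\<^sub>R ?w) (at_right 0)"
    by (rule Lim_transform_eventually[OF tendsto_W])
      (auto simp: V_Q_commute Q_V t intro!: eventually_at_rightI[of 0 1])
  ultimately have "V t l = (1 / Gamma (2 * \<alpha>)) *\<^sub>R ?w"
    using tendsto_unique trivial_limit_at_right_real by blast
  moreover have "Gamma (2 * \<alpha>) > 0" using alpha by (intro Gamma_real_pos) auto
  ultimately show ?thesis unfolding gen by (simp add: blinfun.scaleR_right)
qed

end

section \<open>The linear problem\<close>

context resolvent
begin

text \<open>The mild solution of the linear problem with initial value \<open>y\<close> and forcing \<open>F\<close>, multiplied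
  by \<open>t\<^sup>1\<^sup>-\<^sup>\<alpha>\<close>: the second summand is \<open>t\<^sup>1\<^sup>-\<^sup>\<alpha>\<close> times the convolution of \<open>S\<close> and \<open>F\<close>.\<close>

definition mild_weight :: "'a \<Rightarrow> (real \<Rightarrow> 'a) \<Rightarrow> real \<Rightarrow> 'a" where
  "mild_weight y F t = P t y + t *\<^sub>R kern_mean \<alpha> 1 (\<lambda>s. P (t - s) (F s)) t"

lemma continuous_on_P_conv:
  assumes F: "continuous_on {0..T} F"
  shows "continuous_on {(t, s). 0 \<le> s \<and> s \<le> t \<and> t \<le> T} (\<lambda>(t, s). P (t - s) (F s))"
  unfolding case_prod_unfold
proof (rule continuous_on_P_apply)
  show "bounded ((\<lambda>z. fst z - snd z) ` {z. 0 \<le> snd z \<and> snd z \<le> fst z \<and> fst z \<le> T})"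
    by (rule bounded_subset[of "{0..T}"]) auto
  show "continuous_on {z. 0 \<le> snd z \<and> snd z \<le> fst z \<and> fst z \<le> T} (\<lambda>z. F (snd z))"
    by (rule continuous_on_compose2[OF F]) (auto intro!: continuous_intros)
qed (intro continuous_intros)

lemma continuous_on_P_conv1:
  assumes F: "continuous_on {0..t} F"
  shows "continuous_on {0..t} (\<lambda>s. P (t - s) (F s))"
proof (rule continuous_on_P_apply[OF _ _ F])
  show "bounded ((\<lambda>s. t - s) ` {0..t})"
    by (rule bounded_subset[of "{0..t}"]) auto
qed (intro continuous_intros)

lemma continuous_on_mild_weight:
  assumes "continuous_on {0..T} F"
  shows "continuous_on {0..T} (mild_weight y F)"
  unfolding mild_weight_def
  by (intro continuous_on_add continuous_on_scaleR continuous_on_id continuous_on_kern_mean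
      continuous_on_P_conv assms continuous_on_subset[OF continuous_on_P subset_UNIV] alpha zero_less_one)

text \<open>The trivial factor \<open>kern 1 s\<close> brings the convolution of \<open>S\<close>
  and \<open>F\<close> into the two-kernel form of the preceding section; t^(\<alpha>-1) times the
  factor t in \<open>mild_weight\<close> is the expected power t^\<alpha>.\<close>

lemma kern_mild_weight:
  assumes F: "continuous_on {0..t} F" and t: "0 \<le> t"
  shows "kern \<alpha> t *\<^sub>R mild_weight y F t
    = kern \<alpha> t *\<^sub>R P t y + integral {0..t} (\<lambda>s. (kern \<alpha> (t - s) * kern 1 s) *\<^sub>R P (t - s) (F s))"
proof (cases "t = 0")
  case False
  then have t0: "t > 0" using t by simp
  have "integral {0..t} (\<lambda>s. (kern \<alpha> (t - s) * kern 1 s) *\<^sub>R P (t - s) (F s))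
      = kern (\<alpha> + 1) t *\<^sub>R kern_mean \<alpha> 1 (\<lambda>s. P (t - s) (F s)) t"
    by (intro integral_unique has_integral_kern_mean alpha zero_less_one t0 continuous_on_P_conv1 F)
  moreover have "kern \<alpha> t * t = kern (\<alpha> + 1) t"
    using t0 powr_mult_kern[OF t0, of 1 \<alpha>] by (simp add: mult.commute add.commute)
  ultimately show ?thesis
    by (simp add: mild_weight_def scaleR_add_right)
qed simp

lemma V_conv_integrable:
  assumes F: "continuous_on {0..t} F" and c: "0 < c" and t: "0 \<le> t"
  shows "(\<lambda>s. kern c s *\<^sub>R V (t - s) (F s)) integrable_on {0..t}"
proof -
  have "(\<lambda>s. (kern (2 * \<alpha>) (t - s) * kern c s) *\<^sub>R W (t - s) (F s)) integrable_on {0..t}"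
  proof (rule integrable_on_scaleR_continuous)
    show "(\<lambda>s. kern (2 * \<alpha>) (t - s) * kern c s) integrable_on {0..t}"
      using has_integral_kern_conv[of "2 * \<alpha>" c t t] alpha c by auto
    show "continuous_on {0..t} (\<lambda>s. W (t - s) (F s))"
      by (rule continuous_on_W_apply[where T = t, OF _ _ F]) (auto intro!: continuous_intros)
  qed simp
  then show ?thesis by (simp add: V_apply mult.commute)
qed

lemma integral_V_shift:
  assumes "0 \<le> s" "s \<le> t"
  shows "integral {0..t - s} (\<lambda>\<sigma>. (kern \<alpha> (t - s - \<sigma>) * kern \<alpha> \<sigma>) *\<^sub>R P \<sigma> y) = Gamma \<alpha> *\<^sub>R V (t - s) y"
  using assms by (intro integral_unique has_integral_V) auto

text \<open>Dirichlet's formula shows that the fractional integral of \<open>u\<close> is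
  \<open>V t y\<close> plus the convolution \<open>z\<close> of \<open>V\<close> with
  \<open>F\<close>. On both summands \<open>Q \<sigma>\<close> acts by (P3), and
  \<open>generator_eqI\<close> then gives both claims.\<close>

lemma linear_mild_solution:
  assumes F: "continuous_on {0..T} F" and t: "t \<in> {0<..T}"
    and u: "\<And>\<tau>. \<tau> \<in> {0<..T} \<Longrightarrow> u \<tau> = kern \<alpha> \<tau> *\<^sub>R mild_weight y F \<tau>"
  shows "frac_integral \<alpha> u t \<in> generator_domain \<alpha> S"
    and "u t = (kern \<alpha> t / Gamma \<alpha>) *\<^sub>R y + generator \<alpha> S (frac_integral \<alpha> u t) + frac_integral \<alpha> F t"
proof -
  have t0: "0 \<le> t" "t \<le> T" using t by auto
  have Ft: "continuous_on {0..\<tau>} F" if "\<tau> \<in> {0..t}" for \<tau>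
    using that t by (intro continuous_on_subset[OF F]) auto
  define I where "I = (\<lambda>\<tau>. integral {0..\<tau>} (\<lambda>s. (kern \<alpha> (\<tau> - s) * kern 1 s) *\<^sub>R P (\<tau> - s) (F s)))"
  define z where "z = integral {0..t} (\<lambda>s. kern 1 s *\<^sub>R V (t - s) (F s))"
  let ?w = "\<lambda>s. kern \<alpha> (t - s) *\<^sub>R P (t - s) (F s) - (kern \<alpha> (t - s) / Gamma \<alpha>) *\<^sub>R F s"
  have eq: "(kern \<alpha> (t - \<tau>) * kern \<alpha> \<tau>) *\<^sub>R mild_weight y F \<tau>
      = (kern \<alpha> (t - \<tau>) * kern \<alpha> \<tau>) *\<^sub>R P \<tau> y + kern \<alpha> (t - \<tau>) *\<^sub>R I \<tau>" if "\<tau> \<in> {0..t}" for \<tau>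
    using kern_mild_weight[OF Ft[OF that], of y] that
    by (simp add: I_def scaleR_add_right flip: scaleR_scaleR)
  have "(\<lambda>\<tau>. (kern \<alpha> (t - \<tau>) * kern \<alpha> \<tau>) *\<^sub>R mild_weight y F \<tau>) integrable_on {0..t}"
    using Ft[of t] t0 alpha by (intro kern_conv_integrable continuous_on_mild_weight) auto
  then have int1: "(\<lambda>\<tau>. (kern \<alpha> (t - \<tau>) * kern \<alpha> \<tau>) *\<^sub>R P \<tau> y + kern \<alpha> (t - \<tau>) *\<^sub>R I \<tau>) integrable_on {0..t}"
    by (rule integrable_eq) (simp add: eq)
  have int2: "(\<lambda>\<tau>. (kern \<alpha> (t - \<tau>) * kern \<alpha> \<tau>) *\<^sub>R P \<tau> y) integrable_on {0..t}"
    using has_integral_V[OF t0(1)] by blast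
  \<comment> \<open>Integrability of the iterated part is obtained by subtraction: the sum is
    integrable because \<open>mild_weight\<close> is continuous, and so is the \<open>P\<close>
    term.\<close>
  have int3: "(\<lambda>\<tau>. kern \<alpha> (t - \<tau>) *\<^sub>R I \<tau>) integrable_on {0..t}"
    using integrable_diff[OF int1 int2] by simp
  have "frac_integral \<alpha> u t = (1 / Gamma \<alpha>) *\<^sub>R integral {0..t} (\<lambda>\<tau>. (kern \<alpha> (t - \<tau>) * kern \<alpha> \<tau>) *\<^sub>R mild_weight y F \<tau>)"
    using u t by (intro frac_integral_kern) auto
  also have "integral {0..t} (\<lambda>\<tau>. (kern \<alpha> (t - \<tau>) * kern \<alpha> \<tau>) *\<^sub>R mild_weight y F \<tau>)
      = integral {0..t} (\<lambda>\<tau>. (kern \<alpha> (t - \<tau>) * kern \<alpha> \<tau>) *\<^sub>R P \<tau> y + kern \<alpha> (t - \<tau>) *\<^sub>R I \<tau>)"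
    by (rule Henstock_Kurzweil_Integration.integral_cong) (rule eq)
  also have "\<dots> = Gamma \<alpha> *\<^sub>R V t y + integral {0..t} (\<lambda>\<tau>. kern \<alpha> (t - \<tau>) *\<^sub>R I \<tau>)"
    using Henstock_Kurzweil_Integration.integral_add[OF int2 int3] integral_unique[OF has_integral_V[OF t0(1)]]
    by simp
  also have "integral {0..t} (\<lambda>\<tau>. kern \<alpha> (t - \<tau>) *\<^sub>R I \<tau>)
      = integral {0..t} (\<lambda>s. kern 1 s *\<^sub>R integral {0..t - s}
          (\<lambda>\<sigma>. (kern \<alpha> (t - s - \<sigma>) * kern \<alpha> \<sigma>) *\<^sub>R P (s + \<sigma> - s) (F s)))"
    unfolding I_def
  proof (rule kern_Dirichlet_formula)
    show "continuous_on ({0..t} \<times> {0..t}) (\<lambda>(x, y). P (x - y) (F y))"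
      unfolding case_prod_unfold
    proof (rule continuous_on_P_apply)
      show "bounded ((\<lambda>p. fst p - snd p) ` ({0..t} \<times> {0..t}))"
        by (rule bounded_subset[of "{-t..t}"]) auto
      show "continuous_on ({0..t} \<times> {0..t}) (\<lambda>p. F (snd p))"
        using t0 by (intro continuous_on_compose2[OF F] continuous_intros) auto
    qed (intro continuous_intros)
  qed (use alpha t0 in auto)
  also have "\<dots> = integral {0..t} (\<lambda>s. Gamma \<alpha> *\<^sub>R (kern 1 s *\<^sub>R V (t - s) (F s)))"
    by (rule Henstock_Kurzweil_Integration.integral_cong) (simp add: integral_V_shift)
  also have "\<dots> = Gamma \<alpha> *\<^sub>R z"
    unfolding z_def by (rule integral_cmul)
  finally have J: "frac_integral \<alpha> u t = V t y + z"
    using Gamma_pos by (simp flip: scaleR_add_right)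
  have Vint: "(\<lambda>s. kern 1 s *\<^sub>R V (t - s) (F s)) integrable_on {0..t}"
    using Ft[of t] t0 by (intro V_conv_integrable) auto
  have i1: "(\<lambda>s. (kern \<alpha> (t - s) * kern 1 s) *\<^sub>R P (t - s) (F s)) integrable_on {0..t}"
    using Ft[of t] t0 alpha by (intro kern_conv_integrable continuous_on_P_conv1) auto
  have i2: "(\<lambda>s. (kern \<alpha> (t - s) * kern 1 s) *\<^sub>R F s) integrable_on {0..t}"
    using Ft[of t] t0 alpha by (intro kern_conv_integrable) auto
  have weq: "kern 1 s *\<^sub>R ?w s = (kern \<alpha> (t - s) * kern 1 s) *\<^sub>R P (t - s) (F s)
      - (1 / Gamma \<alpha>) *\<^sub>R ((kern \<alpha> (t - s) * kern 1 s) *\<^sub>R F s)" for s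
    by (simp add: scaleR_diff_right mult.commute)
  have wint: "(\<lambda>s. kern 1 s *\<^sub>R ?w s) integrable_on {0..t}"
    unfolding weq by (intro integrable_diff i1 integrable_cmul i2)
  have JF: "frac_integral \<alpha> F t = (1 / Gamma \<alpha>) *\<^sub>R integral {0..t} (\<lambda>s. (kern \<alpha> (t - s) * kern 1 s) *\<^sub>R F s)"
    by (rule frac_integral_kern) (simp add: kern_one)
  have wI: "integral {0..t} (\<lambda>s. kern 1 s *\<^sub>R ?w s) = I t - frac_integral \<alpha> F t"
    unfolding weq JF I_def Henstock_Kurzweil_Integration.integral_diff[OF i1 integrable_cmul[OF i2]] integral_cmul ..
  \<comment> \<open>\<open>Q \<sigma>\<close> is taken inside the integral, (P3) is applied
    pointwise, and \<open>W \<sigma>\<close> is taken out again. The generator itself is not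
    involved yet.\<close>
  have Qz: "Q \<sigma> z = W \<sigma> (I t - frac_integral \<alpha> F t)" if "0 < \<sigma>" for \<sigma>
  proof -
    have "Q \<sigma> z = integral {0..t} (Q \<sigma> \<circ> (\<lambda>s. kern 1 s *\<^sub>R V (t - s) (F s)))"
      unfolding z_def by (intro integral_linear[symmetric] Vint blinfun.bounded_linear_right)
    also have "\<dots> = integral {0..t} (W \<sigma> \<circ> (\<lambda>s. kern 1 s *\<^sub>R ?w s))"
      by (rule Henstock_Kurzweil_Integration.integral_cong) (simp add: blinfun.scaleR_right Q_V that)
    also have "\<dots> = W \<sigma> (integral {0..t} (\<lambda>s. kern 1 s *\<^sub>R ?w s))"
      by (intro integral_linear wint blinfun.bounded_linear_right)
    finally show ?thesis unfolding wI .
  qed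
  have Q: "Q \<sigma> (frac_integral \<alpha> u t)
      = W \<sigma> (kern \<alpha> t *\<^sub>R P t y - (kern \<alpha> t / Gamma \<alpha>) *\<^sub>R y + (I t - frac_integral \<alpha> F t))" if "0 < \<sigma>" for \<sigma>
    unfolding J blinfun.add_right using that t0 by (simp only: Q_V Qz blinfun.add_right)
  show "frac_integral \<alpha> u t \<in> generator_domain \<alpha> S"
    using generator_eqI(1)[OF Q] by blast
  have "generator \<alpha> S (frac_integral \<alpha> u t)
      = kern \<alpha> t *\<^sub>R P t y - (kern \<alpha> t / Gamma \<alpha>) *\<^sub>R y + (I t - frac_integral \<alpha> F t)"
    using generator_eqI(2)[OF Q] by blast
  moreover have "u t = kern \<alpha> t *\<^sub>R P t y + I t"
    using u[OF t] kern_mild_weight[OF Ft[of t] t0(1), of y] t0 by (simp add: I_def)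
  ultimately show "u t = (kern \<alpha> t / Gamma \<alpha>) *\<^sub>R y + generator \<alpha> S (frac_integral \<alpha> u t) + frac_integral \<alpha> F t"
    by simp
qed

text \<open>For \<open>z = J\<^sup>\<alpha> w\<close>, integrating \<open>V (t - s) (w s) = V (t - s) (A (z s))\<close> and exchanging integrals
  leaves \<open>J\<^sup>\<alpha> z = 0\<close>, so \<open>z = 0\<close> by injectivity of \<open>J\<^sup>\<alpha>\<close>.\<close>

lemma homogeneous_mild_solution_eq_0:
  assumes \<phi>: "continuous_on {0..T} \<phi>"
    and w: "\<And>t. t \<in> {0<..T} \<Longrightarrow> w t = kern \<alpha> t *\<^sub>R \<phi> t"
    and dom: "\<And>t. t \<in> {0<..T} \<Longrightarrow> frac_integral \<alpha> w t \<in> generator_domain \<alpha> S"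
    and eq: "\<And>t. t \<in> {0<..T} \<Longrightarrow> w t = generator \<alpha> S (frac_integral \<alpha> w t)"
    and t: "t \<in> {0<..T}"
  shows "w t = 0"
proof -
  define \<zeta> where "\<zeta> = (\<lambda>t. (1 / Gamma \<alpha>) *\<^sub>R kern_mean \<alpha> \<alpha> \<phi> t)"
  define J where "J = (\<lambda>t. integral {0..t} (\<lambda>s. (kern \<alpha> (t - s) * kern \<alpha> s) *\<^sub>R \<phi> s))"
  have \<phi>t: "continuous_on {0..t} \<phi>" if "t \<le> T" for t
    using that by (intro continuous_on_subset[OF \<phi>]) auto
  have "continuous_on {(t, s). 0 \<le> s \<and> s \<le> t \<and> t \<le> T} (\<lambda>(t, s). \<phi> s)"
    unfolding case_prod_unfold by (intro continuous_on_compose2[OF \<phi>] continuous_intros) auto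
  then have \<zeta>: "continuous_on {0..T} \<zeta>"
    unfolding \<zeta>_def
    using continuous_on_kern_mean[of \<alpha> \<alpha> T "\<lambda>_. \<phi>"] alpha by (intro continuous_intros) auto
  have J: "J t = Gamma \<alpha> *\<^sub>R (kern (2 * \<alpha>) t *\<^sub>R \<zeta> t)" if "t \<in> {0..T}" for t
  proof (cases "t = 0")
    case False
    then have "J t = kern (\<alpha> + \<alpha>) t *\<^sub>R kern_mean \<alpha> \<alpha> \<phi> t"
      unfolding J_def using that by (intro integral_unique has_integral_kern_mean alpha \<phi>t) auto
    then show ?thesis using Gamma_pos by (simp add: \<zeta>_def flip: mult_2)
  qed (simp add: J_def)
  have fr: "frac_integral \<alpha> w t = kern (2 * \<alpha>) t *\<^sub>R \<zeta> t" if "t \<in> {0..T}" for t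
  proof -
    have "frac_integral \<alpha> w t = (1 / Gamma \<alpha>) *\<^sub>R J t"
      unfolding J_def using w that by (intro frac_integral_kern) auto
    then show ?thesis using J[OF that] Gamma_pos by simp
  qed
  have "\<zeta> t = 0" if t: "t \<in> {0<..T}" for t
  proof (rule kern_conv_eq_0_imp_eq_0[where a = \<alpha> and c = "2 * \<alpha>", OF _ _ _ \<zeta> _ t])
    fix t assume t: "t \<in> {0<..T}"
    then have t0: "0 \<le> t" "t \<le> T" by auto
    have \<zeta>t: "continuous_on {0..t} \<zeta>"
      using t0 by (intro continuous_on_subset[OF \<zeta>]) auto
    let ?X = "\<lambda>s. (kern \<alpha> (t - s) * kern (2 * \<alpha>) s) *\<^sub>R P (t - s) (\<zeta> s)"
    let ?Y = "\<lambda>s. (kern \<alpha> (t - s) * kern (2 * \<alpha>) s) *\<^sub>R \<zeta> s"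
    have X: "?X integrable_on {0..t}" and Y: "?Y integrable_on {0..t}"
      using \<zeta>t t0 alpha by (auto intro!: kern_conv_integrable continuous_on_P_conv1)
    have pt: "kern \<alpha> s *\<^sub>R V (t - s) (\<phi> s) = ?X s - (1 / Gamma \<alpha>) *\<^sub>R ?Y s" if s: "s \<in> {0..t}" for s
    proof (cases "s = 0")
      case False
      then have s': "s \<in> {0<..T}" using s t0 by auto
      have "kern \<alpha> s *\<^sub>R V (t - s) (\<phi> s) = V (t - s) (generator \<alpha> S (frac_integral \<alpha> w s))"
        using eq[OF s'] w[OF s'] by (metis blinfun.scaleR_right)
      also have "\<dots> = kern \<alpha> (t - s) *\<^sub>R P (t - s) (frac_integral \<alpha> w s)
          - (kern \<alpha> (t - s) / Gamma \<alpha>) *\<^sub>R frac_integral \<alpha> w s"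
        using s by (intro V_generator dom s') auto
      finally show ?thesis using s t0 by (simp add: fr blinfun.scaleR_right)
    qed simp
    \<comment> \<open>Associativity of convolution, S * (J w) = (J S) * w with J the fractional
      integral of order \<alpha>, shows that \<open>?X\<close> has the same integral as the left
      side of \<open>pt\<close>. Integrating \<open>pt\<close> thus leaves only the
      \<open>?Y\<close> term, a multiple of the twofold fractional integral of
      \<open>w\<close>.\<close>
    have "integral {0..t} ?X = integral {0..t} (\<lambda>\<tau>. (1 / Gamma \<alpha>) *\<^sub>R (kern \<alpha> (t - \<tau>) *\<^sub>R
        integral {0..\<tau>} (\<lambda>s. (kern \<alpha> (\<tau> - s) * kern \<alpha> s) *\<^sub>R P (t - \<tau>) (\<phi> s))))"
    proof (rule Henstock_Kurzweil_Integration.integral_cong)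
      fix \<tau> assume \<tau>: "\<tau> \<in> {0..t}"
      have "integral {0..\<tau>} (\<lambda>s. (kern \<alpha> (\<tau> - s) * kern \<alpha> s) *\<^sub>R P (t - \<tau>) (\<phi> s))
        = integral {0..\<tau>} (P (t - \<tau>) \<circ> (\<lambda>s. (kern \<alpha> (\<tau> - s) * kern \<alpha> s) *\<^sub>R \<phi> s))"
        by (simp add: o_def blinfun.scaleR_right)
      also have "\<dots> = P (t - \<tau>) (J \<tau>)"
        unfolding J_def using \<tau> t0 alpha
        by (intro integral_linear kern_conv_integrable \<phi>t blinfun.bounded_linear_right) auto
      finally show "?X \<tau> = (1 / Gamma \<alpha>) *\<^sub>R (kern \<alpha> (t - \<tau>) *\<^sub>R
        integral {0..\<tau>} (\<lambda>s. (kern \<alpha> (\<tau> - s) * kern \<alpha> s) *\<^sub>R P (t - \<tau>) (\<phi> s)))"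
        using J[of \<tau>] \<tau> t0 Gamma_pos by (simp add: blinfun.scaleR_right)
    qed
    also have "\<dots> = (1 / Gamma \<alpha>) *\<^sub>R integral {0..t} (\<lambda>\<tau>. kern \<alpha> (t - \<tau>) *\<^sub>R
        integral {0..\<tau>} (\<lambda>s. (kern \<alpha> (\<tau> - s) * kern \<alpha> s) *\<^sub>R P (t - \<tau>) (\<phi> s)))"
      by (rule integral_cmul)
    also have "integral {0..t} (\<lambda>\<tau>. kern \<alpha> (t - \<tau>) *\<^sub>R
        integral {0..\<tau>} (\<lambda>s. (kern \<alpha> (\<tau> - s) * kern \<alpha> s) *\<^sub>R P (t - \<tau>) (\<phi> s)))
      = integral {0..t} (\<lambda>s. kern \<alpha> s *\<^sub>R integral {0..t - s}
          (\<lambda>\<sigma>. (kern \<alpha> (t - s - \<sigma>) * kern \<alpha> \<sigma>) *\<^sub>R P (t - (s + \<sigma>)) (\<phi> s)))"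
    proof (rule kern_Dirichlet_formula)
      show "continuous_on ({0..t} \<times> {0..t}) (\<lambda>(x, y). P (t - x) (\<phi> y))"
        unfolding case_prod_unfold
      proof (rule continuous_on_P_apply)
        show "bounded ((\<lambda>p. t - fst p) ` ({0..t} \<times> {0..t}))"
          by (rule bounded_subset[of "{0..t}"]) auto
        show "continuous_on ({0..t} \<times> {0..t}) (\<lambda>p. \<phi> (snd p))"
          using t0 by (intro continuous_on_compose2[OF \<phi>] continuous_intros) auto
      qed (intro continuous_intros)
    qed (use alpha t0 in auto)
    also have "\<dots> = integral {0..t} (\<lambda>s. Gamma \<alpha> *\<^sub>R (kern \<alpha> s *\<^sub>R V (t - s) (\<phi> s)))"
    proof (rule Henstock_Kurzweil_Integration.integral_cong)
      fix s assume s: "s \<in> {0..t}"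
      \<comment> \<open>The exchange leaves \<open>P\<close> at the reversed argument t - s -
        \<sigma>. Both kernels have exponent \<alpha>, so reflecting \<sigma> restores the integral
        that defines \<open>V (t - s)\<close>.\<close>
      have "integral {0..t - s} (\<lambda>\<sigma>. (kern \<alpha> (t - s - \<sigma>) * kern \<alpha> \<sigma>) *\<^sub>R P (t - (s + \<sigma>)) (\<phi> s))
          = integral {0..t - s} (\<lambda>\<sigma>. (kern \<alpha> (t - s - \<sigma>) * kern \<alpha> \<sigma>) *\<^sub>R P \<sigma> (\<phi> s))"
        using integral_kern_conv_reflect[of "t - s" \<alpha> \<alpha> "\<lambda>\<sigma>. P \<sigma> (\<phi> s)"] by (simp add: diff_diff_eq)
      also have "\<dots> = Gamma \<alpha> *\<^sub>R V (t - s) (\<phi> s)"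
        using s by (intro integral_V_shift) auto
      finally show "kern \<alpha> s *\<^sub>R integral {0..t - s} (\<lambda>\<sigma>. (kern \<alpha> (t - s - \<sigma>) * kern \<alpha> \<sigma>) *\<^sub>R P (t - (s + \<sigma>)) (\<phi> s))
          = Gamma \<alpha> *\<^sub>R (kern \<alpha> s *\<^sub>R V (t - s) (\<phi> s))" by simp
    qed
    also have "\<dots> = Gamma \<alpha> *\<^sub>R integral {0..t} (\<lambda>s. kern \<alpha> s *\<^sub>R V (t - s) (\<phi> s))"
      by (rule integral_cmul)
    finally have "integral {0..t} ?X = integral {0..t} (\<lambda>s. kern \<alpha> s *\<^sub>R V (t - s) (\<phi> s))"
      using Gamma_pos by simp
    also have "\<dots> = integral {0..t} (\<lambda>s. ?X s - (1 / Gamma \<alpha>) *\<^sub>R ?Y s)"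
      by (rule Henstock_Kurzweil_Integration.integral_cong) (rule pt)
    also have "\<dots> = integral {0..t} ?X - (1 / Gamma \<alpha>) *\<^sub>R integral {0..t} ?Y"
      unfolding Henstock_Kurzweil_Integration.integral_diff[OF X integrable_cmul[OF Y]] integral_cmul ..
    finally have "(1 / Gamma \<alpha>) *\<^sub>R integral {0..t} ?Y = 0"
      by (simp only: eq_diff_eq add_cancel_left_right)
    then show "integral {0..t} ?Y = 0" using Gamma_pos by simp
  qed (use alpha in auto)
  then have "frac_integral \<alpha> w t = 0" using fr t by simp
  moreover have "generator \<alpha> S 0 = 0"
    by (rule generator_eqI(2)) (simp add: blinfun.zero_right)
  ultimately show ?thesis using eq[OF t] by simp
qed

text \<open>\<open>mild_weight\<close> gives one solution. By linearity of \<open>A\<close> on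
  \<open>D\<close>, its difference from any other solution solves the problem with zero data and so
  vanishes. The equation speaks about t > 0 only, hence the equality on (0,T]; continuity supplies t
  = 0 later.\<close>

theorem linear_mild_solution_iff:
  assumes A: "linear_operator D A" and gen: "generates \<alpha> D A S"
    and F: "continuous_on {0..T} F"
    and \<phi>: "continuous_on {0..T} \<phi>" and u: "\<And>t. t \<in> {0<..T} \<Longrightarrow> u t = kern \<alpha> t *\<^sub>R \<phi> t"
  shows "(\<forall>t\<in>{0<..T}. frac_integral \<alpha> u t \<in> D) \<and>
      (\<forall>t\<in>{0<..T}. u t = (kern \<alpha> t / Gamma \<alpha>) *\<^sub>R y + A (frac_integral \<alpha> u t) + frac_integral \<alpha> F t)
    \<longleftrightarrow> (\<forall>t\<in>{0<..T}. \<phi> t = mild_weight y F t)" (is "?L \<longleftrightarrow> ?R")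
proof -
  have D: "D = generator_domain \<alpha> S" and Agen: "\<And>y. y \<in> D \<Longrightarrow> A y = generator \<alpha> S y"
    using gen by (auto simp: generates_def)
  show ?thesis
  proof
    assume ?R
    then have u': "u t = kern \<alpha> t *\<^sub>R mild_weight y F t" if "t \<in> {0<..T}" for t
      using u that by simp
    show ?L
    proof (intro conjI ballI)
      fix t assume t: "t \<in> {0<..T}"
      show dom: "frac_integral \<alpha> u t \<in> D"
        unfolding D by (rule linear_mild_solution(1)[OF F t u'])
      show "u t = (kern \<alpha> t / Gamma \<alpha>) *\<^sub>R y + A (frac_integral \<alpha> u t) + frac_integral \<alpha> F t"
        unfolding Agen[OF dom] by (rule linear_mild_solution(2)[OF F t u'])
    qed
  next
    assume L: ?L
    define v where "v = (\<lambda>t. kern \<alpha> t *\<^sub>R mild_weight y F t)"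
    define w where "w = (\<lambda>t. kern \<alpha> t *\<^sub>R (\<phi> t - mild_weight y F t))"
    have mw: "continuous_on {0..T} (mild_weight y F)"
      by (rule continuous_on_mild_weight[OF F])
    have frw: "frac_integral \<alpha> w t = frac_integral \<alpha> u t - frac_integral \<alpha> v t" if t: "t \<in> {0<..T}" for t
    proof -
      let ?k = "\<lambda>\<psi>. \<lambda>s. (kern \<alpha> (t - s) * kern \<alpha> s) *\<^sub>R \<psi> s"
      have "?k \<phi> integrable_on {0..t}" "?k (mild_weight y F) integrable_on {0..t}"
        using t alpha by (auto intro!: kern_conv_integrable continuous_on_subset[OF \<phi>] continuous_on_subset[OF mw])
      then have "integral {0..t} (?k (\<lambda>s. \<phi> s - mild_weight y F s))
          = integral {0..t} (?k \<phi>) - integral {0..t} (?k (mild_weight y F))"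
        by (simp add: scaleR_diff_right Henstock_Kurzweil_Integration.integral_diff)
      moreover have "frac_integral \<alpha> w t = (1 / Gamma \<alpha>) *\<^sub>R integral {0..t} (?k (\<lambda>s. \<phi> s - mild_weight y F s))"
        by (rule frac_integral_kern) (simp add: w_def)
      moreover have "frac_integral \<alpha> u t = (1 / Gamma \<alpha>) *\<^sub>R integral {0..t} (?k \<phi>)"
        using u t by (intro frac_integral_kern) auto
      moreover have "frac_integral \<alpha> v t = (1 / Gamma \<alpha>) *\<^sub>R integral {0..t} (?k (mild_weight y F))"
        by (rule frac_integral_kern) (simp add: v_def)
      ultimately show ?thesis by (simp add: scaleR_diff_right)
    qed
    have v: "frac_integral \<alpha> v t \<in> D"
        "v t = (kern \<alpha> t / Gamma \<alpha>) *\<^sub>R y + A (frac_integral \<alpha> v t) + frac_integral \<alpha> F t" if "t \<in> {0<..T}" for t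
    proof -
      show dom: "frac_integral \<alpha> v t \<in> D"
        unfolding D by (rule linear_mild_solution(1)[OF F that, where y = y]) (simp add: v_def)
      show "v t = (kern \<alpha> t / Gamma \<alpha>) *\<^sub>R y + A (frac_integral \<alpha> v t) + frac_integral \<alpha> F t"
        unfolding Agen[OF dom] by (rule linear_mild_solution(2)[OF F that]) (simp add: v_def)
    qed
    have subD: "p - q \<in> D" "A (p - q) = A p - A q" if "p \<in> D" "q \<in> D" for p q
    proof -
      have "subspace D" and add: "\<And>y z. y \<in> D \<Longrightarrow> z \<in> D \<Longrightarrow> A (y + z) = A y + A z"
        using A by (auto simp: linear_operator_def)
      then show d: "p - q \<in> D" using that by (simp add: subspace_diff)
      show "A (p - q) = A p - A q" using add[OF d that(2)] by simp
    qed
    show ?R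
    proof
      fix t assume t: "t \<in> {0<..T}"
      have "w t = 0"
      proof (rule homogeneous_mild_solution_eq_0[where \<phi> = "\<lambda>t. \<phi> t - mild_weight y F t", OF _ _ _ _ t])
        show "continuous_on {0..T} (\<lambda>t. \<phi> t - mild_weight y F t)"
          by (intro continuous_intros \<phi> mw)
        fix t assume t: "t \<in> {0<..T}"
        show "w t = kern \<alpha> t *\<^sub>R (\<phi> t - mild_weight y F t)" by (simp add: w_def)
        have dom: "frac_integral \<alpha> w t \<in> D"
          using frw[OF t] L v(1)[OF t] t subD(1) by simp
        then show "frac_integral \<alpha> w t \<in> generator_domain \<alpha> S" unfolding D .
        have "w t = u t - v t" using u[OF t] by (simp add: w_def v_def scaleR_diff_right)
        also have "\<dots> = A (frac_integral \<alpha> u t) - A (frac_integral \<alpha> v t)"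
          using L t v(2)[OF t] by simp
        also have "\<dots> = A (frac_integral \<alpha> w t)"
          unfolding frw[OF t] using L t v(1)[OF t] by (subst subD(2)) auto
        finally show "w t = generator \<alpha> S (frac_integral \<alpha> w t)" unfolding Agen[OF dom] .
      qed
      then show "\<phi> t = mild_weight y F t"
        using kern_pos[of t \<alpha>] t by (simp add: w_def)
    qed
  qed
qed

end

section \<open>The nonlinear problem\<close>

lemma Holder_integral:
  fixes f g :: "'b \<Rightarrow> real"
  assumes \<theta>: "0 < \<theta>" "\<theta> < 1" and meas: "f \<in> borel_measurable L" "g \<in> borel_measurable L"
    and nn: "\<And>x. 0 \<le> f x" "\<And>x. 0 \<le> g x"
    and f: "integrable L (\<lambda>x. f x powr (1 / \<theta>))" and g: "integrable L (\<lambda>x. g x powr (1 / (1 - \<theta>)))"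
  shows "integrable L (\<lambda>x. f x * g x)"
    and "(LINT x|L. f x * g x) \<le> (LINT x|L. f x powr (1 / \<theta>)) powr \<theta> * (LINT x|L. g x powr (1 / (1 - \<theta>))) powr (1 - \<theta>)"
proof -
  let ?A = "LINT x|L. f x powr (1 / \<theta>)" and ?B = "LINT x|L. g x powr (1 / (1 - \<theta>))"
  have young: "p * q \<le> \<theta> * p powr (1 / \<theta>) + (1 - \<theta>) * q powr (1 / (1 - \<theta>))" if "0 \<le> p" "0 \<le> q" for p q
    using Youngs_inequality[of "1 / \<theta>" "1 / (1 - \<theta>)" p q] \<theta> that by (simp add: mult.commute)
  show int: "integrable L (\<lambda>x. f x * g x)"
  proof (rule Bochner_Integration.integrable_bound)
    show "integrable L (\<lambda>x. \<theta> * f x powr (1 / \<theta>) + (1 - \<theta>) * g x powr (1 / (1 - \<theta>)))"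
      using f g by simp
    show "AE x in L. norm (f x * g x) \<le> norm (\<theta> * f x powr (1 / \<theta>) + (1 - \<theta>) * g x powr (1 / (1 - \<theta>)))"
    proof (rule AE_I2)
      fix x
      have "f x * g x \<le> \<theta> * f x powr (1 / \<theta>) + (1 - \<theta>) * g x powr (1 / (1 - \<theta>))" "0 \<le> f x * g x"
        using young[OF nn] nn by auto
      then show "norm (f x * g x) \<le> norm (\<theta> * f x powr (1 / \<theta>) + (1 - \<theta>) * g x powr (1 / (1 - \<theta>)))"
        by simp
    qed
  qed (use meas in measurable)
  have AB: "0 \<le> ?A" "0 \<le> ?B" by (simp_all add: Bochner_Integration.integral_nonneg)
  show "(LINT x|L. f x * g x) \<le> ?A powr \<theta> * ?B powr (1 - \<theta>)"
  proof (cases "?A = 0 \<or> ?B = 0")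
    case True
    have "AE x in L. f x * g x = 0"
    proof (cases "?A = 0")
      case True
      then have "AE x in L. f x powr (1 / \<theta>) = 0"
        using integral_nonneg_eq_0_iff_AE[OF f] by simp
      then show ?thesis by eventually_elim simp
    next
      case False
      then have "AE x in L. g x powr (1 / (1 - \<theta>)) = 0"
        using True integral_nonneg_eq_0_iff_AE[OF g] by simp
      then show ?thesis by eventually_elim simp
    qed
    then have "(LINT x|L. f x * g x) = 0" by (simp add: integral_eq_zero_AE)
    then show ?thesis using AB by simp
  next
    case False
    then have A: "?A > 0" and B: "?B > 0" using AB unfolding less_le by metis+
    have "f x * g x / (?A powr \<theta> * ?B powr (1 - \<theta>)) \<le> \<theta> / ?A * f x powr (1 / \<theta>) + (1 - \<theta>) / ?B * g x powr (1 / (1 - \<theta>))" for x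
    proof -
      have "(f x / ?A powr \<theta>) powr (1 / \<theta>) = f x powr (1 / \<theta>) / ?A"
        using A nn \<theta> by (simp add: powr_divide powr_powr)
      moreover have "(g x / ?B powr (1 - \<theta>)) powr (1 / (1 - \<theta>)) = g x powr (1 / (1 - \<theta>)) / ?B"
        using B nn \<theta> by (simp add: powr_divide powr_powr)
      ultimately show ?thesis
        using young[of "f x / ?A powr \<theta>" "g x / ?B powr (1 - \<theta>)"] nn by simp
    qed
    then have "(LINT x|L. f x * g x / (?A powr \<theta> * ?B powr (1 - \<theta>)))
      \<le> (LINT x|L. \<theta> / ?A * f x powr (1 / \<theta>) + (1 - \<theta>) / ?B * g x powr (1 / (1 - \<theta>)))"
      using int f g by (intro integral_mono) auto
    also have "\<dots> = \<theta> / ?A * ?A + (1 - \<theta>) / ?B * ?B"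
      using f g by simp
    also have "\<dots> = 1" using A B by simp
    finally show ?thesis using A B by (simp add: divide_le_eq)
  qed
qed

text \<open>Raising (t-s)^(a-1) to the conjugate power 1/(1-\<theta>) gives exponent a' - 1 with a'
  = (a-\<theta>)/(1-\<theta>), positive because \<theta> < a. Its integral is t^a'/a', and the power
  1-\<theta> of this is the factor seen in \<Omega>.\<close>

lemma
  assumes \<theta>: "0 < \<theta>" "\<theta> < a" and a: "a < 1" and m: "in_Lp (1 / \<theta>) {0..T} m" and t: "0 < t" "t \<le> T"
  shows kern_Lp_integrable: "(\<lambda>s. kern a (t - s) * \<bar>m s\<bar>) integrable_on {0..T}"
    and kern_Lp_integral_le: "integral {0..T} (\<lambda>s. kern a (t - s) * \<bar>m s\<bar>)
      \<le> Lp_norm (1 / \<theta>) {0..T} m * (t powr (a - \<theta>) / ((a - \<theta>) / (1 - \<theta>)) powr (1 - \<theta>))"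
proof -
  let ?L = "lebesgue_on {0..T}"
  define a' where "a' = (a - \<theta>) / (1 - \<theta>)"
  have a': "a' > 0" using \<theta> a by (simp add: a'_def)
  have k: "((\<lambda>s. kern a' (t - s)) has_integral t powr a' / a') {0..T}"
  proof -
    have "((\<lambda>s. kern a' (t - s) * kern 1 s) has_integral kern (a' + 1) t * Beta a' 1) {0..T}"
      using a' t by (intro has_integral_kern_conv) auto
    moreover have "Beta a' 1 = 1 / a'"
    proof -
      have "Gamma a' \<noteq> 0" using Gamma_real_pos[OF a'] by linarith
      moreover have "Gamma (a' + 1) = a' * Gamma a'"
        using a' by (intro Gamma_plus1) (auto simp: nonpos_Ints_def)
      ultimately show ?thesis by (simp add: Beta_def)
    qed
    ultimately have h: "((\<lambda>s. kern a' (t - s) * kern 1 s) has_integral t powr a' / a') {0..T}"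
      using t by (simp add: kern_def)
    show ?thesis
      by (rule has_integral_spike[OF _ _ h, of "{0}"]) (auto simp: kern_one)
  qed
  have kpow: "kern a (t - s) powr (1 / (1 - \<theta>)) = kern a' (t - s)" for s
    using \<theta> a by (auto simp: kern_def powr_powr a'_def divide_simps)
  have kint: "integrable ?L (\<lambda>s. kern a' (t - s))"
  proof -
    have "(\<lambda>s. kern a' (t - s)) absolutely_integrable_on {0..T}"
      using k by (intro nonnegative_absolutely_integrable_1) auto
    then show ?thesis by (simp add: set_integrable_def integrable_restrict_space)
  qed
  have kL: "(LINT s|?L. kern a' (t - s)) = t powr a' / a'"
    using lebesgue_integral_eq_integral[OF kint] k by (simp add: integral_unique)
  have kmeas: "(\<lambda>s. kern a (t - s)) \<in> borel_measurable ?L"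
  proof -
    have "(\<lambda>s. kern a (t - s)) \<in> borel_measurable lborel"
      unfolding kern_def by measurable
    then show ?thesis
      by (intro measurable_restrict_space1 measurable_completion)
  qed
  have mm: "m \<in> borel_measurable ?L" "integrable ?L (\<lambda>s. \<bar>m s\<bar> powr (1 / \<theta>))"
    using m by (auto simp: in_Lp_def)
  have H: "integrable ?L (\<lambda>s. \<bar>m s\<bar> * kern a (t - s))"
    "(LINT s|?L. \<bar>m s\<bar> * kern a (t - s)) \<le> (LINT s|?L. \<bar>m s\<bar> powr (1 / \<theta>)) powr \<theta>
       * (LINT s|?L. kern a (t - s) powr (1 / (1 - \<theta>))) powr (1 - \<theta>)"
    using Holder_integral[of \<theta> "\<lambda>s. \<bar>m s\<bar>" ?L "\<lambda>s. kern a (t - s)", unfolded kpow] \<theta> a mm kmeas kint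
    unfolding kpow by auto
  then have int: "integrable ?L (\<lambda>s. kern a (t - s) * \<bar>m s\<bar>)" by (simp add: mult.commute)
  then show "(\<lambda>s. kern a (t - s) * \<bar>m s\<bar>) integrable_on {0..T}"
    by (intro integrable_on_lebesgue_on) auto
  have "integral {0..T} (\<lambda>s. kern a (t - s) * \<bar>m s\<bar>) = (LINT s|?L. \<bar>m s\<bar> * kern a (t - s))"
    using lebesgue_integral_eq_integral[OF int] by (simp add: mult.commute)
  also have "\<dots> \<le> Lp_norm (1 / \<theta>) {0..T} m * (t powr a' / a') powr (1 - \<theta>)"
    using H(2) by (simp add: kpow kL Lp_norm_def)
  also have "(t powr a' / a') powr (1 - \<theta>) = t powr (a - \<theta>) / a' powr (1 - \<theta>)"
    using t a' \<theta> a by (simp add: powr_divide powr_powr) (simp add: a'_def)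
  finally show "integral {0..T} (\<lambda>s. kern a (t - s) * \<bar>m s\<bar>)
      \<le> Lp_norm (1 / \<theta>) {0..T} m * (t powr (a - \<theta>) / ((a - \<theta>) / (1 - \<theta>)) powr (1 - \<theta>))"
    by (simp add: a'_def)
qed

section \<open>The weighted space as the continuous functions on [0,T]\<close>

lemma continuous_on_eq_at_left_end:
  fixes \<phi> \<psi> :: "real \<Rightarrow> 'a::t2_space"
  assumes "0 < T" "continuous_on {0..T} \<phi>" "continuous_on {0..T} \<psi>"
    and eq: "\<And>t. t \<in> {0<..T} \<Longrightarrow> \<phi> t = \<psi> t" and t: "t \<in> {0..T}"
  shows "\<phi> t = \<psi> t"
proof (cases "t = 0")
  case True
  have "(\<phi> \<longlongrightarrow> \<phi> 0) (at_right 0)" "(\<psi> \<longlongrightarrow> \<psi> 0) (at_right 0)"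
    using assms(1-3) by (auto simp: continuous_on_Icc_at_rightD)
  moreover from this(2) have "(\<phi> \<longlongrightarrow> \<psi> 0) (at_right 0)"
    by (rule Lim_transform_eventually) (use assms(1) eq in \<open>auto intro!: eventually_at_rightI[of 0 T]\<close>)
  ultimately show ?thesis
    using tendsto_unique trivial_limit_at_right_real True by blast
qed (use assms in auto)

lemma kern_mult_powr: "0 < t \<Longrightarrow> t powr (1 - \<alpha>) * kern \<alpha> t = 1"
  by (simp add: powr_mult_kern kern_one)

lemma weighted_eq:
  fixes u \<phi> :: "real \<Rightarrow> 'a::real_normed_vector"
  assumes T: "0 < T" and \<phi>: "continuous_on {0..T} \<phi>"
    and u: "\<And>t. t \<in> {0<..T} \<Longrightarrow> u t = kern \<alpha> t *\<^sub>R \<phi> t" and t: "t \<in> {0..T}"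
  shows "weighted \<alpha> u t = \<phi> t"
proof (cases "t = 0")
  case True
  have "(\<phi> \<longlongrightarrow> \<phi> 0) (at_right 0)"
    using T \<phi> by (auto simp: continuous_on_Icc_at_rightD)
  then have "((\<lambda>s. s powr (1 - \<alpha>) *\<^sub>R u s) \<longlongrightarrow> \<phi> 0) (at_right 0)"
    by (rule Lim_transform_eventually)
      (use T in \<open>auto intro!: eventually_at_rightI[of 0 T] simp: u kern_mult_powr\<close>)
  then show ?thesis
    using True by (simp add: weighted_def tendsto_Lim)
qed (use t u in \<open>auto simp: weighted_def kern_mult_powr\<close>)

lemma weighted_space_eq:
  assumes "u \<in> weighted_space \<alpha> T" "t \<in> {0<..T}"
  shows "u t = kern \<alpha> t *\<^sub>R weighted \<alpha> u t"
  using assms kern_mult_powr[of t \<alpha>] by (simp add: weighted_def mult.commute)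

text \<open>Inverse of \<open>weighted\<close>. The restriction makes the result extensional, so
  that uniqueness on (0,T] becomes equality of HOL functions.\<close>

definition unweighted :: "real \<Rightarrow> real \<Rightarrow> (real \<Rightarrow> 'a::real_normed_vector) \<Rightarrow> real \<Rightarrow> 'a" where
  "unweighted \<alpha> T \<phi> = restrict (\<lambda>t. kern \<alpha> t *\<^sub>R \<phi> t) {0<..T}"

lemma unweighted_apply: "t \<in> {0<..T} \<Longrightarrow> unweighted \<alpha> T \<phi> t = kern \<alpha> t *\<^sub>R \<phi> t"
  by (simp add: unweighted_def)

lemma weighted_unweighted:
  assumes "0 < T" "continuous_on {0..T} \<phi>" "t \<in> {0..T}"
  shows "weighted \<alpha> (unweighted \<alpha> T \<phi>) t = \<phi> t"
  using assms by (intro weighted_eq[where T = T]) (auto simp: unweighted_apply)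

lemma unweighted_in_weighted_space:
  assumes "0 < T" "continuous_on {0..T} \<phi>"
  shows "unweighted \<alpha> T \<phi> \<in> weighted_space \<alpha> T"
proof -
  have "continuous_on {0..T} (weighted \<alpha> (unweighted \<alpha> T \<phi>))"
    using assms(2) by (rule continuous_on_cong[THEN iffD2, rotated 2]) (simp_all add: weighted_unweighted assms)
  then show ?thesis by (simp add: weighted_space_def unweighted_def)
qed

lemma unweighted_weighted:
  assumes "u \<in> weighted_space \<alpha> T"
  shows "unweighted \<alpha> T (weighted \<alpha> u) = u"
proof (rule extensionalityI[of _ "{0<..T}"])
  show "u \<in> extensional {0<..T}" using assms by (simp add: weighted_space_def)
qed (use weighted_space_eq[OF assms] in \<open>simp_all add: unweighted_def\<close>)

section \<open>The Volterra operator on the weighted space\<close>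

context
  fixes r :: "real \<Rightarrow> real \<Rightarrow> real" and T \<alpha> :: real
  assumes r: "continuous_on {(t, s). 0 \<le> s \<and> s \<le> t \<and> t \<le> T} (\<lambda>(t, s). r t s)" and alpha: "0 < \<alpha>"
begin

text \<open>Although \<open>u\<close> may blow up like s^(\<alpha>-1), integration gains one power:
  the integral is t^\<alpha> times a mean that is continuous up to t = 0. This makes the forcing
  continuous on the closed interval.\<close>

lemma has_integral_volterra:
  fixes \<phi> u :: "real \<Rightarrow> 'a::banach"
  assumes \<phi>: "continuous_on {0..T} \<phi>" and u: "\<And>s. s \<in> {0<..T} \<Longrightarrow> u s = kern \<alpha> s *\<^sub>R \<phi> s" and t: "t \<in> {0..T}"
  shows "((\<lambda>s. r t s *\<^sub>R u s) has_integral t powr \<alpha> *\<^sub>R kern_mean 1 \<alpha> (\<lambda>s. r t s *\<^sub>R \<phi> s) t) {0..t}"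
proof (cases "t = 0")
  case False
  then have t0: "0 < t" "t \<le> T" using t by auto
  have "continuous_on {0..t} (\<lambda>s. r t s *\<^sub>R \<phi> s)"
  proof (rule continuous_on_scaleR)
    show "continuous_on {0..t} (r t)"
      using continuous_on_compose2[OF r, of "{0..t}" "Pair t"] t0 by (force intro: continuous_on_Pair)
    show "continuous_on {0..t} \<phi>" using t0 by (intro continuous_on_subset[OF \<phi>]) auto
  qed
  then have "((\<lambda>s. (kern 1 (t - s) * kern \<alpha> s) *\<^sub>R (r t s *\<^sub>R \<phi> s)) has_integral
      kern (1 + \<alpha>) t *\<^sub>R kern_mean 1 \<alpha> (\<lambda>s. r t s *\<^sub>R \<phi> s) t) {0..t}"
    using alpha t0 by (intro has_integral_kern_mean) auto
  moreover have "kern (1 + \<alpha>) t = t powr \<alpha>" using t0 by (simp add: kern_def)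
  ultimately have h: "((\<lambda>s. (kern 1 (t - s) * kern \<alpha> s) *\<^sub>R (r t s *\<^sub>R \<phi> s)) has_integral
      t powr \<alpha> *\<^sub>R kern_mean 1 \<alpha> (\<lambda>s. r t s *\<^sub>R \<phi> s) t) {0..t}"
    by simp
  have "r t s *\<^sub>R u s = (kern 1 (t - s) * kern \<alpha> s) *\<^sub>R (r t s *\<^sub>R \<phi> s)" if "s \<in> {0..t} - {0, t}" for s
    using that t0 u[of s] by (simp add: kern_one mult.commute)
  then show ?thesis
    by (intro has_integral_spike[OF _ _ h, of "{0, t}"]) auto
qed (simp add: has_integral_refl)

lemma volterra_eq:
  fixes \<phi> u :: "real \<Rightarrow> 'a::banach"
  assumes "continuous_on {0..T} \<phi>" "\<And>s. s \<in> {0<..T} \<Longrightarrow> u s = kern \<alpha> s *\<^sub>R \<phi> s" "t \<in> {0..T}"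
  shows "volterra r u t = t powr \<alpha> *\<^sub>R kern_mean 1 \<alpha> (\<lambda>s. r t s *\<^sub>R \<phi> s) t"
  unfolding volterra_def by (rule integral_unique) (rule has_integral_volterra[OF assms])

lemma continuous_on_volterra:
  fixes \<phi> u :: "real \<Rightarrow> 'a::banach"
  assumes \<phi>: "continuous_on {0..T} \<phi>" and u: "\<And>s. s \<in> {0<..T} \<Longrightarrow> u s = kern \<alpha> s *\<^sub>R \<phi> s"
  shows "continuous_on {0..T} (volterra r u)"
proof -
  have "continuous_on {0..T} (\<lambda>t. t powr \<alpha> *\<^sub>R kern_mean 1 \<alpha> (\<lambda>s. r t s *\<^sub>R \<phi> s) t)"
  proof (intro continuous_on_scaleR continuous_on_kern_mean)
    show "continuous_on {0..T} (\<lambda>t. t powr \<alpha>)"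
      using alpha by (intro continuous_on_powr' continuous_intros) auto
    show "continuous_on {(t, s). 0 \<le> s \<and> s \<le> t \<and> t \<le> T} (\<lambda>(t, s). r t s *\<^sub>R \<phi> s)"
      using r unfolding case_prod_unfold
      by (intro continuous_on_scaleR continuous_on_compose2[OF \<phi>] continuous_intros) auto
  qed (use alpha in auto)
  then show ?thesis
    by (rule continuous_on_cong[THEN iffD2, OF refl volterra_eq[OF \<phi> u], rotated 2]) auto
qed

lemma volterra_diff_bound:
  fixes \<phi> \<psi> u v :: "real \<Rightarrow> 'a::banach"
  assumes \<phi>: "continuous_on {0..T} \<phi>" and u: "\<And>s. s \<in> {0<..T} \<Longrightarrow> u s = kern \<alpha> s *\<^sub>R \<phi> s"
    and \<psi>: "continuous_on {0..T} \<psi>" and v: "\<And>s. s \<in> {0<..T} \<Longrightarrow> v s = kern \<alpha> s *\<^sub>R \<psi> s"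
    and d: "\<And>s. s \<in> {0..T} \<Longrightarrow> norm (\<phi> s - \<psi> s) \<le> d"
    and N: "\<And>t s. 0 \<le> s \<Longrightarrow> s \<le> t \<Longrightarrow> t \<le> T \<Longrightarrow> \<bar>r t s\<bar> \<le> N"
    and t: "t \<in> {0..T}"
  shows "norm (volterra r u t - volterra r v t) \<le> N * d * (t powr \<alpha> / \<alpha>)"
proof -
  have N0: "0 \<le> N" using N[of 0 t] t by auto
  have iu: "(\<lambda>s. r t s *\<^sub>R u s) integrable_on {0..t}"
    using has_integral_volterra[OF \<phi> u t] by blast
  have iv: "(\<lambda>s. r t s *\<^sub>R v s) integrable_on {0..t}"
    using has_integral_volterra[OF \<psi> v t] by blast
  have "((\<lambda>s. s powr (\<alpha> - 1)) has_integral t powr \<alpha> / \<alpha>) {0..t}"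
    using has_integral_powr_from_0[of "\<alpha> - 1" t] alpha t by simp
  then have "((\<lambda>s. kern \<alpha> s) has_integral t powr \<alpha> / \<alpha>) {0..t}"
    by (rule has_integral_eq[rotated]) (simp add: kern_eq_powr)
  then have k: "((\<lambda>s. N * d * kern \<alpha> s) has_integral N * d * (t powr \<alpha> / \<alpha>)) {0..t}"
    by (rule has_integral_mult_right)
  have "norm (volterra r u t - volterra r v t) = norm (integral {0..t} (\<lambda>s. r t s *\<^sub>R u s - r t s *\<^sub>R v s))"
    unfolding volterra_def Henstock_Kurzweil_Integration.integral_diff[OF iu iv] ..
  also have "\<dots> = norm (integral {0..t} (\<lambda>s. r t s *\<^sub>R (kern \<alpha> s *\<^sub>R (\<phi> s - \<psi> s))))"
    by (rule arg_cong[where f = norm], rule integral_spike[of "{0}"])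
      (use t in \<open>auto simp: u v scaleR_diff_right\<close>)
  also have "\<dots> \<le> integral {0..t} (\<lambda>s. N * d * kern \<alpha> s)"
  proof (rule integral_norm_bound_integral)
    show "(\<lambda>s. r t s *\<^sub>R (kern \<alpha> s *\<^sub>R (\<phi> s - \<psi> s))) integrable_on {0..t}"
      by (rule integrable_spike[OF integrable_diff[OF iu iv], of "{0}"])
        (use t in \<open>auto simp: u v scaleR_diff_right\<close>)
    fix s assume s: "s \<in> {0..t}"
    have "\<bar>r t s\<bar> * (kern \<alpha> s * norm (\<phi> s - \<psi> s)) \<le> N * (kern \<alpha> s * d)"
      using s t N0 by (intro mult_mono N d) auto
    then show "norm (r t s *\<^sub>R (kern \<alpha> s *\<^sub>R (\<phi> s - \<psi> s))) \<le> N * d * kern \<alpha> s"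
      by (simp add: abs_mult mult_ac)
  qed (use k in blast)
  also have "\<dots> = N * d * (t powr \<alpha> / \<alpha>)" using k by (rule integral_unique)
  finally show ?thesis .
qed

end

section \<open>Lipschitz estimate for the solution of the linear problem\<close>

context resolvent
begin

text \<open>Uniform boundedness makes the supremum finite, so it is an upper bound on (0,T]. It
  covers t = 0 by strong continuity, where \<open>P 0\<close> is a limit of admissible
  operators.\<close>

lemma P_bound:
  assumes T: "0 < T" and t: "t \<in> {0..T}"
  shows "norm (P t y) \<le> (SUP t\<in>{0<..T}. norm (t powr (1 - \<alpha>) *\<^sub>R S t)) * norm y" (is "_ \<le> ?M * _")
proof -
  obtain C where C: "\<And>t. t \<in> {0..T} \<Longrightarrow> norm (P t) \<le> C"
    using strongly_continuous_bounded[OF compact_Icc continuous_on_subset[OF continuous_on_P subset_UNIV]] by metis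
  have PS: "P t = t powr (1 - \<alpha>) *\<^sub>R S t" if "0 < t" for t
    using that by (simp add: P_def)
  have "norm (t powr (1 - \<alpha>) *\<^sub>R S t) \<le> C" if "t \<in> {0<..T}" for t
    using C[of t] PS[of t] that by simp
  then have "bdd_above ((\<lambda>t. norm (t powr (1 - \<alpha>) *\<^sub>R S t)) ` {0<..T})"
    by (rule bdd_aboveI2)
  then have "norm (t powr (1 - \<alpha>) *\<^sub>R S t) \<le> ?M" if "t \<in> {0<..T}" for t
    using that by (intro cSUP_upper)
  then have pos: "norm (P t y) \<le> ?M * norm y" if "t \<in> {0<..T}" for t
    using that PS[of t] by (intro order_trans[OF norm_blinfun mult_right_mono]) auto
  show ?thesis
  proof (cases "t = 0")
    case True
    have "continuous_on {0..T} (\<lambda>t. norm (P t y))"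
      by (intro continuous_on_norm continuous_on_subset[OF continuous_on_P subset_UNIV])
    then have "((\<lambda>t. norm (P t y)) \<longlongrightarrow> norm (P 0 y)) (at_right 0)"
      using T by (auto dest: continuous_on_Icc_at_rightD)
    moreover have "\<forall>\<^sub>F t in at_right 0. norm (P t y) \<le> ?M * norm y"
      using T pos by (auto intro!: eventually_at_rightI[of 0 T])
    ultimately show ?thesis
      unfolding True by (rule tendsto_upperbound) simp
  qed (use pos t in auto)
qed

text \<open>The estimate is moved to the fixed interval [0,T], on which the L^p norms are taken. The
  kernel vanishes for s >= t, so \<open>G\<close> has to dominate the difference of the forcings
  only up to \<open>t\<close>.\<close>

lemma norm_mild_weight_diff_le:
  assumes F: "continuous_on {0..T} F" "continuous_on {0..T} F'"
    and t: "t \<in> {0..T}" and M: "\<And>\<sigma> y. \<sigma> \<in> {0..T} \<Longrightarrow> norm (P \<sigma> y) \<le> M * norm y" and M0: "0 \<le> M"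
    and G: "\<And>s. s \<in> {0..t} \<Longrightarrow> norm (F s - F' s) \<le> G s" and G0: "\<And>s. 0 \<le> G s"
    and int: "(\<lambda>s. kern \<alpha> (t - s) * G s) integrable_on {0..T}"
  shows "norm (mild_weight y F t - mild_weight y' F' t)
    \<le> M * norm (y - y') + M * (t powr (1 - \<alpha>) * integral {0..T} (\<lambda>s. kern \<alpha> (t - s) * G s))"
proof (cases "t = 0")
  case True
  then show ?thesis
    using M[OF t, of "y - y'"] by (simp add: mild_weight_def blinfun.diff_right)
next
  case False
  then have t0: "0 < t" "t \<le> T" using t by auto
  let ?H = "\<lambda>s. (kern \<alpha> (t - s) * kern 1 s) *\<^sub>R P (t - s) (F s - F' s)"
  have Ft: "continuous_on {0..t} F" "continuous_on {0..t} F'"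
    using t0 by (auto intro: continuous_on_subset[OF F(1)] continuous_on_subset[OF F(2)])
  have i: "(\<lambda>s. (kern \<alpha> (t - s) * kern 1 s) *\<^sub>R P (t - s) (F s)) integrable_on {0..t}"
    "(\<lambda>s. (kern \<alpha> (t - s) * kern 1 s) *\<^sub>R P (t - s) (F' s)) integrable_on {0..t}"
    using Ft alpha by (auto intro!: kern_conv_integrable continuous_on_P_conv1)
  have "kern \<alpha> t *\<^sub>R (mild_weight y F t - mild_weight y' F' t)
      = kern \<alpha> t *\<^sub>R P t (y - y') + integral {0..t} ?H"
    using kern_mild_weight[OF Ft(1), of y] kern_mild_weight[OF Ft(2), of y'] t0
      Henstock_Kurzweil_Integration.integral_diff[OF i]
    by (simp add: scaleR_diff_right blinfun.diff_right)
  then have "t powr (1 - \<alpha>) *\<^sub>R (kern \<alpha> t *\<^sub>R (mild_weight y F t - mild_weight y' F' t))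
      = t powr (1 - \<alpha>) *\<^sub>R (kern \<alpha> t *\<^sub>R P t (y - y') + integral {0..t} ?H)"
    by simp
  then have eq: "mild_weight y F t - mild_weight y' F' t = P t (y - y') + t powr (1 - \<alpha>) *\<^sub>R integral {0..t} ?H"
    using t0 by (simp add: scaleR_add_right kern_mult_powr)
  have le: "norm (?H s) \<le> M * (kern \<alpha> (t - s) * G s)" if s: "s \<in> {0..T}" for s
  proof (cases "s < t \<and> s \<noteq> 0")
    case True
    then have "norm (P (t - s) (F s - F' s)) \<le> M * norm (F s - F' s)"
      using s t0 by (intro M) auto
    also have "\<dots> \<le> M * G s"
      using True s M0 by (intro mult_left_mono G) auto
    finally have "kern \<alpha> (t - s) * norm (P (t - s) (F s - F' s)) \<le> kern \<alpha> (t - s) * (M * G s)"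
      by (intro mult_left_mono) auto
    then show ?thesis using True s by (simp add: kern_one mult_ac)
  next
    case False
    then have "?H s = 0" by auto
    then show ?thesis using M0 G0[of s] by (simp only:) simp
  qed
  have "integral {0..t} ?H = integral {0..T} ?H"
    using integral_kern_conv_extend[of t T \<alpha> "kern 1" "\<lambda>s. P (t - s) (F s - F' s)"] t0 by simp
  also have "norm \<dots> \<le> integral {0..T} (\<lambda>s. M * (kern \<alpha> (t - s) * G s))"
  proof (rule integral_norm_bound_integral[OF _ _ le])
    show "?H integrable_on {0..T}"
    proof (rule integrable_on_scaleR_continuous)
      show "(\<lambda>s. kern \<alpha> (t - s) * kern 1 s) integrable_on {0..T}"
        using has_integral_kern_conv[of \<alpha> 1 t T] alpha t0 by auto
      show "continuous_on {0..T} (\<lambda>s. P (t - s) (F s - F' s))"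
      proof (rule continuous_on_P_apply)
        show "bounded ((\<lambda>s. t - s) ` {0..T})"
          by (rule bounded_subset[of "{t - T..t}"]) auto
      qed (intro continuous_intros F)+
    qed simp
    show "(\<lambda>s. M * (kern \<alpha> (t - s) * G s)) integrable_on {0..T}"
      using int by (rule integrable_on_mult_right)
  qed
  also have "\<dots> = M * integral {0..T} (\<lambda>s. kern \<alpha> (t - s) * G s)"
    using int by simp
  finally have "norm (t powr (1 - \<alpha>) *\<^sub>R integral {0..t} ?H)
      \<le> t powr (1 - \<alpha>) * (M * integral {0..T} (\<lambda>s. kern \<alpha> (t - s) * G s))"
    by (simp add: mult_left_mono)
  moreover have "norm (P t (y - y')) \<le> M * norm (y - y')"
    using M t by blast
  ultimately show ?thesis
    unfolding eq by (intro norm_triangle_le add_mono) (auto simp: mult_ac)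
qed

end

lemma compact_triangle: "compact {(t, s). 0 \<le> s \<and> s \<le> t \<and> t \<le> (T::real)}" (is "compact ?\<Delta>")
proof -
  have "bounded ?\<Delta>"
    by (rule bounded_subset[of "{0..T} \<times> {0..T}"]) (auto intro: bounded_Times)
  moreover have "closed ?\<Delta>"
    unfolding case_prod_unfold by (intro closed_Collect_conj closed_Collect_le continuous_intros)
  ultimately show ?thesis by (simp only: compact_eq_bounded_closed)
qed

text \<open>Two applications of the Hoelder estimate. The weight t^(1-\<alpha>) combines with
  t^(\<alpha>-\<theta>1) to t^(1-\<theta>1), and with t^(\<alpha>-\<theta>2) t^\<alpha> to
  t^(\<alpha>+1-\<theta>2). Both exponents are positive, so \<open>t\<close> may be replaced by
  \<open>T\<close>.\<close>

lemma kern_Lp_sum: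
  fixes \<alpha> \<theta>1 \<theta>2 N d t T :: real
  defines "G \<equiv> \<lambda>m1 m2 s. (\<bar>m1 s\<bar> + \<bar>m2 s\<bar> * (N * (t powr \<alpha> / \<alpha>))) * d"
  assumes \<alpha>: "0 < \<alpha>" "\<alpha> < 1" and \<theta>: "\<theta>1 \<in> {0<..<\<alpha>}" "\<theta>2 \<in> {0<..<\<alpha>}"
    and m: "in_Lp (1 / \<theta>1) {0..T} m1" "in_Lp (1 / \<theta>2) {0..T} m2"
    and nn: "0 \<le> N" "0 \<le> d" and t: "t \<in> {0..T}"
  shows "(\<lambda>s. kern \<alpha> (t - s) * G m1 m2 s) integrable_on {0..T}" (is ?int)
    and "t powr (1 - \<alpha>) * integral {0..T} (\<lambda>s. kern \<alpha> (t - s) * G m1 m2 s)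
      \<le> (Lp_norm (1 / \<theta>1) {0..T} m1 * T powr (1 - \<theta>1) / ((\<alpha> - \<theta>1) / (1 - \<theta>1)) powr (1 - \<theta>1)
        + Lp_norm (1 / \<theta>2) {0..T} m2 * N * T powr (\<alpha> + 1 - \<theta>2)
            / (\<alpha> * ((\<alpha> - \<theta>2) / (1 - \<theta>2)) powr (1 - \<theta>2))) * d" (is "_ \<le> ?R")
proof -
  define L1 where "L1 = Lp_norm (1 / \<theta>1) {0..T} m1"
  define L2 where "L2 = Lp_norm (1 / \<theta>2) {0..T} m2"
  define c1 where "c1 = ((\<alpha> - \<theta>1) / (1 - \<theta>1)) powr (1 - \<theta>1)"
  define c2 where "c2 = ((\<alpha> - \<theta>2) / (1 - \<theta>2)) powr (1 - \<theta>2)"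
  have L0: "0 \<le> L1" "0 \<le> L2" by (simp_all add: L1_def L2_def Lp_norm_def)
  have c0: "0 < c1" "0 < c2" using \<alpha> \<theta> by (simp_all add: c1_def c2_def)
  have R: "?R = (L1 * T powr (1 - \<theta>1) / c1 + L2 * N * T powr (\<alpha> + 1 - \<theta>2) / (\<alpha> * c2)) * d"
    by (simp add: L1_def L2_def c1_def c2_def)
  have "?int \<and> t powr (1 - \<alpha>) * integral {0..T} (\<lambda>s. kern \<alpha> (t - s) * G m1 m2 s) \<le> ?R"
  proof (cases "t = 0")
    case True
    have "(\<lambda>s. kern \<alpha> (t - s) * G m1 m2 s) integrable_on {0..T}"
      by (rule integrable_eq[OF integrable_0]) (simp add: True)
    moreover have "0 \<le> ?R" unfolding R using L0 c0 nn \<alpha> by simp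
    ultimately show ?thesis by (simp add: True)
  next
    case False
    then have t0: "0 < t" "t \<le> T" using t by auto
    let ?I1 = "\<lambda>s. kern \<alpha> (t - s) * \<bar>m1 s\<bar>" and ?I2 = "\<lambda>s. kern \<alpha> (t - s) * \<bar>m2 s\<bar>"
    let ?c = "N * (t powr \<alpha> / \<alpha>)"
    have th: "0 < \<theta>1" "\<theta>1 < \<alpha>" "0 < \<theta>2" "\<theta>2 < \<alpha>" using \<theta> by auto
    have int: "?I1 integrable_on {0..T}" "?I2 integrable_on {0..T}"
      using kern_Lp_integrable[OF th(1,2) \<alpha>(2) m(1) t0] kern_Lp_integrable[OF th(3,4) \<alpha>(2) m(2) t0] by auto
    have "((\<lambda>s. (?I1 s + ?I2 s * ?c) * d) has_integral (integral {0..T} ?I1 + integral {0..T} ?I2 * ?c) * d) {0..T}"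
      using int by (intro has_integral_mult_left has_integral_add integrable_integral)
    then have hi: "((\<lambda>s. kern \<alpha> (t - s) * G m1 m2 s) has_integral (integral {0..T} ?I1 + integral {0..T} ?I2 * ?c) * d) {0..T}"
      by (rule has_integral_eq[rotated]) (simp add: G_def algebra_simps)
    have b1: "integral {0..T} ?I1 \<le> L1 * (t powr (\<alpha> - \<theta>1) / c1)"
      unfolding L1_def c1_def by (rule kern_Lp_integral_le[OF th(1,2) \<alpha>(2) m(1) t0])
    have b2: "integral {0..T} ?I2 \<le> L2 * (t powr (\<alpha> - \<theta>2) / c2)"
      unfolding L2_def c2_def by (rule kern_Lp_integral_le[OF th(3,4) \<alpha>(2) m(2) t0])
    have p1: "t powr (1 - \<alpha>) * t powr (\<alpha> - \<theta>1) \<le> T powr (1 - \<theta>1)"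
      using t0 \<alpha> th by (simp add: powr_mono2 flip: powr_add)
    have p2: "t powr (1 - \<alpha>) * (t powr (\<alpha> - \<theta>2) * t powr \<alpha>) \<le> T powr (\<alpha> + 1 - \<theta>2)"
    proof -
      have "t powr (1 - \<alpha>) * (t powr (\<alpha> - \<theta>2) * t powr \<alpha>) = t powr (\<alpha> + 1 - \<theta>2)"
        by (simp flip: powr_add) (simp add: algebra_simps)
      then show ?thesis using t0 \<alpha> th by (simp add: powr_mono2)
    qed
    have "t powr (1 - \<alpha>) * ((integral {0..T} ?I1 + integral {0..T} ?I2 * ?c) * d)
      \<le> t powr (1 - \<alpha>) * ((L1 * (t powr (\<alpha> - \<theta>1) / c1) + L2 * (t powr (\<alpha> - \<theta>2) / c2) * ?c) * d)"
      using b1 b2 nn \<alpha> by (intro mult_left_mono mult_right_mono add_mono) auto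
    also have "\<dots> = ((L1 / c1) * (t powr (1 - \<alpha>) * t powr (\<alpha> - \<theta>1))
        + (L2 * N / (\<alpha> * c2)) * (t powr (1 - \<alpha>) * (t powr (\<alpha> - \<theta>2) * t powr \<alpha>))) * d"
      using c0 \<alpha> by (simp add: field_simps)
    also have "\<dots> \<le> ((L1 / c1) * T powr (1 - \<theta>1) + (L2 * N / (\<alpha> * c2)) * T powr (\<alpha> + 1 - \<theta>2)) * d"
      using p1 p2 nn L0 c0 \<alpha> by (intro mult_left_mono mult_right_mono add_mono) auto
    also have "\<dots> = ?R" unfolding R by simp
    finally show ?thesis using hi by (auto simp: integral_unique)
  qed
  then show ?int and "t powr (1 - \<alpha>) * integral {0..T} (\<lambda>s. kern \<alpha> (t - s) * G m1 m2 s) \<le> ?R"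
    by blast+
qed

section \<open>The fixed-point argument\<close>

theorem theorem3p4:
  fixes \<alpha> T \<alpha>1 \<alpha>2 \<alpha>3 b M N M1 M2 :: real
    and D :: "'a::banach set" and A :: "'a \<Rightarrow> 'a"
    and S :: "real \<Rightarrow> 'a \<Rightarrow>\<^sub>L 'a"
    and x :: 'a
    and r :: "real \<Rightarrow> real \<Rightarrow> real"
    and f :: "real \<Rightarrow> 'a \<Rightarrow> 'a \<Rightarrow> 'a"
    and g :: "(real \<Rightarrow> 'a) \<Rightarrow> 'a"
    and m1 m2 h :: "real \<Rightarrow> real"
  assumes alpha: "0 < \<alpha>" "\<alpha> < 1" and T: "0 < T"
    and A: "linear_operator D A" "closed_operator D A" "densely_defined D"
    and S: "generates \<alpha> D A S"
    and r: "continuous_on {(t, s). 0 \<le> s \<and> s \<le> t \<and> t \<le> T} (\<lambda>(t, s). r t s)"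
    and f: "continuous_on ({0..T} \<times> UNIV \<times> UNIV) (\<lambda>(t, u, v). f t u v)"
    and alpha1: "\<alpha>1 \<in> {0<..<\<alpha>}" and alpha2: "\<alpha>2 \<in> {0<..<\<alpha>}"
    and m1: "in_Lp (1 / \<alpha>1) {0..T} m1" and m2: "in_Lp (1 / \<alpha>2) {0..T} m2"
    and f_Lipschitz: "\<And>t u1 u2 v1 v2. t \<in> {0..T} \<Longrightarrow>
      norm (f t u1 u2 - f t v1 v2) \<le> m1 t * norm (u1 - v1) + m2 t * norm (u2 - v2)"
    and alpha3: "\<alpha>3 \<in> {0<..<\<alpha>}" and h: "in_Lp (1 / \<alpha>3) {0..T} h"
    and f_bound: "\<And>t u v. t \<in> {0..T} \<Longrightarrow> norm (f t u v) \<le> h t"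
    and g_Lipschitz: "\<And>u v. u \<in> weighted_space \<alpha> T \<Longrightarrow> v \<in> weighted_space \<alpha> T \<Longrightarrow>
      norm (g u - g v) \<le> b * weighted_norm \<alpha> T (\<lambda>t. u t - v t)"
    and M: "M = (SUP t\<in>{0<..T}. norm (t powr (1 - \<alpha>) *\<^sub>R S t))"
    and N: "N = (SUP (t, s)\<in>{(t, s). 0 \<le> s \<and> s \<le> t \<and> t \<le> T}. \<bar>r t s\<bar>)"
    and M1: "M1 = Lp_norm (1 / \<alpha>1) {0..T} m1"
    and M2: "M2 = Lp_norm (1 / \<alpha>2) {0..T} m2"
    and Omega: "M * b
      + M * M1 * T powr (1 - \<alpha>1) / ((\<alpha> - \<alpha>1) / (1 - \<alpha>1)) powr (1 - \<alpha>1)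
      + M * M2 * N * T powr (\<alpha> + 1 - \<alpha>2) / (\<alpha> * ((\<alpha> - \<alpha>2) / (1 - \<alpha>2)) powr (1 - \<alpha>2)) < 1"
  shows "\<exists>!u. u \<in> weighted_space \<alpha> T \<and> mild_solution \<alpha> T D A f (volterra r) x g u"
proof -
  interpret resolvent \<alpha> S
    using alpha S by unfold_locales (auto simp: generates_def)
  define c where "c = M * b
      + M * M1 * T powr (1 - \<alpha>1) / ((\<alpha> - \<alpha>1) / (1 - \<alpha>1)) powr (1 - \<alpha>1)
      + M * M2 * N * T powr (\<alpha> + 1 - \<alpha>2) / (\<alpha> * ((\<alpha> - \<alpha>2) / (1 - \<alpha>2)) powr (1 - \<alpha>2))"
  define u where "u = (\<lambda>\<phi> :: real \<Rightarrow> 'a. unweighted \<alpha> T \<phi>)"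
  define F where "F = (\<lambda>\<phi> s. f s (\<phi> s) (volterra r (u \<phi>) s))"
  define \<Psi> where "\<Psi> = (\<lambda>\<phi>. mild_weight (x - g (u \<phi>)) (F \<phi>))"
  have u_apply: "u \<phi> t = kern \<alpha> t *\<^sub>R \<phi> t" if "t \<in> {0<..T}" for \<phi> t
    using that by (simp add: u_def unweighted_apply)
  have u_space: "u \<phi> \<in> weighted_space \<alpha> T" if "continuous_on {0..T} \<phi>" for \<phi>
    using that T by (simp add: u_def unweighted_in_weighted_space)
  have F_cont: "continuous_on {0..T} (F \<phi>)" if "continuous_on {0..T} \<phi>" for \<phi>
  proof -
    have "continuous_on {0..T} (\<lambda>s. (s, \<phi> s, volterra r (u \<phi>) s))"
      using that continuous_on_volterra[OF r alpha(1) that u_apply[where \<phi> = \<phi>]] by (intro continuous_intros)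
    then have "continuous_on {0..T} (\<lambda>s. (\<lambda>(t, u, v). f t u v) (s, \<phi> s, volterra r (u \<phi>) s))"
      by (rule continuous_on_compose2[OF f]) auto
    then show ?thesis by (simp add: F_def)
  qed
  have \<Psi>_cont: "continuous_on {0..T} (\<Psi> \<phi>)" if "continuous_on {0..T} \<phi>" for \<phi>
    unfolding \<Psi>_def by (intro continuous_on_mild_weight F_cont that)
  have mild_iff: "mild_solution \<alpha> T D A f (volterra r) x g v \<longleftrightarrow>
      (\<forall>t\<in>{0<..T}. weighted \<alpha> v t = \<Psi> (weighted \<alpha> v) t)" if v: "v \<in> weighted_space \<alpha> T" for v
  proof -
    let ?\<phi> = "weighted \<alpha> v"
    have \<phi>: "continuous_on {0..T} ?\<phi>" using v by (simp add: weighted_space_def)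
    have uv: "u ?\<phi> = v" using unweighted_weighted[OF v] by (simp add: u_def)
    have veq: "v t = kern \<alpha> t *\<^sub>R ?\<phi> t" if "t \<in> {0<..T}" for t
      using weighted_space_eq[OF v that] .
    have "continuous_on {0<..T} (\<lambda>t. kern \<alpha> t *\<^sub>R ?\<phi> t)"
      by (intro continuous_on_scaleR continuous_on_subset[OF continuous_on_kern] continuous_on_subset[OF \<phi>]) auto
    then have cont: "continuous_on {0<..T} v"
      by (rule continuous_on_cong[THEN iffD2, OF refl veq, rotated]) auto
    have fr: "frac_integral \<alpha> (\<lambda>s. f s (s powr (1 - \<alpha>) *\<^sub>R v s) (volterra r v s)) t = frac_integral \<alpha> (F ?\<phi>) t"
      if "t \<in> {0<..T}" for t
    proof -
      have "frac_integral \<alpha> (\<lambda>s. f s (s powr (1 - \<alpha>) *\<^sub>R v s) (volterra r v s)) t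
        = (1 / Gamma \<alpha>) *\<^sub>R integral {0..t} (\<lambda>s. (kern \<alpha> (t - s) * kern 1 s) *\<^sub>R F ?\<phi> s)"
        by (rule frac_integral_kern) (simp add: F_def uv weighted_def kern_one)
      moreover have "frac_integral \<alpha> (F ?\<phi>) t
        = (1 / Gamma \<alpha>) *\<^sub>R integral {0..t} (\<lambda>s. (kern \<alpha> (t - s) * kern 1 s) *\<^sub>R F ?\<phi> s)"
        by (rule frac_integral_kern) (simp add: kern_one)
      ultimately show ?thesis by simp
    qed
    have "mild_solution \<alpha> T D A f (volterra r) x g v \<longleftrightarrow>
      (\<forall>t\<in>{0<..T}. frac_integral \<alpha> v t \<in> D) \<and>
      (\<forall>t\<in>{0<..T}. v t = (kern \<alpha> t / Gamma \<alpha>) *\<^sub>R (x - g v) + A (frac_integral \<alpha> v t) + frac_integral \<alpha> (F ?\<phi>) t)"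
      unfolding mild_solution_def using cont fr by (simp add: kern_eq_powr)
    also have "\<dots> \<longleftrightarrow> (\<forall>t\<in>{0<..T}. ?\<phi> t = mild_weight (x - g v) (F ?\<phi>) t)"
      by (rule linear_mild_solution_iff[OF A(1) S F_cont[OF \<phi>] \<phi> veq])
    finally show ?thesis by (simp add: \<Psi>_def uv)
  qed
  \<comment> \<open>\<open>d\<close> is any bound for the distance on [0,T], so that d = 0 is
    allowed as well. The cut-off at 0 puts the factor into [0,1) without a discussion of the sign of
    \<open>c\<close>.\<close>
  have contr: "norm (\<Psi> \<phi> t - \<Psi> \<psi> t) \<le> max 0 c * d"
    if \<phi>: "continuous_on {0..T} \<phi>" and \<psi>: "continuous_on {0..T} \<psi>"
      and d: "\<And>s. s \<in> {0..T} \<Longrightarrow> norm (\<phi> s - \<psi> s) \<le> d" and t: "t \<in> {0..T}" for \<phi> \<psi> d t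
  \<comment> \<open>In the zero space the Lipschitz condition on \<open>g\<close> says nothing about
    the sign of \<open>b\<close>; there the estimate is trivial. Otherwise a nonzero vector is
    available for testing.\<close>
  proof (cases "\<forall>z::'a. z = 0")
    case True
    have "0 \<le> d" using order_trans[OF norm_ge_zero d[OF t]] .
    then show ?thesis using True[rule_format, of "\<Psi> \<phi> t - \<Psi> \<psi> t"] by simp
  next
    case False
    then obtain z :: 'a where z: "z \<noteq> 0" by blast
    have d0: "0 \<le> d" using order_trans[OF norm_ge_zero d[OF t]] .
    have wn: "weighted_norm \<alpha> T (\<lambda>t. u \<phi> t - u \<psi> t) = (SUP t\<in>{0..T}. norm (\<phi> t - \<psi> t))"
      if "continuous_on {0..T} \<phi>" "continuous_on {0..T} \<psi>" for \<phi> \<psi>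
      unfolding weighted_norm_def
    proof (rule SUP_cong[OF refl])
      fix t assume "t \<in> {0..T}"
      then show "norm (weighted \<alpha> (\<lambda>t. u \<phi> t - u \<psi> t) t) = norm (\<phi> t - \<psi> t)"
        using weighted_eq[OF T continuous_on_diff[OF that], of "\<lambda>t. u \<phi> t - u \<psi> t" \<alpha> t]
        by (simp add: u_apply scaleR_diff_right)
    qed
    \<comment> \<open>The Lipschitz condition is tested on the functions with constant weights
      \<open>z\<close> and 0, whose distance is the norm of \<open>z\<close>.\<close>
    have b0: "0 \<le> b"
    proof -
      have "norm (g (u (\<lambda>_. z)) - g (u (\<lambda>_. 0))) \<le> b * (SUP t\<in>{0..T}. norm z)"
        using g_Lipschitz[OF u_space u_space, of "\<lambda>_. z" "\<lambda>_. 0"] wn[of "\<lambda>_. z" "\<lambda>_. 0"] by simp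
      also have "(SUP t\<in>{0..T}. norm z) = norm z" using T by simp
      finally have "0 \<le> b * norm z" using norm_ge_zero order_trans by blast
      then show ?thesis using z by (simp add: zero_le_mult_iff)
    qed
    have MP: "norm (P \<sigma> y) \<le> M * norm y" if "\<sigma> \<in> {0..T}" for \<sigma> y
      unfolding M by (rule P_bound[OF T that])
    have M0: "0 \<le> M"
      using order_trans[OF norm_ge_zero MP[OF t, of z]] z by (simp add: zero_le_mult_iff)
    have NB: "\<bar>r t s\<bar> \<le> N" if "0 \<le> s" "s \<le> t" "t \<le> T" for t s
    proof -
      let ?\<Delta> = "{(t, s). 0 \<le> s \<and> s \<le> t \<and> t \<le> T}"
      have "bounded ((\<lambda>(t, s). r t s) ` ?\<Delta>)"
        using compact_imp_bounded[OF compact_continuous_image[OF r compact_triangle]] .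
      then obtain B where "\<forall>z\<in>(\<lambda>(t, s). r t s) ` ?\<Delta>. norm z \<le> B"
        unfolding bounded_iff by blast
      then have "(case p of (t, s) \<Rightarrow> \<bar>r t s\<bar>) \<le> B" if "p \<in> ?\<Delta>" for p
        using that by (cases p) auto
      then have "bdd_above ((\<lambda>(t, s). \<bar>r t s\<bar>) ` ?\<Delta>)"
        by (rule bdd_aboveI2)
      then have "(\<lambda>(t, s). \<bar>r t s\<bar>) (t, s) \<le> N"
        unfolding N using that by (intro cSUP_upper) auto
      then show ?thesis by simp
    qed
    have N0: "0 \<le> N" using NB[of 0 0] T by auto
    \<comment> \<open>The Volterra difference at s <= t is bounded by its estimate at
      \<open>t\<close>. The coefficient of |m2| is then constant in s, and Hoelder is applied to m2
      alone.\<close>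
    define G where "G = (\<lambda>s. (\<bar>m1 s\<bar> + \<bar>m2 s\<bar> * (N * (t powr \<alpha> / \<alpha>))) * d)"
    have FG: "norm (F \<phi> s - F \<psi> s) \<le> G s" if s: "s \<in> {0..t}" for s
    proof -
      have sT: "s \<in> {0..T}" using s t by auto
      have "norm (volterra r (u \<phi>) s - volterra r (u \<psi>) s) \<le> N * d * (s powr \<alpha> / \<alpha>)"
        by (rule volterra_diff_bound[OF r alpha(1) \<phi> u_apply[where \<phi> = \<phi>] \<psi> u_apply[where \<phi> = \<psi>] d NB sT])
      also have "\<dots> \<le> N * d * (t powr \<alpha> / \<alpha>)"
        using s N0 d0 alpha by (intro mult_left_mono divide_right_mono powr_mono2) auto
      finally have v: "norm (volterra r (u \<phi>) s - volterra r (u \<psi>) s) \<le> N * d * (t powr \<alpha> / \<alpha>)" .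
      have "norm (F \<phi> s - F \<psi> s) \<le> m1 s * norm (\<phi> s - \<psi> s) + m2 s * norm (volterra r (u \<phi>) s - volterra r (u \<psi>) s)"
        unfolding F_def by (rule f_Lipschitz[OF sT])
      also have "\<dots> \<le> \<bar>m1 s\<bar> * norm (\<phi> s - \<psi> s) + \<bar>m2 s\<bar> * norm (volterra r (u \<phi>) s - volterra r (u \<psi>) s)"
        by (intro add_mono mult_right_mono) auto
      also have "\<dots> \<le> \<bar>m1 s\<bar> * d + \<bar>m2 s\<bar> * (N * d * (t powr \<alpha> / \<alpha>))"
        using d[OF sT] v by (intro add_mono mult_left_mono) auto
      also have "\<dots> = G s" by (simp add: G_def algebra_simps)
      finally show ?thesis .
    qed
    have "(SUP t\<in>{0..T}. norm (\<phi> t - \<psi> t)) \<le> d"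
      using T d by (intro cSUP_least) auto
    then have "b * (SUP t\<in>{0..T}. norm (\<phi> t - \<psi> t)) \<le> b * d"
      using b0 by (intro mult_left_mono)
    moreover have "norm (g (u \<phi>) - g (u \<psi>)) \<le> b * (SUP t\<in>{0..T}. norm (\<phi> t - \<psi> t))"
      using g_Lipschitz[OF u_space[OF \<phi>] u_space[OF \<psi>]] unfolding wn[OF \<phi> \<psi>] .
    ultimately have gd: "norm (g (u \<psi>) - g (u \<phi>)) \<le> b * d"
      unfolding norm_minus_commute[of "g (u \<psi>)"] by linarith
    have est1: "(\<lambda>s. kern \<alpha> (t - s) * G s) integrable_on {0..T}"
      unfolding G_def by (rule kern_Lp_sum(1)[OF alpha alpha1 alpha2 m1 m2 N0 d0 t])
    have est2: "t powr (1 - \<alpha>) * integral {0..T} (\<lambda>s. kern \<alpha> (t - s) * G s)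
        \<le> (M1 * T powr (1 - \<alpha>1) / ((\<alpha> - \<alpha>1) / (1 - \<alpha>1)) powr (1 - \<alpha>1)
        + M2 * N * T powr (\<alpha> + 1 - \<alpha>2) / (\<alpha> * ((\<alpha> - \<alpha>2) / (1 - \<alpha>2)) powr (1 - \<alpha>2))) * d"
      unfolding G_def M1 M2 by (rule kern_Lp_sum(2)[OF alpha alpha1 alpha2 m1 m2 N0 d0 t])
    have "norm (\<Psi> \<phi> t - \<Psi> \<psi> t) \<le> M * norm ((x - g (u \<phi>)) - (x - g (u \<psi>)))
        + M * (t powr (1 - \<alpha>) * integral {0..T} (\<lambda>s. kern \<alpha> (t - s) * G s))"
      unfolding \<Psi>_def
      by (rule norm_mild_weight_diff_le[OF F_cont[OF \<phi>] F_cont[OF \<psi>] t MP M0 FG _ est1])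
        (use N0 d0 alpha in \<open>auto simp: G_def\<close>)
    also have "\<dots> \<le> M * (b * d) + M * ((M1 * T powr (1 - \<alpha>1) / ((\<alpha> - \<alpha>1) / (1 - \<alpha>1)) powr (1 - \<alpha>1)
        + M2 * N * T powr (\<alpha> + 1 - \<alpha>2) / (\<alpha> * ((\<alpha> - \<alpha>2) / (1 - \<alpha>2)) powr (1 - \<alpha>2))) * d)"
      using M0 gd est2 by (intro add_mono mult_left_mono) auto
    also have "\<dots> = c * d" by (simp add: c_def algebra_simps)
    also have "\<dots> \<le> max 0 c * d" using d0 by (intro mult_right_mono) auto
    finally show ?thesis .
  qed
  \<comment> \<open>The contraction estimate with distance 0: \<Psi> sees only the values of its
    argument on [0,T].\<close>
  have \<Psi>_cong: "\<Psi> \<phi> t = \<Psi> \<psi> t" if "continuous_on {0..T} \<phi>" "continuous_on {0..T} \<psi>"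
    "\<And>s. s \<in> {0..T} \<Longrightarrow> \<phi> s = \<psi> s" "t \<in> {0..T}" for \<phi> \<psi> t
    using contr[OF that(1,2) _ that(4), of 0] that(3) by simp
  have clamp_in: "clamp 0 T s \<in> {0..T}" for s :: real
    using clamp_in_interval[of 0 T s] T by simp
  \<comment> \<open>Composition with \<open>clamp\<close> makes a continuous function on [0,T] a
    bounded continuous function on the line, where Banach's theorem is applied. All values of
    \<Theta> are constant on either side of [0,T], so its fixed points are determined by their
    restrictions.\<close>
  have "\<exists>\<eta> :: (real, 'a) bcontfun. \<forall>s. \<eta> s = \<phi> (clamp 0 T s)" if "continuous_on {0..T} \<phi>" for \<phi>
    using continuous_on_cbox_bcontfunE[of 0 T \<phi>] that by (metis interval_cbox)
  note ext = this
  have "\<exists>\<Theta> :: (real, 'a) bcontfun \<Rightarrow> (real, 'a) bcontfun. \<forall>\<phi> s. apply_bcontfun (\<Theta> \<phi>) s = \<Psi> (apply_bcontfun \<phi>) (clamp 0 T s)"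
    using ext[OF \<Psi>_cont[OF continuous_on_apply_bcontfun]] by metis
  then obtain \<Theta> :: "(real, 'a) bcontfun \<Rightarrow> (real, 'a) bcontfun"
    where \<Theta>: "\<And>\<phi> s. apply_bcontfun (\<Theta> \<phi>) s = \<Psi> (apply_bcontfun \<phi>) (clamp 0 T s)" by blast
  have "dist (\<Theta> \<phi>) (\<Theta> \<psi>) \<le> max 0 c * dist \<phi> \<psi>" for \<phi> \<psi>
  proof (rule dist_bound)
    fix s
    show "dist (\<Theta> \<phi> s) (\<Theta> \<psi> s) \<le> max 0 c * dist \<phi> \<psi>"
      unfolding \<Theta> dist_norm[of "\<Psi> _ _"]
      by (rule contr[OF continuous_on_apply_bcontfun continuous_on_apply_bcontfun _ clamp_in])
        (metis dist_bounded dist_norm)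
  qed
  then have unique: "\<exists>!\<phi>. \<Theta> \<phi> = \<phi>"
    using Omega by (intro banach_fix_type[of "max 0 c"]) (auto simp: c_def)
  show ?thesis
  proof (rule ex_ex1I)
    obtain \<phi> where \<phi>: "\<Theta> \<phi> = \<phi>" using unique by blast
    have wu: "weighted \<alpha> (u \<phi>) t = \<phi> t" if "t \<in> {0..T}" for t
      using that T by (simp add: u_def weighted_unweighted)
    have sp: "u \<phi> \<in> weighted_space \<alpha> T" by (rule u_space) simp
    then have wc: "continuous_on {0..T} (weighted \<alpha> (u \<phi>))" by (simp add: weighted_space_def)
    have "weighted \<alpha> (u \<phi>) t = \<Psi> (weighted \<alpha> (u \<phi>)) t" if t: "t \<in> {0<..T}" for t
    proof -
      have t': "t \<in> {0..T}" using t by auto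
      have "\<phi> t = \<Psi> \<phi> t" using \<Theta>[of \<phi> t] \<phi> t' by simp
      also have "\<dots> = \<Psi> (weighted \<alpha> (u \<phi>)) t"
        by (rule \<Psi>_cong[OF _ wc _ t']) (simp_all add: wu)
      finally show ?thesis by (simp add: wu[OF t'])
    qed
    then show "\<exists>u. u \<in> weighted_space \<alpha> T \<and> mild_solution \<alpha> T D A f (volterra r) x g u"
      using sp mild_iff by blast
  next
    have fixed: "\<exists>\<eta>. \<Theta> \<eta> = \<eta> \<and> (\<forall>t\<in>{0..T}. \<eta> t = weighted \<alpha> v t)"
      if v: "v \<in> weighted_space \<alpha> T" "mild_solution \<alpha> T D A f (volterra r) x g v" for v
    proof -
      have wc: "continuous_on {0..T} (weighted \<alpha> v)" using v by (simp add: weighted_space_def)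
      then obtain \<eta> :: "(real, 'a) bcontfun" where \<eta>: "\<And>s. \<eta> s = weighted \<alpha> v (clamp 0 T s)"
        using ext by blast
      have \<eta>w: "\<eta> t = weighted \<alpha> v t" if "t \<in> {0..T}" for t using that by (simp add: \<eta>)
      have "\<Theta> \<eta> s = \<eta> s" for s
      proof -
        have "\<Theta> \<eta> s = \<Psi> (weighted \<alpha> v) (clamp 0 T s)"
          unfolding \<Theta> by (rule \<Psi>_cong[OF _ wc \<eta>w clamp_in]) simp_all
        also have "\<dots> = weighted \<alpha> v (clamp 0 T s)"
          \<comment> \<open>The mild equation gives the identity for t > 0 only; continuity of both
            sides carries it to the left endpoint.\<close>
          using mild_iff[OF v(1)] v(2) by (intro continuous_on_eq_at_left_end[OF T \<Psi>_cont[OF wc] wc _ clamp_in]) simp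
        finally show ?thesis by (simp add: \<eta>)
      qed
      then show ?thesis using \<eta>w by (intro exI[of _ \<eta>]) (auto intro: bcontfun_eqI)
    qed
    fix v w assume v: "v \<in> weighted_space \<alpha> T \<and> mild_solution \<alpha> T D A f (volterra r) x g v"
      and w: "w \<in> weighted_space \<alpha> T \<and> mild_solution \<alpha> T D A f (volterra r) x g w"
    then have eq: "weighted \<alpha> v t = weighted \<alpha> w t" if "t \<in> {0..T}" for t
      using fixed[of v] fixed[of w] unique that by metis
    have "u (weighted \<alpha> v) = u (weighted \<alpha> w)"
      unfolding u_def unweighted_def by (rule restrict_ext) (simp add: eq)
    then show "v = w"
      using v w by (simp add: u_def unweighted_weighted)
  qed
qed

end
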